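(* Let $n\ge1$. The $\mathbb{P}M$-monoid $\mathscr{R}_n=\overline{N_{\mathrm{PGL}_n}(T)}/T$ has a monoid presentation with generating set $$\{s_1,\dots,s_{n-1}\}\cup\{e_{k_1,\dots,k_{m-1}}\ :\ 1\le k_1<\dots<k_{m-1}<n\}$$ and defining relations: 1. $s_i^2=1$ for $1\le i\le n-1$; 2. $s_is_j=s_js_i$ for $1\le i,j\le n-1$, $|i-j|\ge2$; 3. $s_is_{i+1}s_i=s_{i+1}s_is_{i+1}$ for $1\le i\le n-2$; 4. $e_{k_1,\dots,k_{m-1}}s_i=s_ie_{k_1,\dots,k_{m-1}}$ whenever $1\le i\le n-1$, $1\le k_1<\dots<k_{m-1}<n$, and $\{i,i+1\}\subseteq\{k_{j-1}+1,\dots,k_j\}$ for some $j\in\{1,\dots,m\}$; 5. $e_{k_1,\dots,k_{m-1}}\,s_{i_1}\cdots s_{i_r}\,e_{l_1,\dots,l_{m'-1}}=\mathrm{Ad}(s_{j_1}\cdots s_{j_t})(e_q)\,s_{i_1}\cdots s_{i_r}$ whenever $1\le k_1<\dots<k_{m-1}<n$, $1\le l_1<\dots<l_{m'-1}<n$, $\{i_1,i_1+1\}\nsubseteq\{k_{l-1}+1,\dots,k_l\}$ for all $l=1,\dots,m$, and $$q=u^{s_{j_1}\cdots s_{j_t}}\Bigl((k_1,\dots,k_{m-1})*\varphi_{(s_{i_1}\cdots s_{i_r})^{-1}}\bigl((l_1,\dots,l_{m'-1})\bigr)\Bigr)\in\Pi_n .$$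
   Context: **Presentations.** A monoid has presentation $\langle X\mid R\rangle$ if it is isomorphic to $X^*/R^\#$, where $X^*$ is the free monoid on $X$ and $R^\#$ is the smallest congruence containing $R\subseteq X^*\times X^*$. **Notation in the relations.** $k_0=0$, $k_m=n$. The symbol $e_{k_1,\dots,k_{m-1}}$ with $m=1$ (empty index sequence) is the identity $1$. $P_n$ is the set of ordered set partitions of $\{1,\dots,n\}$ into nonempty blocks, with product $$(p_1,\dots,p_m)*(p_1',\dots,p'_{m'})=(p_1\cap p_1',\dots,p_m\cap p_1',\dots,p_1\cap p'_{m'},\dots,p_m\cap p'_{m'}),$$ empty intersections removed. A sequence $1\le k_1<\dots<k_{m-1}<n$ is identified with the ordered set partition $(k_1,\dots,k_{m-1})=(\{1,\dots,k_1\},\{k_1+1,\dots,k_2\},\dots,\{k_{m-1}+1,\dots,n\})$, and $\Pi_n\subseteq P_n$ is the set of all such partitions; for $q\in\Pi_n$, $e_q$ is the corresponding generator. For $\sigma\in S_n$, $\varphi_\sigma:P_n\to P_n$ is $(p_1,\dots,p_m)\mapsto(\sigma^{-1}(p_1),\dots,\sigma^{-1}(p_m))$. For $p=(p_1,\dots,p_m)\in P_n$ and $w\in S_n$ with $(w(p_1),\dots,w(p_m))\in\Pi_n$, $u^w(p)=(w(p_1),\dots,w(p_m))$. Whenever a word in the $s_i$ appears in $\varphi$ or $u$, it denotes the corresponding element of $S_n$, with $s_i$ the transposition $(i,i+1)$ and permutations composed right to left. $\mathrm{Ad}(\sigma)(e)=\sigma^{-1}e\sigma$, the inverse of $s_{j_1}\cdots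 s_{j_t}$ being $s_{j_t}\cdots s_{j_1}$. **The space $\mathbb{P}M$.** Let $V=\mathbb{C}^n$. Let $M$ be the set of finite sequences $(A_0,\dots,A_m)$, $m\ge 0$, with $0\ne A_i\in\mathrm{Hom}(V_i,V)$, $V_0=V$, $V_{i+1}=\mathrm{Ker}(A_i)$ for $0\le i\le m$, and $V_{m+1}=0$. Write $V(\mathbb{A})_i=V_i$. Let $\mathbb{P}M$ be the set of sequences $(\overline{A_0},\dots,\overline{A_m})$ of classes $\overline{A_i}\in\mathbb{P}\mathrm{Hom}(V_i,V)$ with $(A_0,\dots,A_m)\in M$. $\mathrm{PGL}_n$ is the set of one-term elements of $\mathbb{P}M$. **Topology.** For $\mathbb{A}=(A_0,\dots,A_m)\in M$ and neighbourhoods $U_i$ of $\overline{A_i}$ in $\mathbb{P}\mathrm{Hom}(V(\mathbb{A})_i,V)$ (classical topology), let $U(U_0,\dots,U_m)$ be the set of $(\overline{B_0},\dots,\overline{B_{r}})\in\mathbb{P}M$ such that for every $i\in\{0,\dots,m\}$ there is $j\in\{0,\dots,r\}$ with $V(\mathbb{B})_j\supseteq V(\mathbb{A})_i$ and $\overline{B_j|_{V(\mathbb{A})_i}}\in U_i$. These sets form a base of neighbourhoods of $\mathbb{P}\mathbb{A}$ and define the topology of $\mathbb{P}M$. **The monoid $\mathscr{R}_n$.** Let $T$ be a maximal torus of $\mathrm{PGL}_n$; choose a basis of $V$ in which $T$ is diagonal, with the Hermitian inner product making this basis orthonormal. For a subspace $W\subseteq V$, regard $\mathrm{Hom}(W,V)\subseteq\mathrm{End}(V)$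 via extension by $0$ on $W^\perp$. The closure $\overline{N_{\mathrm{PGL}_n}(T)}$ is taken in $\mathbb{P}M$. It is a monoid under $$(A_0,\dots,A_m)(B_0,\dots,B_r)=(A_0B_0,A_1B_0,\dots,A_mB_0,A_0B_1,\dots,A_mB_1,\dots,A_0B_r,\dots,A_mB_r)$$ with redundant matrices removed, a matrix being redundant if its kernel contains the intersection of the kernels of the preceding matrices in the list. $\mathscr{R}_n=\overline{N_{\mathrm{PGL}_n}(T)}/T$ is the quotient by multiplication by $T$, with the induced product. *)

theory Defs
  imports
    "HOL-Analysis.Analysis"
    "HOL-Algebra.Group_Action"
    "HOL-Algebra.Product_Groups"
    "HOL-Combinatorics.Transposition"
begin

section \<open>Monoid presentations\<close>

text \<open>The free monoid on \<open>X\<close> is the set \<open>lists X\<close> of words under concatenation.\<close>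

definition congruence_on :: "'g set \<Rightarrow> ('g list \<times> 'g list) set \<Rightarrow> bool" where
  "congruence_on X C \<longleftrightarrow> equiv (lists X) C \<and>
     (\<forall>u v u' v'. (u, v) \<in> C \<longrightarrow> (u', v') \<in> C \<longrightarrow> (u @ u', v @ v') \<in> C)"

definition generated_congruence ::
  "'g set \<Rightarrow> ('g list \<times> 'g list) set \<Rightarrow> ('g list \<times> 'g list) set" where
  "generated_congruence X R = \<Inter>{C. congruence_on X C \<and> R \<subseteq> C}"

definition presented_monoid :: "'g set \<Rightarrow> ('g list \<times> 'g list) set \<Rightarrow> 'g list set monoid" where
  "presented_monoid X R = (let C = generated_congruence X R in
     \<lparr>carrier = lists X // C,
      mult = (\<lambda>P Q. \<Union>u\<in>P. \<Union>v\<in>Q. C `` {u @ v}),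
      one = C `` {[]}\<rparr>)"

text \<open>The library's \<open>iso\<close> only preserves products, hence the clause on the units.\<close>

definition has_presentation ::
  "('a, 'b) monoid_scheme \<Rightarrow> 'g set \<Rightarrow> ('g list \<times> 'g list) set \<Rightarrow> bool" where
  "has_presentation G X R \<longleftrightarrow> monoid G \<and> R \<subseteq> lists X \<times> lists X \<and>
     (\<exists>h \<in> iso (presented_monoid X R) G. h \<one>\<^bsub>presented_monoid X R\<^esub> = \<one>\<^bsub>G\<^esub>)"


section \<open>The generators and relations\<close>

text \<open>\<open>Gen_e ks\<close> stands for \<open>e\<close> with index sequence \<open>ks\<close>; it is a generator only
  for nonempty \<open>ks\<close>, since \<open>e\<close> with empty index sequence is the identity.\<close>

datatype gen = Gen_s nat | Gen_e "nat list"

definition index_seq :: "nat \<Rightarrow> nat list \<Rightarrow> bool" where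
  "index_seq n ks \<longleftrightarrow> sorted_wrt (<) ks \<and> set ks \<subseteq> {1..<n}"

definition generators :: "nat \<Rightarrow> gen set" where
  "generators n = Gen_s ` {1..<n} \<union> Gen_e ` {ks. index_seq n ks \<and> ks \<noteq> []}"

definition s_word :: "nat list \<Rightarrow> gen list" where
  "s_word = map Gen_s"

definition e_word :: "nat list \<Rightarrow> gen list" where
  "e_word ks = (if ks = [] then [] else [Gen_e ks])"

text \<open>Ordered set partitions are lists of blocks; \<open>interval_partition n ks\<close> is the
  partition identified with \<open>ks\<close>, and \<open>\<Pi>\<^sub>n\<close> is its range over all \<open>ks\<close> with \<open>index_seq n ks\<close>.\<close>

definition interval_partition :: "nat \<Rightarrow> nat list \<Rightarrow> nat set list" where
  "interval_partition n ks = map2 (\<lambda>a b. {a + 1..b}) (0 # ks) (ks @ [n])"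

definition partition_mult :: "nat set list \<Rightarrow> nat set list \<Rightarrow> nat set list" where
  "partition_mult p p' = filter (\<lambda>b. b \<noteq> {}) [a \<inter> b. b \<leftarrow> p', a \<leftarrow> p]"

definition phi_map :: "(nat \<Rightarrow> nat) \<Rightarrow> nat set list \<Rightarrow> nat set list" where
  "phi_map \<sigma> p = map (\<lambda>b. inv_into UNIV \<sigma> ` b) p"

definition u_map :: "(nat \<Rightarrow> nat) \<Rightarrow> nat set list \<Rightarrow> nat set list" where
  "u_map w p = map (\<lambda>b. w ` b) p"

definition word_perm :: "nat list \<Rightarrow> nat \<Rightarrow> nat" where
  "word_perm ii = foldr (\<lambda>i \<sigma>. Transposition.transpose i (i + 1) \<circ> \<sigma>) ii id"

inductive_set relations :: "nat \<Rightarrow> (gen list \<times> gen list) set" for n :: nat where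
  square: "i \<in> {1..<n} \<Longrightarrow> (s_word [i, i], []) \<in> relations n"
| commute: "\<lbrakk>i \<in> {1..<n}; j \<in> {1..<n}; \<bar>int i - int j\<bar> \<ge> 2\<rbrakk> \<Longrightarrow>
    (s_word [i, j], s_word [j, i]) \<in> relations n"
| braid: "\<lbrakk>i \<in> {1..<n}; i + 1 \<in> {1..<n}\<rbrakk> \<Longrightarrow>
    (s_word [i, i + 1, i], s_word [i + 1, i, i + 1]) \<in> relations n"
| e_s: "\<lbrakk>i \<in> {1..<n}; index_seq n ks; b \<in> set (interval_partition n ks); {i, i + 1} \<subseteq> b\<rbrakk> \<Longrightarrow>
    (e_word ks @ s_word [i], s_word [i] @ e_word ks) \<in> relations n"
| e_s_e: "\<lbrakk>index_seq n ks; index_seq n ls; index_seq n qs;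
      ii \<noteq> []; set ii \<subseteq> {1..<n}; set jj \<subseteq> {1..<n};
      \<forall>b \<in> set (interval_partition n ks). \<not> {hd ii, hd ii + 1} \<subseteq> b;
      interval_partition n qs =
        u_map (word_perm jj)
          (partition_mult (interval_partition n ks)
            (phi_map (inv_into UNIV (word_perm ii)) (interval_partition n ls)))\<rbrakk> \<Longrightarrow>
    (e_word ks @ s_word ii @ e_word ls,
     s_word (rev jj) @ e_word qs @ s_word jj @ s_word ii) \<in> relations n"


section \<open>The space \<open>\<P>M\<close>\<close>

text \<open>\<open>V\<close> is \<^typ>\<open>complex ^ 'n\<close>, so that \<open>n = CARD('n)\<close>. An element of \<open>Hom(W, V)\<close>
  is an extensional function on \<open>W\<close>.\<close>

type_synonym 'n vmap = "complex ^ 'n \<Rightarrow> complex ^ 'n"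

definition hom_space :: "(complex ^ 'n) set \<Rightarrow> 'n vmap set" where
  "hom_space W = {A \<in> extensional W.
     (\<forall>x\<in>W. \<forall>y\<in>W. A (x + y) = A x + A y) \<and> (\<forall>c. \<forall>x\<in>W. A (c *s x) = c *s A x)}"

definition nonzero_hom :: "(complex ^ 'n) set \<Rightarrow> 'n vmap set" where
  "nonzero_hom W = {A \<in> hom_space W. \<exists>x\<in>W. A x \<noteq> 0}"

definition proj_class :: "(complex ^ 'n) set \<Rightarrow> 'n vmap \<Rightarrow> 'n vmap set" where
  "proj_class W A = {restrict (\<lambda>x. c *s A x) W | c. c \<noteq> 0}"

definition proj_hom :: "(complex ^ 'n) set \<Rightarrow> 'n vmap set set" where
  "proj_hom W = proj_class W ` nonzero_hom W"

text \<open>\<open>V(\<AA>)\<^sub>i\<close>\<close>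

fun flag :: "('n::finite) vmap list \<Rightarrow> nat \<Rightarrow> (complex ^ 'n) set" where
  "flag As 0 = UNIV"
| "flag As (Suc i) = {x \<in> flag As i. (As ! i) x = 0}"

definition M_seqs :: "('n::finite) vmap list set" where
  "M_seqs = {As. As \<noteq> [] \<and> (\<forall>i<length As. As ! i \<in> nonzero_hom (flag As i)) \<and>
        flag As (length As) = {0}}"

definition proj_seq :: "('n::finite) vmap list \<Rightarrow> 'n vmap set list" where
  "proj_seq As = map (\<lambda>i. proj_class (flag As i) (As ! i)) [0..<length As]"

definition PM :: "('n::finite) vmap set list set" where
  "PM = proj_seq ` M_seqs"

text \<open>The classical topology of \<open>\<P>Hom(W, V)\<close> is the quotient of the vector space topology
  of \<open>Hom(W, V) - {0}\<close>; as \<open>W\<close> is finite dimensional, the latter is the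
  topology of pointwise convergence.\<close>

definition nonzero_hom_top :: "(complex ^ 'n::finite) set \<Rightarrow> 'n vmap topology" where
  "nonzero_hom_top W = subtopology (product_topology (\<lambda>_. euclidean) W) (nonzero_hom W)"

definition proj_hom_top :: "(complex ^ 'n::finite) set \<Rightarrow> 'n vmap set topology" where
  "proj_hom_top W = topology (\<lambda>U. U \<subseteq> proj_hom W \<and>
     openin (nonzero_hom_top W) {A \<in> nonzero_hom W. proj_class W A \<in> U})"

lemma openin_proj_hom_top:
  "openin (proj_hom_top W) U \<longleftrightarrow> U \<subseteq> proj_hom W \<and>
     openin (nonzero_hom_top W) {A \<in> nonzero_hom W. proj_class W A \<in> U}"
proof -
  have "istopology (\<lambda>U. U \<subseteq> proj_hom W \<and>
     openin (nonzero_hom_top W) {A \<in> nonzero_hom W. proj_class W A \<in> U})"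
    unfolding istopology_def
  proof (intro conjI allI impI)
    fix S T assume
      S: "S \<subseteq> proj_hom W \<and> openin (nonzero_hom_top W) {A \<in> nonzero_hom W. proj_class W A \<in> S}" and
      T: "T \<subseteq> proj_hom W \<and> openin (nonzero_hom_top W) {A \<in> nonzero_hom W. proj_class W A \<in> T}"
    show "S \<inter> T \<subseteq> proj_hom W" using S by blast
    have "{A \<in> nonzero_hom W. proj_class W A \<in> S \<inter> T} =
        {A \<in> nonzero_hom W. proj_class W A \<in> S} \<inter> {A \<in> nonzero_hom W. proj_class W A \<in> T}"
      by blast
    then show "openin (nonzero_hom_top W) {A \<in> nonzero_hom W. proj_class W A \<in> S \<inter> T}"
      using S T by (simp add: openin_Int)
  next
    fix K assume K: "\<forall>S\<in>K. S \<subseteq> proj_hom W \<and>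
        openin (nonzero_hom_top W) {A \<in> nonzero_hom W. proj_class W A \<in> S}"
    show "\<Union>K \<subseteq> proj_hom W" using K by blast
    have "{A \<in> nonzero_hom W. proj_class W A \<in> \<Union>K} =
        (\<Union>S\<in>K. {A \<in> nonzero_hom W. proj_class W A \<in> S})"
      by blast
    then show "openin (nonzero_hom_top W) {A \<in> nonzero_hom W. proj_class W A \<in> \<Union>K}"
      using K by (auto intro!: openin_Union)
  qed
  then show ?thesis unfolding proj_hom_top_def by simp
qed

definition basic_nbhd ::
  "('n::finite) vmap list \<Rightarrow> (nat \<Rightarrow> 'n vmap set set) \<Rightarrow> 'n vmap set list set" where
  "basic_nbhd As U = {proj_seq Bs | Bs. Bs \<in> M_seqs \<and>
     (\<forall>i<length As. \<exists>j<length Bs. flag As i \<subseteq> flag Bs j \<and>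
        proj_class (flag As i) (restrict (Bs ! j) (flag As i)) \<in> U i)}"

definition PM_open :: "('n::finite) vmap set list set \<Rightarrow> bool" where
  "PM_open S \<longleftrightarrow> S \<subseteq> PM \<and> (\<forall>As\<in>M_seqs. proj_seq As \<in> S \<longrightarrow>
     (\<exists>U. (\<forall>i<length As. openin (proj_hom_top (flag As i)) (U i) \<and>
                          proj_class (flag As i) (As ! i) \<in> U i) \<and>
          basic_nbhd As U \<subseteq> S))"

definition PM_top :: "('n::finite) vmap set list topology" where
  "PM_top = topology PM_open"

lemma openin_PM_top:
  fixes S :: "('n::finite) vmap set list set"
  shows "openin PM_top S \<longleftrightarrow> PM_open S"
proof -
  have "istopology (PM_open :: ('n vmap set list set \<Rightarrow> bool))"
    unfolding istopology_def
  proof (intro conjI allI impI)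
    fix S T :: "'n vmap set list set" assume S: "PM_open S" and T: "PM_open T"
    show "PM_open (S \<inter> T)" unfolding PM_open_def
    proof (intro conjI ballI impI)
      show "S \<inter> T \<subseteq> PM" using S unfolding PM_open_def by blast
    next
      fix As :: "'n vmap list" assume As: "As \<in> M_seqs" "proj_seq As \<in> S \<inter> T"
      obtain U where U: "\<forall>i<length As. openin (proj_hom_top (flag As i)) (U i) \<and>
          proj_class (flag As i) (As ! i) \<in> U i" "basic_nbhd As U \<subseteq> S"
        using S As unfolding PM_open_def by blast
      obtain U' where U': "\<forall>i<length As. openin (proj_hom_top (flag As i)) (U' i) \<and>
          proj_class (flag As i) (As ! i) \<in> U' i" "basic_nbhd As U' \<subseteq> T"
        using T As unfolding PM_open_def by blast
      have "basic_nbhd As (\<lambda>i. U i \<inter> U' i) \<subseteq> S \<inter> T"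
      proof -
        have "basic_nbhd As (\<lambda>i. U i \<inter> U' i) \<subseteq> basic_nbhd As U"
          "basic_nbhd As (\<lambda>i. U i \<inter> U' i) \<subseteq> basic_nbhd As U'"
          unfolding basic_nbhd_def by fast+
        then show ?thesis using U(2) U'(2) by blast
      qed
      then show "\<exists>U. (\<forall>i<length As. openin (proj_hom_top (flag As i)) (U i) \<and>
                          proj_class (flag As i) (As ! i) \<in> U i) \<and>
          basic_nbhd As U \<subseteq> S \<inter> T"
        using U(1) U'(1) by (intro exI[of _ "\<lambda>i. U i \<inter> U' i"]) (simp add: openin_Int)
    qed
  next
    fix K :: "'n vmap set list set set" assume K: "\<forall>S\<in>K. PM_open S"
    show "PM_open (\<Union>K)" unfolding PM_open_def
    proof (intro conjI ballI impI)
      show "\<Union>K \<subseteq> PM" using K unfolding PM_open_def by blast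
    next
      fix As :: "'n vmap list" assume As: "As \<in> M_seqs" "proj_seq As \<in> \<Union>K"
      then obtain S where S: "S \<in> K" "proj_seq As \<in> S" by blast
      then obtain U where U: "\<forall>i<length As. openin (proj_hom_top (flag As i)) (U i) \<and>
          proj_class (flag As i) (As ! i) \<in> U i" "basic_nbhd As U \<subseteq> S"
        using K As(1) unfolding PM_open_def by blast
      then show "\<exists>U. (\<forall>i<length As. openin (proj_hom_top (flag As i)) (U i) \<and>
                          proj_class (flag As i) (As ! i) \<in> U i) \<and>
          basic_nbhd As U \<subseteq> \<Union>K" using S(1) by blast
    qed
  qed
  then show ?thesis unfolding PM_top_def by simp
qed


section \<open>\<open>PGL\<^sub>n\<close> and its maximal tori\<close>

definition PGL :: "('n::finite) vmap set list monoid" where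
  "PGL = \<lparr>carrier = {P \<in> PM. length P = 1},
          mult = (\<lambda>P Q. [{A \<circ> B | A B. A \<in> hd P \<and> B \<in> hd Q}]),
          one = proj_seq [id]\<rparr>"

text \<open>Coordinate rings are rendered as rings of complex-valued functions.\<close>

inductive_set function_algebra :: "('a \<Rightarrow> complex) set \<Rightarrow> ('a \<Rightarrow> complex) set"
  for S :: "('a \<Rightarrow> complex) set" where
  gen: "f \<in> S \<Longrightarrow> f \<in> function_algebra S"
| const: "(\<lambda>_. c) \<in> function_algebra S"
| add: "\<lbrakk>f \<in> function_algebra S; g \<in> function_algebra S\<rbrakk> \<Longrightarrow> (\<lambda>x. f x + g x) \<in> function_algebra S"
| mult: "\<lbrakk>f \<in> function_algebra S; g \<in> function_algebra S\<rbrakk> \<Longrightarrow> (\<lambda>x. f x * g x) \<in> function_algebra S"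

text \<open>\<open>\<O>(GL\<^sub>n)\<close> is generated by the matrix entries and the inverse of the determinant.\<close>

definition regular_GL :: "(('n::finite) vmap \<Rightarrow> complex) set" where
  "regular_GL = function_algebra
     ({\<lambda>A. matrix A $ i $ j | i j. True} \<union> {\<lambda>A. inverse (det (matrix A))})"

text \<open>\<open>\<O>(PGL\<^sub>n)\<close> consists of the functions on \<open>PGL\<^sub>n\<close> whose pullback along
  \<open>GL\<^sub>n \<rightarrow> PGL\<^sub>n\<close> is regular, \<open>PGL\<^sub>n\<close> being the quotient of \<open>GL\<^sub>n\<close> by the scalars.\<close>

definition regular_PGL :: "(('n::finite) vmap set list \<Rightarrow> complex) set" where
  "regular_PGL = {f. \<exists>F\<in>regular_GL. \<forall>A. [A] \<in> M_seqs \<longrightarrow> f (proj_seq [A]) = F A}"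

definition zariski_closed_PGL :: "('n::finite) vmap set list set \<Rightarrow> bool" where
  "zariski_closed_PGL T \<longleftrightarrow>
     (\<exists>F \<subseteq> regular_PGL. T = {P \<in> carrier PGL. \<forall>f\<in>F. f P = 0})"

definition Gm :: "complex monoid" where
  "Gm = \<lparr>carrier = - {0}, mult = (*), one = 1\<rparr>"

definition Gm_power :: "nat \<Rightarrow> (nat \<Rightarrow> complex) monoid" where
  "Gm_power k = product_group {..<k} (\<lambda>_. Gm)"

definition regular_Gm_power :: "nat \<Rightarrow> ((nat \<Rightarrow> complex) \<Rightarrow> complex) set" where
  "regular_Gm_power k = function_algebra
     ({\<lambda>t. t i | i. i < k} \<union> {\<lambda>t. inverse (t i) | i. i < k})"

text \<open>A torus is a closed subgroup isomorphic, as an algebraic group, to a power of the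
  multiplicative group: \<open>h\<close> is a group isomorphism that induces a bijection between the
  coordinate rings.\<close>

definition torus :: "('n::finite) vmap set list set \<Rightarrow> bool" where
  "torus T \<longleftrightarrow> subgroup T PGL \<and> zariski_closed_PGL T \<and>
     (\<exists>k. \<exists>h \<in> iso (Gm_power k) (PGL\<lparr>carrier := T\<rparr>). \<forall>g.
        (\<exists>f\<in>regular_PGL. \<forall>P\<in>T. g P = f P) \<longleftrightarrow>
        (\<exists>f\<in>regular_Gm_power k. \<forall>t\<in>carrier (Gm_power k). g (h t) = f t))"

definition maximal_torus :: "('n::finite) vmap set list set \<Rightarrow> bool" where
  "maximal_torus T \<longleftrightarrow> torus T \<and> (\<forall>T'. torus T' \<longrightarrow> T \<subseteq> T' \<longrightarrow> T' = T)"

definition is_basis :: "(complex ^ 'n::finite) set \<Rightarrow> bool" where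
  "is_basis E \<longleftrightarrow> vec.independent E \<and> vec.span E = UNIV"

definition diagonal_in :: "(complex ^ 'n::finite) set \<Rightarrow> 'n vmap set list set \<Rightarrow> bool" where
  "diagonal_in E T \<longleftrightarrow> (\<forall>P\<in>T. \<forall>A\<in>hd P. \<forall>v\<in>E. \<exists>c. A v = c *s v)"


section \<open>The monoid \<open>\<R>\<^sub>n\<close>\<close>

text \<open>The Hermitian inner product for which the basis \<open>E\<close> is orthonormal\<close>

definition herm :: "(complex ^ 'n::finite) set \<Rightarrow> complex ^ 'n \<Rightarrow> complex ^ 'n \<Rightarrow> complex" where
  "herm E x y = (\<Sum>v\<in>E. cnj (vec.representation E x v) * vec.representation E y v)"

definition orth_compl ::
  "(complex ^ 'n::finite) set \<Rightarrow> (complex ^ 'n) set \<Rightarrow> (complex ^ 'n) set" where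
  "orth_compl E W = {x. \<forall>w\<in>W. herm E w x = 0}"

definition extend_zero :: "(complex ^ 'n::finite) set \<Rightarrow> (complex ^ 'n) set \<Rightarrow> 'n vmap \<Rightarrow> 'n vmap" where
  "extend_zero E W A = (\<lambda>x. A (THE w. w \<in> W \<and> x - w \<in> orth_compl E W))"

definition extend_list :: "(complex ^ 'n::finite) set \<Rightarrow> 'n vmap list \<Rightarrow> 'n vmap list" where
  "extend_list E As = map (\<lambda>i. extend_zero E (flag As i) (As ! i)) [0..<length As]"

definition preceding_kernels :: "('n::finite) vmap list \<Rightarrow> nat \<Rightarrow> (complex ^ 'n) set" where
  "preceding_kernels Cs i = (\<Inter>j<i. {x. (Cs ! j) x = 0})"

definition remove_redundant :: "('n::finite) vmap list \<Rightarrow> 'n vmap list" where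
  "remove_redundant Cs =
     nths Cs {i. \<not> preceding_kernels Cs i \<subseteq> {x. (Cs ! i) x = 0}}"

text \<open>Restriction to \<open>W\<close> inverts extension by zero on the orthogonal complement of \<open>W\<close>, so it
  turns a list of matrices back into a sequence of elements of \<open>Hom(V\<^sub>i, V)\<close>.\<close>

definition restrict_list :: "('n::finite) vmap list \<Rightarrow> 'n vmap list" where
  "restrict_list Cs = map (\<lambda>i. restrict (Cs ! i) (preceding_kernels Cs i)) [0..<length Cs]"

definition M_mult :: "(complex ^ 'n::finite) set \<Rightarrow> 'n vmap list \<Rightarrow> 'n vmap list \<Rightarrow> 'n vmap list" where
  "M_mult E As Bs = restrict_list (remove_redundant
     [A \<circ> B. B \<leftarrow> extend_list E Bs, A \<leftarrow> extend_list E As])"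

definition representative :: "('n::finite) vmap set list \<Rightarrow> 'n vmap list" where
  "representative P = (SOME As. As \<in> M_seqs \<and> proj_seq As = P)"

definition PM_mult ::
  "(complex ^ 'n::finite) set \<Rightarrow> 'n vmap set list \<Rightarrow> 'n vmap set list \<Rightarrow> 'n vmap set list" where
  "PM_mult E P Q = proj_seq (M_mult E (representative P) (representative Q))"

definition normalizer_closure ::
  "(complex ^ 'n::finite) set \<Rightarrow> 'n vmap set list set \<Rightarrow> 'n vmap set list monoid" where
  "normalizer_closure E T =
     \<lparr>carrier = PM_top closure_of (normalizer PGL T), mult = PM_mult E, one = proj_seq [id]\<rparr>"

text \<open>The library's quotient by cosets: its elements are the orbits \<open>T P\<close>, multiplied
  elementwise. On the closure of the normalizer \<open>T P = P T\<close>, so this is the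
  product induced on the quotient.\<close>

definition R_monoid ::
  "(complex ^ 'n::finite) set \<Rightarrow> 'n vmap set list set \<Rightarrow> 'n vmap set list set monoid" where
  "R_monoid E T = normalizer_closure E T Mod T"

end

theory Submission
  imports Defs "HOL-Combinatorics.Permutations"
begin

text \<open>In a basis in which \<open>T\<close> is diagonal, the normalizer of \<open>T\<close> consists of the classes of
  monomial matrices: a permutation \<open>\<sigma>\<close> and nonzero coefficients. Passing to the closure keeps
  the permutation and lets the coefficients degenerate at different speeds. The coordinates that
  decay at the \<open>j\<close>-th speed are those on which the \<open>j\<close>-th map of the limit sequence lives, so the
  limit remembers an ordered set partition \<open>p\<close> of \<open>{1..n}\<close>, and its coefficients are determined
  up to one scalar for each block. Multiplication by \<open>T\<close> changes the coefficients arbitrarily.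
  Hence the points of the quotient are the pairs \<open>(p, \<sigma>)\<close>, and composing partial monomial maps
  and discarding the zero ones gives the product
  \<open>(p, \<sigma>) (q, \<tau>) = (\<tau>\<^sup>-\<^sup>1(p) * q, \<sigma> \<circ> \<tau>)\<close>.

  Three facts make this precise. The group of all diagonal classes is a torus, so the maximal
  torus \<open>T\<close>, which is contained in it, equals it (\<open>maximal_torus_diagonal\<close>). The condition
  "if the \<open>i\<close>-th coordinate of \<open>x\<close> vanishes then so does the \<open>\<sigma>(i)\<close>-th coordinate of the image of
  \<open>x\<close>" is closed, and a sequence that satisfies it for a fixed \<open>\<sigma>\<close> is given by an ordered set
  partition and coefficients; conversely such a sequence is the limit, for \<open>t \<rightarrow> 0\<close>, of the
  monomial matrices whose coefficients in block \<open>j\<close> are multiplied by \<open>t\<^sup>j\<close>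
  (\<open>closure_one_block\<close>). Finally the \<open>T\<close>-orbits multiply like pairs (\<open>orbit_iso\<close>).

  It remains to present the monoid of pairs. The relations allow every word to be rewritten
  as \<open>w v\<^sup>-\<^sup>1 e\<^sub>q v\<close> with words \<open>w\<close>, \<open>v\<close> in the simple transpositions (\<open>exists_normal_word\<close>): the
  last family of relations merges two idempotents into one, after \<open>s\<^sub>i s\<^sub>i\<close> has been inserted, for
  an \<open>i\<close> at which two blocks meet, to satisfy its condition on the first letter. The value of
  such a word is the pair \<open>(v\<^sup>-\<^sup>1(q), w)\<close>. Two of them with the same value are congruent
  (\<open>normal_word_unique\<close>), by the Coxeter presentation of the symmetric group and by the
  instance \<open>e\<^sub>k = v\<^sup>-\<^sup>1 e\<^sub>q v\<close>, for \<open>v(k) = q\<close>, of the last family.\<close>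

section \<open>Presentations from normal forms\<close>

lemma congruence_on_Times: "congruence_on X (lists X \<times> lists X)"
  unfolding congruence_on_def equiv_def refl_on_def sym_def trans_def by auto

lemma congruence_on_generated:
  assumes "R \<subseteq> lists X \<times> lists X"
  shows "congruence_on X (generated_congruence X R)"
proof -
  let ?F = "{C. congruence_on X C \<and> R \<subseteq> C}"
  have top: "lists X \<times> lists X \<in> ?F" using assms congruence_on_Times by blast
  have F: "equiv (lists X) C" "\<And>u v u' v'. (u, v) \<in> C \<Longrightarrow> (u', v') \<in> C \<Longrightarrow> (u @ u', v @ v') \<in> C"
    if "C \<in> ?F" for C
    using that unfolding congruence_on_def by simp_all
  have "equiv (lists X) (\<Inter>?F)"
  proof (rule equivI)
    show "\<Inter>?F \<subseteq> lists X \<times> lists X" using top by (rule Inter_lower)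
    show "refl_on (lists X) (\<Inter>?F)"
    proof (intro refl_onI InterI)
      fix u C assume "u \<in> lists X" and C: "C \<in> ?F"
      then show "(u, u) \<in> C" using F(1)[OF C] unfolding equiv_def by (blast dest: refl_onD)
    qed
    show "sym (\<Inter>?F)"
    proof (intro symI InterI)
      fix u v C assume uv: "(u, v) \<in> \<Inter>?F" and C: "C \<in> ?F"
      show "(v, u) \<in> C"
        using F(1)[OF C] InterD[OF uv C] unfolding equiv_def by (blast dest: symD)
    qed
    show "trans (\<Inter>?F)"
    proof (intro transI InterI)
      fix u v w C assume uv: "(u, v) \<in> \<Inter>?F" "(v, w) \<in> \<Inter>?F" and C: "C \<in> ?F"
      show "(u, w) \<in> C"
        using F(1)[OF C] InterD[OF uv(1) C] InterD[OF uv(2) C] unfolding equiv_def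
        by (blast dest: transD)
    qed
  qed
  moreover have "(u @ u', v @ v') \<in> \<Inter>?F" if "(u, v) \<in> \<Inter>?F" "(u', v') \<in> \<Inter>?F" for u v u' v'
  proof (rule InterI)
    fix C assume C: "C \<in> ?F"
    show "(u @ u', v @ v') \<in> C"
      by (rule F(2)[OF C InterD[OF that(1) C] InterD[OF that(2) C]])
  qed
  ultimately show ?thesis unfolding congruence_on_def generated_congruence_def by blast
qed

lemma generated_congruence_least:
  "congruence_on X C \<Longrightarrow> R \<subseteq> C \<Longrightarrow> generated_congruence X R \<subseteq> C"
  unfolding generated_congruence_def by blast

lemma generated_congruence_superset: "R \<subseteq> generated_congruence X R"
  unfolding generated_congruence_def by blast

definition word_value :: "('a, 'b) monoid_scheme \<Rightarrow> ('g \<Rightarrow> 'a) \<Rightarrow> 'g list \<Rightarrow> 'a" where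
  "word_value G g u = foldr (\<lambda>x a. g x \<otimes>\<^bsub>G\<^esub> a) u \<one>\<^bsub>G\<^esub>"

lemma word_value_simps [simp]:
  "word_value G g [] = \<one>\<^bsub>G\<^esub>" "word_value G g (x # u) = g x \<otimes>\<^bsub>G\<^esub> word_value G g u"
  unfolding word_value_def by simp_all

context monoid
begin

lemma word_value_closed:
  "g ` X \<subseteq> carrier G \<Longrightarrow> u \<in> lists X \<Longrightarrow> word_value G g u \<in> carrier G"
  by (induction u) auto

lemma word_value_append:
  assumes "g ` X \<subseteq> carrier G" "u \<in> lists X" "v \<in> lists X"
  shows "word_value G g (u @ v) = word_value G g u \<otimes> word_value G g v"
  using assms(2)
proof (induction u)
  case Nil
  then show ?case using word_value_closed[OF assms(1,3)] by simp
next
  case (Cons x u)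
  then show ?case
    using word_value_closed[OF assms(1), of u] word_value_closed[OF assms(1,3)] assms(1)
    by (auto simp: m_assoc image_subset_iff)
qed

text \<open>The pairs of words with equal values form a congruence, and it contains the relations.\<close>

lemma word_value_congruent:
  assumes g: "g ` X \<subseteq> carrier G" and R: "R \<subseteq> lists X \<times> lists X"
    and rel: "\<And>u v. (u, v) \<in> R \<Longrightarrow> word_value G g u = word_value G g v"
    and uv: "(u, v) \<in> generated_congruence X R"
  shows "u \<in> lists X" "v \<in> lists X" "word_value G g u = word_value G g v"
proof -
  let ?K = "{(u, v). u \<in> lists X \<and> v \<in> lists X \<and> word_value G g u = word_value G g v}"
  have "congruence_on X ?K"
    unfolding congruence_on_def equiv_def refl_on_def sym_def trans_def
    using word_value_append[OF g] by auto
  moreover have "R \<subseteq> ?K" using R rel by auto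
  ultimately have "generated_congruence X R \<subseteq> ?K" by (rule generated_congruence_least)
  then show "u \<in> lists X" "v \<in> lists X" "word_value G g u = word_value G g v"
    using uv by blast+
qed

text \<open>The evaluation of words is constant on congruence classes; it induces an isomorphism as
  soon as it is onto and does not identify words from different classes.\<close>

lemma has_presentationI:
  assumes g: "g ` X \<subseteq> carrier G"
    and R: "R \<subseteq> lists X \<times> lists X"
    and rel: "\<And>u v. (u, v) \<in> R \<Longrightarrow> word_value G g u = word_value G g v"
    and faithful: "\<And>u v. u \<in> lists X \<Longrightarrow> v \<in> lists X \<Longrightarrow>
      word_value G g u = word_value G g v \<Longrightarrow> (u, v) \<in> generated_congruence X R"
    and onto: "\<And>a. a \<in> carrier G \<Longrightarrow> \<exists>u\<in>lists X. word_value G g u = a"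
  shows "has_presentation G X R"
proof -
  let ?C = "generated_congruence X R"
  let ?e = "word_value G g"
  have C: "congruence_on X ?C" by (rule congruence_on_generated[OF R])
  then have eq: "equiv (lists X) ?C" unfolding congruence_on_def by blast
  have C_iff: "(u, v) \<in> ?C \<longleftrightarrow> u \<in> lists X \<and> v \<in> lists X \<and> ?e u = ?e v" for u v
    using faithful word_value_congruent[OF g R rel] by blast
  let ?P = "presented_monoid X R"
  have carP: "carrier ?P = (\<lambda>u. ?C `` {u}) ` lists X"
    unfolding presented_monoid_def Let_def quotient_def by auto
  have carP_E: thesis if "P \<in> carrier ?P" "\<And>u. u \<in> lists X \<Longrightarrow> P = ?C `` {u} \<Longrightarrow> thesis"
    for P thesis
    using that(1) unfolding carP by (rule imageE) (rule that(2))
  have mulP: "?C `` {u} \<otimes>\<^bsub>?P\<^esub> ?C `` {v} = ?C `` {u @ v}" if "u \<in> lists X" "v \<in> lists X" for u v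
  proof -
    have cl: "?C `` {u' @ v'} = ?C `` {u @ v}" if "(u, u') \<in> ?C" "(v, v') \<in> ?C" for u' v'
    proof -
      have "(u @ v, u' @ v') \<in> ?C" using C that unfolding congruence_on_def by blast
      then show ?thesis using equiv_class_eq[OF eq] by metis
    qed
    have "(u, u) \<in> ?C" "(v, v) \<in> ?C" using that C_iff by blast+
    then have ne: "?C `` {u} \<noteq> {}" "?C `` {v} \<noteq> {}" by blast+
    have "?C `` {u} \<otimes>\<^bsub>?P\<^esub> ?C `` {v} = (\<Union>u'\<in>?C `` {u}. \<Union>v'\<in>?C `` {v}. ?C `` {u' @ v'})"
      unfolding presented_monoid_def Let_def by simp
    also have "\<dots> = (\<Union>u'\<in>?C `` {u}. \<Union>v'\<in>?C `` {v}. ?C `` {u @ v})"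
      by (intro SUP_cong refl cl) auto
    finally show ?thesis using ne by simp
  qed
  define h where "h P = the_elem (?e ` P)" for P
  have h: "h (?C `` {u}) = ?e u" if "u \<in> lists X" for u
  proof -
    have "u \<in> ?C `` {u}" using that C_iff by blast
    moreover have "?e ` (?C `` {u}) \<subseteq> {?e u}"
    proof (rule image_subsetI)
      fix v assume "v \<in> ?C `` {u}"
      then have "(u, v) \<in> ?C" by simp
      then show "?e v \<in> {?e u}" using C_iff[of u v] by simp
    qed
    ultimately have "?e ` (?C `` {u}) = {?e u}" by blast
    then show ?thesis unfolding h_def by simp
  qed
  have "h \<in> hom ?P G"
  proof (rule homI)
    show "h P \<in> carrier G" if P: "P \<in> carrier ?P" for P
    proof -
      obtain u where u: "u \<in> lists X" "P = ?C `` {u}" using carP_E[OF P] .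
      then show ?thesis using h[OF u(1)] word_value_closed[OF g u(1)] by simp
    qed
    show "h (P \<otimes>\<^bsub>?P\<^esub> Q) = h P \<otimes> h Q" if P: "P \<in> carrier ?P" and Q: "Q \<in> carrier ?P" for P Q
    proof -
      obtain u v where uv: "u \<in> lists X" "v \<in> lists X" "P = ?C `` {u}" "Q = ?C `` {v}"
        using carP_E[OF P] carP_E[OF Q] by metis
      then have "u @ v \<in> lists X" by simp
      then show ?thesis unfolding uv(3,4) mulP[OF uv(1,2)]
        using h[OF uv(1)] h[OF uv(2)] h[of "u @ v"] word_value_append[OF g uv(1,2)] by simp
    qed
  qed
  moreover have "bij_betw h (carrier ?P) (carrier G)"
    unfolding bij_betw_def
  proof
    show "inj_on h (carrier ?P)"
    proof (rule inj_onI)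
      fix P Q assume PQ: "P \<in> carrier ?P" "Q \<in> carrier ?P" "h P = h Q"
      then obtain u v where uv: "u \<in> lists X" "v \<in> lists X" "P = ?C `` {u}" "Q = ?C `` {v}"
        using carP_E[OF PQ(1)] carP_E[OF PQ(2)] by metis
      then have "(u, v) \<in> ?C" using PQ(3) h[OF uv(1)] h[OF uv(2)] C_iff by simp
      then show "P = Q" unfolding uv(3,4) by (rule equiv_class_eq[OF eq])
    qed
    show "h ` carrier ?P = carrier G"
    proof
      show "h ` carrier ?P \<subseteq> carrier G"
        using \<open>h \<in> hom ?P G\<close> unfolding hom_def by blast
      show "carrier G \<subseteq> h ` carrier ?P"
      proof
        fix a assume "a \<in> carrier G"
        then obtain u where u: "u \<in> lists X" "?e u = a" using onto by blast
        then have "h (?C `` {u}) = a" using h by simp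
        then show "a \<in> h ` carrier ?P" unfolding carP using u(1) by (metis imageI)
      qed
    qed
  qed
  moreover have "h \<one>\<^bsub>?P\<^esub> = \<one>"
    using h[of "[]"] unfolding presented_monoid_def Let_def by simp
  ultimately show ?thesis
    unfolding has_presentation_def iso_def using R monoid_axioms by blast
qed

end

lemma monoid_iso_image:
  assumes "monoid G" "f \<in> iso G H" "f \<one>\<^bsub>G\<^esub> = \<one>\<^bsub>H\<^esub>"
  shows "monoid H"
proof -
  interpret G: monoid G by fact
  have f: "f ` carrier G = carrier H" "f \<in> hom G H"
    using assms(2) unfolding iso_def bij_betw_def by auto
  have m: "f (a \<otimes>\<^bsub>G\<^esub> b) = f a \<otimes>\<^bsub>H\<^esub> f b" if "a \<in> carrier G" "b \<in> carrier G" for a b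
    using f(2) that by (rule hom_mult)
  show ?thesis
    unfolding monoid_def f(1)[symmetric] assms(3)[symmetric]
    by (auto simp: m[symmetric] G.m_assoc)
qed

lemma has_presentation_iso:
  assumes "has_presentation G X R" "f \<in> iso G H" "f \<one>\<^bsub>G\<^esub> = \<one>\<^bsub>H\<^esub>"
  shows "has_presentation H X R"
proof -
  obtain h where h: "monoid G" "R \<subseteq> lists X \<times> lists X" "h \<in> iso (presented_monoid X R) G"
    "h \<one>\<^bsub>presented_monoid X R\<^esub> = \<one>\<^bsub>G\<^esub>"
    using assms(1) unfolding has_presentation_def by blast
  have "f \<circ> h \<in> iso (presented_monoid X R) H"
    using h(3) assms(2) unfolding iso_def by (auto intro: hom_compose bij_betw_trans)
  moreover have "(f \<circ> h) \<one>\<^bsub>presented_monoid X R\<^esub> = \<one>\<^bsub>H\<^esub>" using h(4) assms(3) by simp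
  ultimately show ?thesis
    unfolding has_presentation_def
    using h monoid_iso_image[OF h(1) assms(2,3)] by blast
qed

section \<open>The monoid of pairs of an ordered set partition and a permutation\<close>

definition ordered_partitions :: "nat \<Rightarrow> nat set list set" where
  "ordered_partitions n = {p. sorted_wrt disjnt p \<and> {} \<notin> set p \<and> \<Union>(set p) = {1..n}}"

definition partition_perm_monoid :: "nat \<Rightarrow> (nat set list \<times> (nat \<Rightarrow> nat)) monoid" where
  "partition_perm_monoid n =
     \<lparr>carrier = ordered_partitions n \<times> {\<sigma>. \<sigma> permutes {1..n}},
      mult = (\<lambda>(p, \<sigma>) (q, \<tau>). (partition_mult (phi_map \<tau> p) q, \<sigma> \<circ> \<tau>)),
      one = ([{1..n}], id)\<rparr>"

text \<open>The list of all intersections before the empty ones are removed. This list is compatible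
  with concatenation, which makes inductions possible.\<close>

definition intersections :: "nat set list \<Rightarrow> nat set list \<Rightarrow> nat set list" where
  "intersections p q = [a \<inter> b. b \<leftarrow> q, a \<leftarrow> p]"

lemma intersections_simps [simp]:
  "intersections p [] = []"
  "intersections p (b # q) = map (\<lambda>a. a \<inter> b) p @ intersections p q"
  "intersections p (q @ q') = intersections p q @ intersections p q'"
  unfolding intersections_def by simp_all

lemma partition_mult_eq: "partition_mult p q = filter (\<lambda>b. b \<noteq> {}) (intersections p q)"
  unfolding partition_mult_def intersections_def ..

lemma set_intersections: "set (intersections p q) = {a \<inter> b | a b. a \<in> set p \<and> b \<in> set q}"
  by (induction q) auto

lemma set_partition_mult:
  "set (partition_mult p q) = {a \<inter> b | a b. a \<in> set p \<and> b \<in> set q \<and> a \<inter> b \<noteq> {}}"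
  unfolding partition_mult_eq set_filter set_intersections by auto

lemma filter_map_Int:
  "filter (\<lambda>b. b \<noteq> {}) (map (\<lambda>a. a \<inter> x) (filter (\<lambda>b. b \<noteq> {}) p)) =
   filter (\<lambda>b. b \<noteq> {}) (map (\<lambda>a. a \<inter> x) p)"
  by (induction p) auto

lemma filter_intersections_left:
  "filter (\<lambda>b. b \<noteq> {}) (intersections (filter (\<lambda>b. b \<noteq> {}) p) q) =
   filter (\<lambda>b. b \<noteq> {}) (intersections p q)"
  by (induction q) (simp_all only: intersections_simps filter_append filter_map_Int)

lemma filter_intersections_right:
  "filter (\<lambda>b. b \<noteq> {}) (intersections p (filter (\<lambda>b. b \<noteq> {}) q)) =
   filter (\<lambda>b. b \<noteq> {}) (intersections p q)"
  by (induction q) (auto simp: filter_empty_conv)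

lemma map_Int_intersections:
  "map (\<lambda>a. a \<inter> x) (intersections p q) = intersections p (map (\<lambda>b. b \<inter> x) q)"
  by (induction q) (auto simp: Int_assoc)

lemma intersections_assoc:
  "intersections (intersections p q) r = intersections p (intersections q r)"
  by (induction r) (simp_all add: map_Int_intersections)

text \<open>Removing empty blocks early or late makes no difference, and before the removal the
  product is associative because intersection is.\<close>

lemma partition_mult_assoc:
  "partition_mult (partition_mult p q) r = partition_mult p (partition_mult q r)"
  unfolding partition_mult_eq filter_intersections_left filter_intersections_right
    intersections_assoc ..

lemma sorted_wrt_disjnt_Int:
  "sorted_wrt disjnt p \<Longrightarrow> sorted_wrt disjnt (map (\<lambda>a. a \<inter> x) p)"
  unfolding sorted_wrt_map by (erule sorted_wrt_mono_rel[rotated]) (auto simp: disjnt_def)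

lemma sorted_wrt_disjnt_intersections:
  "sorted_wrt disjnt p \<Longrightarrow> sorted_wrt disjnt q \<Longrightarrow> sorted_wrt disjnt (intersections p q)"
proof (induction q)
  case (Cons b q)
  then show ?case
    using sorted_wrt_disjnt_Int[of p b]
    by (simp add: sorted_wrt_append set_intersections) (auto simp: disjnt_def)
qed simp

lemma partition_mult_closed:
  assumes "p \<in> ordered_partitions n" "q \<in> ordered_partitions n"
  shows "partition_mult p q \<in> ordered_partitions n"
proof -
  have "\<Union>(set (partition_mult p q)) = \<Union>(set p) \<inter> \<Union>(set q)"
    unfolding set_partition_mult by blast
  moreover have "sorted_wrt disjnt (partition_mult p q)"
    using assms unfolding partition_mult_eq ordered_partitions_def
    by (intro sorted_wrt_filter sorted_wrt_disjnt_intersections) auto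
  ultimately show ?thesis
    using assms unfolding ordered_partitions_def by (auto simp: partition_mult_eq)
qed

lemma one_ordered_partition: "1 \<le> n \<Longrightarrow> [{1..n}] \<in> ordered_partitions n"
  unfolding ordered_partitions_def by auto

lemma permutes_vimage_self: "\<sigma> permutes S \<Longrightarrow> \<sigma> -` S = S"
  by (simp add: set_eq_iff permutes_in_image)

lemma phi_map_eq: "\<sigma> permutes S \<Longrightarrow> phi_map \<sigma> p = map (\<lambda>b. \<sigma> -` b) p"
  unfolding phi_map_def by (simp add: bij_vimage_eq_inv_image permutes_bij)

lemma phi_map_closed:
  assumes "p \<in> ordered_partitions n" "\<sigma> permutes {1..n}"
  shows "phi_map \<sigma> p \<in> ordered_partitions n"
proof -
  have "sorted_wrt disjnt (map (\<lambda>b. \<sigma> -` b) p)"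
    using assms(1) unfolding sorted_wrt_map ordered_partitions_def
    by (auto elim!: sorted_wrt_mono_rel[rotated] simp: disjnt_def)
  moreover have "{} \<notin> set (map (\<lambda>b. \<sigma> -` b) p)"
  proof
    assume "{} \<in> set (map (\<lambda>b. \<sigma> -` b) p)"
    then obtain b where "b \<in> set p" "\<sigma> -` b = {}" by auto
    then show False
      using assms(1) permutes_surj[OF assms(2)] unfolding ordered_partitions_def
      by (metis (no_types, lifting) surj_image_vimage_eq image_empty mem_Collect_eq)
  qed
  moreover have "\<Union>(set (map (\<lambda>b. \<sigma> -` b) p)) = \<sigma> -` \<Union>(set p)" by auto
  moreover have "\<sigma> -` {1..n} = {1..n}" by (rule permutes_vimage_self[OF assms(2)])
  ultimately show ?thesis
    using assms(1) unfolding phi_map_eq[OF assms(2)] ordered_partitions_def by simp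
qed

lemma phi_map_partition_mult:
  assumes "\<sigma> permutes S"
  shows "phi_map \<sigma> (partition_mult p q) = partition_mult (phi_map \<sigma> p) (phi_map \<sigma> q)"
proof -
  have inj: "(\<sigma> -` b \<noteq> {}) = (b \<noteq> {})" for b
    using permutes_surj[OF assms] by (metis surj_image_vimage_eq vimage_empty image_empty)
  have "map (\<lambda>b. \<sigma> -` b) (intersections p q) =
      intersections (map (\<lambda>b. \<sigma> -` b) p) (map (\<lambda>b. \<sigma> -` b) q)"
    by (induction q) auto
  then have "intersections (map (\<lambda>b. \<sigma> -` b) p) (map (\<lambda>b. \<sigma> -` b) q) =
      map (\<lambda>b. \<sigma> -` b) (intersections p q)" by (rule sym)
  then show ?thesis
    unfolding partition_mult_eq phi_map_eq[OF assms] by (simp only: filter_map comp_def inj)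
qed

lemma phi_map_comp:
  assumes "\<sigma> permutes S" "\<tau> permutes S"
  shows "phi_map (\<sigma> \<circ> \<tau>) p = phi_map \<tau> (phi_map \<sigma> p)"
  unfolding phi_map_eq[OF assms(1)] phi_map_eq[OF assms(2)]
    phi_map_eq[OF permutes_compose[OF assms(2,1)]] by (auto simp: vimage_comp)

lemma phi_map_id [simp]: "phi_map id p = p"
  unfolding phi_map_eq[OF permutes_id] by simp

lemma phi_map_one:
  assumes "\<sigma> permutes {1..n}" shows "phi_map \<sigma> [{1..n}] = [{1..n}]"
  unfolding phi_map_eq[OF assms] using permutes_vimage_self[OF assms] by simp

lemma partition_mult_one_left:
  assumes "q \<in> ordered_partitions n" shows "partition_mult [{1..n}] q = q"
proof -
  have "intersections [{1..n}] r = r" if "set r \<subseteq> set q" for r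
    using that assms unfolding ordered_partitions_def by (induction r) auto
  then show ?thesis using assms unfolding partition_mult_eq ordered_partitions_def
    by (auto simp: filter_id_conv)
qed

lemma partition_mult_one_right:
  assumes "p \<in> ordered_partitions n" shows "partition_mult p [{1..n}] = p"
proof -
  have "map (\<lambda>a. a \<inter> {1..n}) p = p"
    using assms unfolding ordered_partitions_def by (intro map_idI) auto
  then show ?thesis using assms unfolding partition_mult_eq ordered_partitions_def
    by (auto simp: filter_id_conv)
qed

lemma monoid_partition_perm: assumes "1 \<le> n" shows "monoid (partition_perm_monoid n)"
proof (rule monoidI)
  let ?G = "partition_perm_monoid n"
  show "\<one>\<^bsub>?G\<^esub> \<in> carrier ?G"
    using one_ordered_partition[OF assms] permutes_id by (simp add: partition_perm_monoid_def)
  fix x assume "x \<in> carrier ?G"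
  then obtain p \<sigma> where x: "x = (p, \<sigma>)" "p \<in> ordered_partitions n" "\<sigma> permutes {1..n}"
    by (auto simp: partition_perm_monoid_def)
  show "\<one>\<^bsub>?G\<^esub> \<otimes>\<^bsub>?G\<^esub> x = x" "x \<otimes>\<^bsub>?G\<^esub> \<one>\<^bsub>?G\<^esub> = x"
    using x phi_map_one[of \<sigma> n] partition_mult_one_left[of p n] partition_mult_one_right[of p n]
    by (simp_all add: partition_perm_monoid_def)
  fix y assume "y \<in> carrier ?G"
  then obtain q \<tau> where y: "y = (q, \<tau>)" "q \<in> ordered_partitions n" "\<tau> permutes {1..n}"
    by (auto simp: partition_perm_monoid_def)
  show "x \<otimes>\<^bsub>?G\<^esub> y \<in> carrier ?G"
    using x y by (simp add: partition_perm_monoid_def partition_mult_closed phi_map_closed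
        permutes_compose)
  fix z assume "z \<in> carrier ?G"
  then obtain r \<rho> where z: "z = (r, \<rho>)" "r \<in> ordered_partitions n" "\<rho> permutes {1..n}"
    by (auto simp: partition_perm_monoid_def)
  show "x \<otimes>\<^bsub>?G\<^esub> y \<otimes>\<^bsub>?G\<^esub> z = x \<otimes>\<^bsub>?G\<^esub> (y \<otimes>\<^bsub>?G\<^esub> z)"
    using x y z by (simp add: partition_perm_monoid_def phi_map_partition_mult[OF z(3)]
        phi_map_comp[OF y(3) z(3)] partition_mult_assoc comp_assoc)
qed

section \<open>Words in the simple transpositions\<close>

definition gen_cong :: "nat \<Rightarrow> gen list \<Rightarrow> gen list \<Rightarrow> bool" where
  "gen_cong n u v \<longleftrightarrow> (u, v) \<in> generated_congruence (generators n) (relations n)"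

definition s_cong :: "nat \<Rightarrow> nat list \<Rightarrow> nat list \<Rightarrow> bool" where
  "s_cong n u v \<longleftrightarrow> gen_cong n (s_word u) (s_word v)"

lemma s_word_simps [simp]:
  "s_word [] = []" "s_word (u @ v) = s_word u @ s_word v" "s_word (i # u) = Gen_s i # s_word u"
  unfolding s_word_def by simp_all

lemma s_word_in_lists: "set u \<subseteq> {1..<n} \<Longrightarrow> s_word u \<in> lists (generators n)"
  unfolding s_word_def generators_def by (auto, blast)

lemma e_word_in_lists: "index_seq n ks \<Longrightarrow> e_word ks \<in> lists (generators n)"
  unfolding e_word_def generators_def by auto

lemma relations_subset: "relations n \<subseteq> lists (generators n) \<times> lists (generators n)"
proof (rule subrelI)
  fix u v assume "(u, v) \<in> relations n"
  then show "(u, v) \<in> lists (generators n) \<times> lists (generators n)"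
  proof cases
    case (square i) then show ?thesis using s_word_in_lists[of "[i, i]" n] by simp
  next
    case (commute i j)
    then show ?thesis using s_word_in_lists[of "[i, j]" n] by simp
  next
    case (braid i)
    then show ?thesis using s_word_in_lists[of "[i, i + 1, i]" n] by simp
  next
    case (e_s i ks b)
    then show ?thesis using s_word_in_lists[of "[i]" n] e_word_in_lists[of n ks] by simp
  next
    case (e_s_e ks ls qs ii jj)
    then show ?thesis
      using s_word_in_lists[of ii n] s_word_in_lists[of jj n] s_word_in_lists[of "rev jj" n]
        e_word_in_lists[of n ks] e_word_in_lists[of n ls] e_word_in_lists[of n qs]
      by simp
  qed
qed

lemma congruence_gen_cong: "congruence_on (generators n) {(u, v). gen_cong n u v}"
  using congruence_on_generated[OF relations_subset] unfolding gen_cong_def by simp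

lemma gen_cong_refl: "u \<in> lists (generators n) \<Longrightarrow> gen_cong n u u"
  using congruence_gen_cong[of n] unfolding congruence_on_def equiv_def refl_on_def by blast

lemma gen_cong_sym: "gen_cong n u v \<Longrightarrow> gen_cong n v u"
  using congruence_gen_cong[of n] unfolding congruence_on_def equiv_def sym_def by blast

lemma gen_cong_trans [trans]: "gen_cong n u v \<Longrightarrow> gen_cong n v w \<Longrightarrow> gen_cong n u w"
  using congruence_gen_cong[of n] unfolding congruence_on_def equiv_def trans_def by blast

lemma gen_cong_append: "gen_cong n u v \<Longrightarrow> gen_cong n u' v' \<Longrightarrow> gen_cong n (u @ u') (v @ v')"
  using congruence_gen_cong[of n] unfolding congruence_on_def by blast

lemma gen_cong_relation: "(u, v) \<in> relations n \<Longrightarrow> gen_cong n u v"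
  unfolding gen_cong_def using generated_congruence_superset by (rule subsetD)

lemma s_cong_refl: "set u \<subseteq> {1..<n} \<Longrightarrow> s_cong n u u"
  unfolding s_cong_def by (intro gen_cong_refl s_word_in_lists)

lemma s_cong_sym: "s_cong n u v \<Longrightarrow> s_cong n v u"
  unfolding s_cong_def by (rule gen_cong_sym)

lemma s_cong_trans [trans]: "s_cong n u v \<Longrightarrow> s_cong n v w \<Longrightarrow> s_cong n u w"
  unfolding s_cong_def by (rule gen_cong_trans)

lemma s_cong_append: "s_cong n u v \<Longrightarrow> s_cong n u' v' \<Longrightarrow> s_cong n (u @ u') (v @ v')"
  unfolding s_cong_def s_word_simps by (rule gen_cong_append)

lemma s_cong_context:
  assumes "s_cong n u v" "set a \<subseteq> {1..<n}" "set b \<subseteq> {1..<n}"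
  shows "s_cong n (a @ u @ b) (a @ v @ b)"
  using assms by (intro s_cong_append s_cong_refl)

lemma s_cong_square: "i \<in> {1..<n} \<Longrightarrow> s_cong n [i, i] []"
  unfolding s_cong_def s_word_simps(1) by (intro gen_cong_relation relations.square)

lemma s_cong_commute:
  "i \<in> {1..<n} \<Longrightarrow> j \<in> {1..<n} \<Longrightarrow> \<bar>int i - int j\<bar> \<ge> 2 \<Longrightarrow> s_cong n [i, j] [j, i]"
  unfolding s_cong_def by (intro gen_cong_relation relations.commute)

lemma s_cong_braid:
  "i \<in> {1..<n} \<Longrightarrow> i + 1 \<in> {1..<n} \<Longrightarrow> s_cong n [i, i + 1, i] [i + 1, i, i + 1]"
  unfolding s_cong_def by (intro gen_cong_relation relations.braid)

lemma word_perm_simps [simp]: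
  "word_perm [] = id" "word_perm (i # u) = Transposition.transpose i (i + 1) \<circ> word_perm u"
  unfolding word_perm_def by simp_all

lemma word_perm_append: "word_perm (u @ v) = word_perm u \<circ> word_perm v"
  by (induction u) (simp_all add: comp_assoc)

lemma word_perm_permutes: "set u \<subseteq> {1..<n} \<Longrightarrow> word_perm u permutes {1..n}"
proof (induction u)
  case (Cons i u)
  then have "Transposition.transpose i (i + 1) permutes {1..n}"
    by (intro permutes_swap_id) auto
  moreover have "word_perm u permutes {1..n}" using Cons by simp
  ultimately show ?case unfolding word_perm_simps by (intro permutes_compose)
qed (simp add: permutes_id)

lemma word_perm_rev: "word_perm (rev u) \<circ> word_perm u = id"
proof (induction u)
  case (Cons i u)
  have "word_perm (rev (i # u)) \<circ> word_perm (i # u) =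
      word_perm (rev u) \<circ> (Transposition.transpose i (i + 1) \<circ> Transposition.transpose i (i + 1))
        \<circ> word_perm u"
    by (simp only: word_perm_append rev.simps word_perm_simps comp_assoc comp_id id_comp)
  then show ?case
    using Cons by (simp only: Transposition.transpose_comp_involutory comp_id)
qed simp

lemma word_perm_rev': "word_perm u \<circ> word_perm (rev u) = id"
  using word_perm_rev[of "rev u"] by simp

lemma inv_word_perm: "inv_into UNIV (word_perm u) = word_perm (rev u)"
  using word_perm_rev word_perm_rev' by (intro inv_unique_comp) auto


section \<open>Interval partitions\<close>

lemma index_seq_Nil [simp]: "index_seq n []"
  unfolding index_seq_def by simp

lemma index_seq_snoc: "index_seq n (ks @ [m]) \<longleftrightarrow> index_seq m ks \<and> m \<in> {1..<n}"
  unfolding index_seq_def by (auto simp: sorted_wrt_append)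

lemma interval_partition_Nil [simp]: "interval_partition n [] = [{1..n}]"
  unfolding interval_partition_def by simp

lemma interval_partition_snoc:
  "interval_partition n (ks @ [m]) = interval_partition m ks @ [{m + 1..n}]"
proof -
  have "zip ((0 # ks) @ [m]) ((ks @ [m]) @ [n]) = zip (0 # ks) (ks @ [m]) @ zip [m] [n]"
    by (rule zip_append) simp
  then show ?thesis unfolding interval_partition_def by simp
qed

lemma length_interval_partition: "length (interval_partition n ks) = Suc (length ks)"
  unfolding interval_partition_def by simp

lemma interval_partition_closed:
  "1 \<le> n \<Longrightarrow> index_seq n ks \<Longrightarrow> interval_partition n ks \<in> ordered_partitions n"
proof (induction ks arbitrary: n rule: rev_induct)
  case Nil
  then show ?case by (simp add: ordered_partitions_def)
next
  case (snoc m ks)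
  then have m: "m \<in> {1..<n}" "interval_partition m ks \<in> ordered_partitions m"
    by (auto simp: index_seq_snoc)
  have un: "{1..n} = {1..m} \<union> {m + 1..n}" using m(1) by auto
  have "disjnt b {m + 1..n}" if "b \<in> set (interval_partition m ks)" for b
  proof -
    have "b \<subseteq> {1..m}" using m(2) that unfolding ordered_partitions_def by auto
    then show ?thesis by (auto simp: disjnt_def)
  qed
  moreover have "{m + 1..n} \<noteq> {}" using m(1) by simp
  ultimately show ?case
    using m(2) unfolding ordered_partitions_def interval_partition_snoc un
    by (simp add: sorted_wrt_append Un_commute)
qed

lemma interval_partition_separates:
  "1 \<le> n \<Longrightarrow> index_seq n ks \<Longrightarrow> i \<in> set ks \<Longrightarrow> b \<in> set (interval_partition n ks) \<Longrightarrow>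
   \<not> {i, i + 1} \<subseteq> b"
proof (induction ks arbitrary: n rule: rev_induct)
  case (snoc m ks)
  then have m: "m \<in> {1..<n}" "index_seq m ks" by (auto simp: index_seq_snoc)
  have sub: "c \<subseteq> {1..m}" if "c \<in> set (interval_partition m ks)" for c
    using interval_partition_closed[of m ks] m that unfolding ordered_partitions_def by auto
  have im: "i \<le> m" using snoc.prems(3) m unfolding index_seq_def by auto
  consider "b = {m + 1..n}" | "b \<in> set (interval_partition m ks)"
    using snoc.prems(4) unfolding interval_partition_snoc by auto
  then show ?case
  proof cases
    case 1
    then show ?thesis using im by auto
  next
    case 2
    show ?thesis
    proof (cases "i = m")
      case True
      then show ?thesis using sub[OF 2] by auto
    next
      case False
      then show ?thesis using snoc.IH[of m] snoc.prems(3) m 2 by auto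
    qed
  qed
qed simp

text \<open>The elements are numbered block after block. Adding a block at the end only adds the
  numbers that follow those already used, so the images of the blocks are consecutive
  intervals.\<close>

lemma standardize_blocks:
  assumes "p \<noteq> []" "sorted_wrt disjnt p" "{} \<notin> set p" "finite (\<Union>(set p))"
  shows "\<exists>f ks. inj_on f (\<Union>(set p)) \<and> index_seq (card (\<Union>(set p))) ks \<and>
    map ((`) f) p = interval_partition (card (\<Union>(set p))) ks"
  using assms
proof (induction p rule: rev_nonempty_induct)
  case (single b)
  then have "finite b" by simp
  then obtain f where "bij_betw f b {1..card b}"
    using finite_same_card_bij[of b "{1..card b}"] by auto
  then show ?case
    by (intro exI[of _ f] exI[of _ "[]"]) (simp add: bij_betw_def)
next
  case (snoc b p)
  define A where "A = \<Union>(set p)"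
  have b: "finite A" "finite b" "b \<noteq> {}" "A \<inter> b = {}"
    using snoc.prems unfolding A_def by (auto simp: sorted_wrt_append disjnt_def)
  obtain f ks where f: "inj_on f A" "index_seq (card A) ks"
    "map ((`) f) p = interval_partition (card A) ks"
    using snoc.IH snoc.prems unfolding A_def by (auto simp: sorted_wrt_append)
  have "p \<noteq> []" by fact
  then have "A \<noteq> {}" using snoc.prems unfolding A_def by (cases p) auto
  then have cA: "1 \<le> card A" using b(1) by (simp add: Suc_le_eq card_gt_0_iff)
  have fA: "f ` A = {1..card A}"
  proof -
    have "f ` A = \<Union>(set (map ((`) f) p))" unfolding A_def by auto
    also have "\<dots> = {1..card A}"
      using interval_partition_closed[OF cA f(2)] unfolding f(3) ordered_partitions_def by simp
    finally show ?thesis .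
  qed
  have U: "\<Union>(set (p @ [b])) = A \<union> b" unfolding A_def by auto
  have card: "card (A \<union> b) = card A + card b" using b by (simp add: card_Un_disjoint)
  have "card b = card {card A + 1..card A + card b}" by simp
  then obtain g where g: "bij_betw g b {card A + 1..card A + card b}"
    using b(2) finite_same_card_bij[of b] by blast
  define h where "h x = (if x \<in> A then f x else g x)" for x
  have hb: "h ` b = {card A + 1..card A + card b}" "inj_on h b"
  proof -
    have "h x = g x" if "x \<in> b" for x using b(4) that unfolding h_def by auto
    then show "h ` b = {card A + 1..card A + card b}" "inj_on h b"
      using g unfolding bij_betw_def inj_on_def by auto
  qed
  have hA: "h ` A = {1..card A}" "inj_on h A"
    using f(1) fA unfolding h_def inj_on_def by auto
  have "h ` A \<inter> h ` b = {}" unfolding hb(1) hA(1) by auto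
  then have "inj_on h (A \<union> b)" unfolding inj_on_Un using hb(2) hA(2) by blast
  moreover have "map ((`) h) p = map ((`) f) p"
  proof (rule map_cong[OF refl])
    fix c assume "c \<in> set p"
    then have "c \<subseteq> A" unfolding A_def by auto
    then show "h ` c = f ` c" unfolding h_def by (intro image_cong) auto
  qed
  then have "map ((`) h) (p @ [b]) = interval_partition (card (A \<union> b)) (ks @ [card A])"
    unfolding interval_partition_snoc card using f(3) hb by simp
  moreover have "index_seq (card (A \<union> b)) (ks @ [card A])"
    unfolding index_seq_snoc card using f(2) cA b by (auto simp: card_gt_0_iff)
  ultimately show ?case unfolding U by blast
qed

text \<open>Every ordered set partition is conjugate, under the symmetric group, to one made of
  intervals; this is why idempotents indexed by index sequences suffice as generators.\<close>

lemma standardize_partition: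
  assumes "p \<in> ordered_partitions n" "1 \<le> n"
  shows "\<exists>v ks. v permutes {1..n} \<and> index_seq n ks \<and> u_map v p = interval_partition n ks"
proof -
  have U: "\<Union>(set p) = {1..n}" using assms(1) unfolding ordered_partitions_def by simp
  then have "p \<noteq> []" using assms(2) by auto
  then obtain f ks where f: "inj_on f {1..n}" "index_seq n ks"
    "map ((`) f) p = interval_partition n ks"
    using standardize_blocks[of p] assms(1) unfolding U by (auto simp: ordered_partitions_def)
  define v where "v x = (if x \<in> {1..n} then f x else x)" for x
  have vf: "v ` b = f ` b" if "b \<subseteq> {1..n}" for b
    using that unfolding v_def by (intro image_cong) auto
  have "map ((`) v) p = map ((`) f) p"
    using U by (intro map_cong refl vf) auto
  then have eq: "u_map v p = interval_partition n ks" unfolding u_map_def using f(3) by simp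
  have "v ` {1..n} = \<Union>(set (u_map v p))" unfolding U[symmetric] u_map_def by auto
  also have "\<dots> = {1..n}"
    using interval_partition_closed[OF assms(2) f(2)] unfolding eq ordered_partitions_def by simp
  finally have "v ` {1..n} = {1..n}" .
  moreover have "inj_on v {1..n} = inj_on f {1..n}" by (rule inj_on_cong) (simp add: v_def)
  then have "inj_on v {1..n}" using f(1) by blast
  ultimately have "bij_betw v {1..n} {1..n}" unfolding bij_betw_def by simp
  then have "v permutes {1..n}" by (rule bij_imp_permutes) (auto simp: v_def)
  then show ?thesis using f(2) eq by blast
qed

section \<open>Evaluation of words\<close>

primrec gen_value :: "nat \<Rightarrow> gen \<Rightarrow> nat set list \<times> (nat \<Rightarrow> nat)" where
  "gen_value n (Gen_s i) = ([{1..n}], Transposition.transpose i (i + 1))"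
| "gen_value n (Gen_e ks) = (interval_partition n ks, id)"

abbreviation gen_word_value :: "nat \<Rightarrow> gen list \<Rightarrow> nat set list \<times> (nat \<Rightarrow> nat)" where
  "gen_word_value n \<equiv> word_value (partition_perm_monoid n) (gen_value n)"

lemma mult_partition_perm:
  "(p, \<sigma>) \<otimes>\<^bsub>partition_perm_monoid n\<^esub> (q, \<tau>) = (partition_mult (phi_map \<tau> p) q, \<sigma> \<circ> \<tau>)"
  unfolding partition_perm_monoid_def by simp

lemma gen_value_closed:
  assumes "1 \<le> n"
  shows "gen_value n ` generators n \<subseteq> carrier (partition_perm_monoid n)"
proof -
  have "Transposition.transpose i (i + 1) permutes {1..n}" if "i \<in> {1..<n}" for i
    using that by (intro permutes_swap_id) auto
  then show ?thesis
    using one_ordered_partition[OF assms] interval_partition_closed[OF assms] permutes_id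
    unfolding generators_def partition_perm_monoid_def by auto
qed

lemma gen_word_value_append:
  assumes "1 \<le> n" "u \<in> lists (generators n)" "v \<in> lists (generators n)"
  shows "gen_word_value n (u @ v) =
    gen_word_value n u \<otimes>\<^bsub>partition_perm_monoid n\<^esub> gen_word_value n v"
  by (rule monoid.word_value_append[OF monoid_partition_perm[OF assms(1)]
        gen_value_closed[OF assms(1)] assms(2,3)])

lemma gen_word_value_s_word:
  assumes "1 \<le> n"
  shows "set u \<subseteq> {1..<n} \<Longrightarrow> gen_word_value n (s_word u) = ([{1..n}], word_perm u)"
proof (induction u)
  case Nil
  then show ?case by (simp add: partition_perm_monoid_def id_def)
next
  case (Cons i u)
  then show ?case
    using phi_map_one[OF word_perm_permutes[of u n]]
      partition_mult_one_left[OF one_ordered_partition[OF assms]]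
    by (simp add: mult_partition_perm comp_def)
qed

lemma gen_word_value_e_word:
  assumes "1 \<le> n" "index_seq n ks"
  shows "gen_word_value n (e_word ks) = (interval_partition n ks, id)"
proof (cases "ks = []")
  case True
  then show ?thesis by (simp add: e_word_def partition_perm_monoid_def)
next
  case False
  have "\<one>\<^bsub>partition_perm_monoid n\<^esub> = ([{1..n}], id)" by (simp add: partition_perm_monoid_def)
  then show ?thesis
    using False partition_mult_one_right[OF interval_partition_closed[OF assms]]
    by (simp add: e_word_def mult_partition_perm)
qed

lemma gen_word_value_form:
  assumes "1 \<le> n" "set w \<subseteq> {1..<n}" "set v \<subseteq> {1..<n}" "index_seq n ks"
  shows "gen_word_value n (s_word w @ e_word ks @ s_word v) =
    (phi_map (word_perm v) (interval_partition n ks), word_perm w \<circ> word_perm v)"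
proof -
  have ks: "interval_partition n ks \<in> ordered_partitions n"
    using assms by (intro interval_partition_closed)
  have "gen_word_value n (s_word w @ e_word ks @ s_word v) =
      ([{1..n}], word_perm w) \<otimes>\<^bsub>partition_perm_monoid n\<^esub>
        ((interval_partition n ks, id) \<otimes>\<^bsub>partition_perm_monoid n\<^esub> ([{1..n}], word_perm v))"
    using assms s_word_in_lists[of w n] s_word_in_lists[of v n] e_word_in_lists[of n ks]
    by (simp only: gen_word_value_append append_in_lists_conv gen_word_value_s_word
        gen_word_value_e_word)
  then show ?thesis
    using phi_map_one[OF word_perm_permutes[OF assms(3)]]
      partition_mult_one_right[OF phi_map_closed[OF ks word_perm_permutes[OF assms(3)]]]
      partition_mult_one_left[OF phi_map_closed[OF ks word_perm_permutes[OF assms(3)]]]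
    by (simp add: mult_partition_perm)
qed

lemma u_map_phi_map:
  assumes "\<sigma> permutes S" shows "phi_map \<sigma> (u_map \<sigma> p) = p" "u_map \<sigma> (phi_map \<sigma> p) = p"
  unfolding u_map_def phi_map_eq[OF assms]
  by (simp_all add: permutes_inj[OF assms] inj_vimage_image_eq surj_image_vimage_eq
      permutes_surj[OF assms] comp_def)

lemma phi_map_inv: "\<sigma> permutes S \<Longrightarrow> phi_map (inv_into UNIV \<sigma>) p = u_map \<sigma> p"
  unfolding phi_map_def u_map_def by (simp add: permutes_bij inv_inv_eq)

lemma blocks_disjoint:
  assumes "sorted_wrt disjnt p" "b \<in> set p" "c \<in> set p" shows "b = c \<or> b \<inter> c = {}"
proof -
  obtain i j where "i < length p" "j < length p" "b = p ! i" "c = p ! j"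
    using assms(2,3) by (auto simp: in_set_conv_nth)
  then show ?thesis
    using assms(1) unfolding sorted_wrt_iff_nth_less disjnt_def
    by (cases i j rule: linorder_cases) auto
qed

lemma phi_map_transpose_same_block:
  assumes "p \<in> ordered_partitions n" "b \<in> set p" "{i, j} \<subseteq> b" "i \<in> {1..n}" "j \<in> {1..n}"
  shows "phi_map (Transposition.transpose i j) p = p"
proof -
  have perm: "Transposition.transpose i j permutes {1..n}"
    using assms(4,5) by (rule permutes_swap_id)
  have "Transposition.transpose i j -` c = c" if "c \<in> set p" for c
  proof -
    have "c = b \<or> c \<inter> b = {}"
      using blocks_disjoint[of p c b] assms(1,2) that unfolding ordered_partitions_def by auto
    then have "i \<in> c \<longleftrightarrow> j \<in> c" using assms(3) by blast
    then show ?thesis by (auto simp: Transposition.transpose_def split: if_splits)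
  qed
  then show ?thesis unfolding phi_map_eq[OF perm] by (simp add: map_idI)
qed

text \<open>The relations hold in the monoid of pairs. For the last family this is the fact that a
  permutation acts on ordered set partitions by automorphisms.\<close>

lemma gen_word_value_relation:
  assumes "1 \<le> n" "(u, v) \<in> relations n"
  shows "gen_word_value n u = gen_word_value n v"
  using assms(2)
proof cases
  case (square i)
  then show ?thesis
    using gen_word_value_s_word[OF assms(1), of "[i, i]"] by (simp add: partition_perm_monoid_def)
next
  case (commute i j)
  then have "Transposition.transpose i (i + 1) \<circ> Transposition.transpose j (j + 1) =
      Transposition.transpose j (j + 1) \<circ> Transposition.transpose i (i + 1)"
    by (auto simp: fun_eq_iff Transposition.transpose_def)
  then have "word_perm [i, j] = word_perm [j, i]" by simp
  then show ?thesis
    using commute gen_word_value_s_word[OF assms(1), of "[i, j]"]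
      gen_word_value_s_word[OF assms(1), of "[j, i]"] by simp
next
  case (braid i)
  have "word_perm [i, i + 1, i] = word_perm [i + 1, i, i + 1]"
    by (auto simp: fun_eq_iff Transposition.transpose_def)
  then show ?thesis
    using braid gen_word_value_s_word[OF assms(1), of "[i, i + 1, i]"]
      gen_word_value_s_word[OF assms(1), of "[i + 1, i, i + 1]"] by simp
next
  case (e_s i ks b)
  have ks: "interval_partition n ks \<in> ordered_partitions n"
    by (rule interval_partition_closed[OF assms(1) e_s(4)])
  have "phi_map (word_perm [i]) (interval_partition n ks) = interval_partition n ks"
    using phi_map_transpose_same_block[OF ks e_s(5,6)] e_s(3) by simp
  then show ?thesis
    unfolding e_s(1,2)
    using gen_word_value_form[OF assms(1), of "[]" "[i]" ks]
      gen_word_value_form[OF assms(1), of "[i]" "[]" ks] e_s(3,4) by simp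
next
  case (e_s_e ks ls qs ii jj)
  let ?G = "partition_perm_monoid n"
  define w v where "w = word_perm ii" and "v = word_perm jj"
  have w: "w permutes {1..n}" and v: "v permutes {1..n}"
    unfolding w_def v_def by (intro word_perm_permutes e_s_e(7) e_s_e(8))+
  define K L where "K = interval_partition n ks" and "L = interval_partition n ls"
  have K: "K \<in> ordered_partitions n" and L: "L \<in> ordered_partitions n"
    unfolding K_def L_def by (intro interval_partition_closed assms(1) e_s_e(3) e_s_e(4))+
  have q: "interval_partition n qs = u_map v (partition_mult K (u_map w L))"
    using e_s_e(10) unfolding K_def L_def w_def[symmetric] v_def[symmetric] phi_map_inv[OF w] .
  have "gen_word_value n u = gen_word_value n (e_word ks @ s_word ii) \<otimes>\<^bsub>?G\<^esub> gen_word_value n (e_word ls)"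
    unfolding e_s_e(1) append_assoc[symmetric]
    using s_word_in_lists[OF e_s_e(7)] e_word_in_lists[OF e_s_e(3)] e_word_in_lists[OF e_s_e(4)]
    by (intro gen_word_value_append assms(1)) simp_all
  also have "\<dots> = (phi_map w K, w) \<otimes>\<^bsub>?G\<^esub> (L, id)"
    using gen_word_value_form[OF assms(1), of "[]" ii ks] gen_word_value_e_word[OF assms(1), of ls] e_s_e(3,4,7)
    unfolding w_def K_def L_def by simp
  also have "\<dots> = (partition_mult (phi_map w K) L, w)" by (simp add: mult_partition_perm)
  also have "partition_mult (phi_map w K) L = phi_map w (partition_mult K (u_map w L))"
    unfolding phi_map_partition_mult[OF w] u_map_phi_map(1)[OF w] ..
  also have "partition_mult K (u_map w L) = phi_map v (interval_partition n qs)"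
    unfolding q u_map_phi_map(1)[OF v] ..
  also have "phi_map w (phi_map v (interval_partition n qs)) = phi_map (v \<circ> w) (interval_partition n qs)"
    unfolding phi_map_comp[OF v w] ..
  finally have "gen_word_value n u = (phi_map (v \<circ> w) (interval_partition n qs), w)" .
  moreover have "word_perm (rev jj) \<circ> (v \<circ> w) = w"
    unfolding v_def comp_assoc[symmetric] word_perm_rev by simp
  ultimately show ?thesis
    using gen_word_value_form[OF assms(1), of "rev jj" "jj @ ii" qs] e_s_e(5,7,8)
    unfolding e_s_e(2) word_perm_append v_def[symmetric] w_def[symmetric] by simp
qed

lemma gen_cong_value:
  assumes "1 \<le> n" "gen_cong n u v" shows "gen_word_value n u = gen_word_value n v"
  by (rule monoid.word_value_congruent(3)[OF monoid_partition_perm[OF assms(1)]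
        gen_value_closed[OF assms(1)] relations_subset gen_word_value_relation[OF assms(1)]
        assms(2)[unfolded gen_cong_def]])

lemma gen_cong_lists:
  assumes "gen_cong n u v" shows "u \<in> lists (generators n)" "v \<in> lists (generators n)"
  using assms congruence_gen_cong[of n] unfolding congruence_on_def equiv_def by blast+

lemma s_cong_word_perm:
  assumes "1 \<le> n" "s_cong n u v" shows "word_perm u = word_perm v"
proof -
  have "set w \<subseteq> {1..<n}" if "s_word w \<in> lists (generators n)" for w
    using that unfolding s_word_def generators_def by auto
  then show ?thesis
    using gen_cong_value[OF assms(1)] gen_cong_lists assms(2) gen_word_value_s_word[OF assms(1)]
    unfolding s_cong_def by (metis prod.inject)
qed

section \<open>The Coxeter presentation of the symmetric group\<close>

lemma s_cong_commute_word:
  assumes "set u \<subseteq> {1..<n}" "i \<in> {1..<n}" "\<forall>j\<in>set u. \<bar>int i - int j\<bar> \<ge> 2"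
  shows "s_cong n (u @ [i]) (i # u)"
  using assms(1,3)
proof (induction u)
  case Nil
  then show ?case using s_cong_refl[of "[i]" n] assms(2) by simp
next
  case (Cons j u)
  have "s_cong n ([j] @ (u @ [i]) @ []) ([j] @ (i # u) @ [])"
    using Cons by (intro s_cong_context) auto
  also have "[j] @ (i # u) @ [] = [] @ [j, i] @ u" by simp
  also have "s_cong n ([] @ [j, i] @ u) ([] @ [i, j] @ u)"
    using Cons.prems assms(2) by (intro s_cong_context s_cong_sym[OF s_cong_commute]) auto
  finally show ?case by simp
qed

lemma word_perm_descending: "k \<le> m \<Longrightarrow> word_perm (rev [k..<m]) k = m"
proof (induction "m - k" arbitrary: m)
  case (Suc d)
  then obtain m' where m: "m = Suc m'" "k \<le> m'" by (cases m) auto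
  then have "word_perm (rev [k..<m']) k = m'" using Suc by simp
  then show ?case using m by simp
qed simp

text \<open>The words \<open>s\<^sub>m \<dots> s\<^sub>k\<close> with \<open>1 \<le> k \<le> m + 1\<close> represent the right cosets of the symmetric
  group on \<open>m\<close> letters in that on \<open>m + 1\<close> letters. Multiplication by a letter \<open>s\<^sub>i\<close> either
  lengthens or shortens the representative (\<open>i = k - 1\<close>, \<open>i = k\<close>), or \<open>s\<^sub>i\<close> passes to the
  left, unchanged if \<open>i < k - 1\<close> and turned into \<open>s\<close> with index \<open>i - 1\<close> by one braid
  relation if \<open>i > k\<close>.\<close>

lemma s_cong_descending_right:
  assumes "m < n" "k \<in> {1..Suc m}" "i \<in> {1..m}"
  shows "\<exists>u l. set u \<subseteq> {1..<m} \<and> l \<in> {1..Suc m} \<and>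
    s_cong n (rev [k..<Suc m] @ [i]) (u @ rev [l..<Suc m])"
proof -
  have letters: "set (rev [j..<Suc m]) \<subseteq> {1..<n}" if "1 \<le> j" for j
    using that assms(1) by auto
  have split: "rev [k..<Suc m] = rev [j..<Suc m] @ rev [k..<j]" if "k \<le> j" "j \<le> Suc m" for j
    using that by (metis le_add_diff_inverse rev_append upt_add_eq_append)
  consider "i + 1 < k" | "i + 1 = k" | "i = k" | "k < i" by linarith
  then show ?thesis
  proof cases
    case 1
    then have "s_cong n (rev [k..<Suc m] @ [i]) ([i] @ rev [k..<Suc m])"
      using s_cong_commute_word[of "rev [k..<Suc m]" n i] assms letters[of k] by auto
    moreover have "set [i] \<subseteq> {1..<m}" using 1 assms by auto
    ultimately show ?thesis using assms(2) by blast
  next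
    case 2
    then have "rev [k..<Suc m] @ [i] = rev [i..<Suc m]"
      using assms by (simp add: upt_rec[of i])
    then have "s_cong n (rev [k..<Suc m] @ [i]) ([] @ rev [i..<Suc m])"
      using s_cong_refl[OF letters[of i]] assms by simp
    moreover have "set [] \<subseteq> {1..<m}" "i \<in> {1..Suc m}" using assms by auto
    ultimately show ?thesis by blast
  next
    case 3
    then have "rev [k..<Suc m] = rev [Suc k..<Suc m] @ [k]"
      using split[of "Suc k"] assms by simp
    then have "rev [k..<Suc m] @ [i] = rev [Suc k..<Suc m] @ [k, k] @ []" using 3 by simp
    moreover have "s_cong n (rev [Suc k..<Suc m] @ [k, k] @ []) (rev [Suc k..<Suc m] @ [] @ [])"
      using assms 3 letters[of "Suc k"] by (intro s_cong_context s_cong_square) auto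
    ultimately have "s_cong n (rev [k..<Suc m] @ [i]) ([] @ rev [Suc k..<Suc m])" by simp
    moreover have "set [] \<subseteq> {1..<m}" "Suc k \<in> {1..Suc m}" using assms 3 by auto
    ultimately show ?thesis by blast
  next
    case 4
    define j where "j = i - 1"
    have j: "i = Suc j" "1 \<le> j" "k \<le> j" "j < m" using 4 assms unfolding j_def by auto
    define a where "a = rev [Suc i..<Suc m]"
    define b where "b = rev [k..<j]"
    have ab: "set a \<subseteq> {1..<n}" "set b \<subseteq> {1..<n}"
      using assms j unfolding a_def b_def by auto
    have ij: "i \<in> {1..<n}" "j \<in> {1..<n}" using assms j by auto
    have "rev [k..<Suc m] = rev [Suc i..<Suc m] @ rev [k..<Suc i]"
      using assms j by (intro split) auto
    also have "rev [k..<Suc i] = [i, j] @ rev [k..<j]" using j by simp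
    finally have D: "rev [k..<Suc m] = a @ [i, j] @ b" unfolding a_def b_def .
    have "s_cong n ((a @ [i, j]) @ (b @ [i]) @ []) ((a @ [i, j]) @ (i # b) @ [])"
      using ab ij j unfolding b_def by (intro s_cong_context s_cong_commute_word) auto
    also have "(a @ [i, j]) @ (i # b) @ [] = a @ [j + 1, j, j + 1] @ b" using j by simp
    also have "s_cong n (a @ [j + 1, j, j + 1] @ b) (a @ [j, j + 1, j] @ b)"
      using ab ij j by (intro s_cong_context s_cong_sym[OF s_cong_braid]) auto
    also have "a @ [j, j + 1, j] @ b = [] @ (a @ [j]) @ ([i, j] @ b)" using j by simp
    also have "s_cong n ([] @ (a @ [j]) @ ([i, j] @ b)) ([] @ (j # a) @ ([i, j] @ b))"
      using ab ij j unfolding a_def by (intro s_cong_context s_cong_commute_word) auto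
    finally have "s_cong n (rev [k..<Suc m] @ [i]) ([j] @ rev [k..<Suc m])"
      unfolding D by simp
    moreover have "set [j] \<subseteq> {1..<m}" using j by auto
    ultimately show ?thesis using assms(2) by blast
  qed
qed

lemma s_cong_coset_form:
  assumes "m < n" "set u \<subseteq> {1..m}"
  shows "\<exists>v k. set v \<subseteq> {1..<m} \<and> k \<in> {1..Suc m} \<and> s_cong n u (v @ rev [k..<Suc m])"
  using assms(2)
proof (induction u rule: rev_induct)
  case Nil
  have "s_cong n [] ([] @ rev [Suc m..<Suc m])" using s_cong_refl[of "[]" n] by simp
  moreover have "set [] \<subseteq> {1..<m}" "Suc m \<in> {1..Suc m}" by auto
  ultimately show ?case by blast
next
  case (snoc i u)
  then obtain v k where v: "set v \<subseteq> {1..<m}" "k \<in> {1..Suc m}" "s_cong n u (v @ rev [k..<Suc m])"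
    by auto
  have i: "i \<in> {1..m}" using snoc.prems by auto
  obtain w l where w: "set w \<subseteq> {1..<m}" "l \<in> {1..Suc m}"
    "s_cong n (rev [k..<Suc m] @ [i]) (w @ rev [l..<Suc m])"
    using s_cong_descending_right[OF assms(1) v(2) i] by blast
  have "s_cong n ([] @ u @ [i]) ([] @ (v @ rev [k..<Suc m]) @ [i])"
    using v(3) i assms(1) by (intro s_cong_context) auto
  also have "[] @ (v @ rev [k..<Suc m]) @ [i] = v @ (rev [k..<Suc m] @ [i]) @ []" by simp
  also have "s_cong n (v @ (rev [k..<Suc m] @ [i]) @ []) (v @ (w @ rev [l..<Suc m]) @ [])"
    using w(3) v(1) assms(1) by (intro s_cong_context) auto
  finally have "s_cong n (u @ [i]) ((v @ w) @ rev [l..<Suc m])" by simp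
  moreover have "set (v @ w) \<subseteq> {1..<m}" using v(1) w(1) by simp
  ultimately show ?case using w(2) by blast
qed

text \<open>The coset representative in the factorisation of a word is determined by its
  permutation, since it moves \<open>k\<close> to \<open>m + 1\<close> and the other factor fixes \<open>m + 1\<close>.
  Cancelling it leaves two words on fewer letters.\<close>

lemma s_cong_if_word_perm_eq:
  assumes "m \<le> n" "set u \<subseteq> {1..<m}" "set v \<subseteq> {1..<m}" "word_perm u = word_perm v"
  shows "s_cong n u v"
  using assms
proof (induction m arbitrary: u v)
  case 0
  then show ?case using s_cong_refl[of "[]" n] by simp
next
  case (Suc m)
  have fix_top: "word_perm w (Suc m) = Suc m" if "set w \<subseteq> {1..<m}" for w
    using word_perm_permutes[OF that] by (auto simp: permutes_def)
  have uv: "set u \<subseteq> {1..m}" "set v \<subseteq> {1..m}" "m < n" using Suc.prems by auto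
  obtain u' k where u': "set u' \<subseteq> {1..<m}" "k \<in> {1..Suc m}" "s_cong n u (u' @ rev [k..<Suc m])"
    using s_cong_coset_form[OF uv(3,1)] by blast
  obtain v' l where v': "set v' \<subseteq> {1..<m}" "l \<in> {1..Suc m}" "s_cong n v (v' @ rev [l..<Suc m])"
    using s_cong_coset_form[OF uv(3,2)] by blast
  have n1: "1 \<le> n" using uv(3) by simp
  have eq: "word_perm u' \<circ> word_perm (rev [k..<Suc m]) = word_perm v' \<circ> word_perm (rev [l..<Suc m])"
    using Suc.prems(4) unfolding s_cong_word_perm[OF n1 u'(3)] s_cong_word_perm[OF n1 v'(3)]
      word_perm_append .
  have inj: "inj (word_perm w)" for w
    using word_perm_rev[of w] by (metis inj_on_id inj_on_imageI2)
  have "(word_perm u' \<circ> word_perm (rev [k..<Suc m])) k = Suc m"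
    using word_perm_descending[of k "Suc m"] u' fix_top by simp
  moreover have "(word_perm v' \<circ> word_perm (rev [l..<Suc m])) l = Suc m"
    using word_perm_descending[of l "Suc m"] v' fix_top by simp
  ultimately have "(word_perm v' \<circ> word_perm (rev [l..<Suc m])) k =
      (word_perm v' \<circ> word_perm (rev [l..<Suc m])) l" unfolding eq by metis
  then have kl: "k = l" using inj by (metis comp_apply injD)
  have "word_perm u' = word_perm v'"
  proof -
    let ?d = "rev [k..<Suc m]"
    have "word_perm u' \<circ> (word_perm ?d \<circ> word_perm (rev ?d)) =
        word_perm v' \<circ> (word_perm ?d \<circ> word_perm (rev ?d))"
      using eq unfolding kl by (metis comp_assoc)
    then show ?thesis unfolding word_perm_rev' by simp
  qed
  then have "s_cong n u' v'" using Suc.IH[OF _ u'(1) v'(1)] uv(3) by simp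
  then have "s_cong n ([] @ u' @ rev [k..<Suc m]) ([] @ v' @ rev [k..<Suc m])"
    using u'(2) uv(3) by (intro s_cong_context) auto
  then have "s_cong n (u' @ rev [k..<Suc m]) (v' @ rev [k..<Suc m])" by simp
  with u'(3) have "s_cong n u (v' @ rev [k..<Suc m])" by (rule s_cong_trans)
  then show ?case using s_cong_sym[OF v'(3)] unfolding kl by (rule s_cong_trans)
qed

text \<open>A descending word moves the preimage of the last letter to the last place; the rest is a
  permutation of fewer letters.\<close>

lemma permutation_is_word:
  assumes "\<sigma> permutes {1..n}" shows "\<exists>u. set u \<subseteq> {1..<n} \<and> word_perm u = \<sigma>"
  using assms
proof (induction n arbitrary: \<sigma>)
  case 0
  then have "\<sigma> = id" by simp
  then show ?case by (intro exI[of _ "[]"]) simp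
next
  case (Suc n)
  define k where "k = inv_into UNIV \<sigma> (Suc n)"
  have k: "\<sigma> k = Suc n" "k \<in> {1..Suc n}"
    using Suc.prems permutes_inverses(1)[OF Suc.prems] permutes_in_image[OF permutes_inv[OF Suc.prems]]
    unfolding k_def by auto
  define d where "d = rev [k..<Suc n]"
  have d: "set d \<subseteq> {1..<Suc n}" "word_perm d k = Suc n"
    using k word_perm_descending[of k "Suc n"] unfolding d_def by auto
  define \<tau> where "\<tau> = \<sigma> \<circ> word_perm (rev d)"
  have perm: "\<tau> permutes insert (Suc n) {1..n}"
    using permutes_compose[OF word_perm_permutes[of "rev d" "Suc n"] Suc.prems] d(1)
    unfolding \<tau>_def by (simp add: atLeastAtMostSuc_conv)
  have fix_top: "\<tau> (Suc n) = Suc n"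
  proof -
    have "word_perm (rev d) (word_perm d k) = k" using word_perm_rev[of d]
      by (metis comp_apply id_apply)
    then show ?thesis using k(1) unfolding \<tau>_def d(2) by simp
  qed
  have "\<tau> permutes {1..n}"
  proof (rule permutes_superset[OF perm])
    fix x assume "x \<in> insert (Suc n) {1..n} - {1..n}"
    then show "\<tau> x = x" using fix_top by (metis DiffE insertE)
  qed
  then obtain u where u: "set u \<subseteq> {1..<n}" "word_perm u = \<tau>" using Suc.IH by blast
  have "word_perm (u @ d) = \<sigma> \<circ> (word_perm (rev d) \<circ> word_perm d)"
    using u(2) unfolding \<tau>_def word_perm_append by (simp add: comp_assoc)
  then have "word_perm (u @ d) = \<sigma>" unfolding word_perm_rev by simp
  moreover have "set (u @ d) \<subseteq> {1..<Suc n}" using u(1) d(1) by auto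
  ultimately show ?case by blast
qed

section \<open>Normal forms\<close>

lemma gen_cong_s_word:
  assumes "1 \<le> n" "set u \<subseteq> {1..<n}" "set v \<subseteq> {1..<n}" "word_perm u = word_perm v"
  shows "gen_cong n (s_word u) (s_word v)"
  using s_cong_if_word_perm_eq[OF order_refl assms(2-4)] unfolding s_cong_def .

lemma gen_cong_context:
  assumes "gen_cong n u v" "a \<in> lists (generators n)" "b \<in> lists (generators n)"
  shows "gen_cong n (a @ u @ b) (a @ v @ b)"
  using assms by (intro gen_cong_append gen_cong_refl)

text \<open>Two idempotents with an arbitrary word between them merge into one. The relation demands
  a first letter that crosses a boundary between blocks of \<open>k\<close>; the word is prefixed with
  such a letter twice, which changes it only by a square.\<close>

lemma gen_cong_sandwich:
  assumes "1 \<le> n" "index_seq n ks" "ks \<noteq> []" "index_seq n ls" "index_seq n qs"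
    "set w \<subseteq> {1..<n}" "set v \<subseteq> {1..<n}"
    "interval_partition n qs = u_map (word_perm v)
      (partition_mult (interval_partition n ks) (u_map (word_perm w) (interval_partition n ls)))"
  shows "gen_cong n (e_word ks @ s_word w @ e_word ls)
    (s_word (rev v) @ e_word qs @ s_word v @ s_word w)"
proof -
  define i where "i = hd ks"
  have iks: "i \<in> set ks" using assms(3) unfolding i_def by simp
  then have i: "i \<in> {1..<n}" using assms(2) unfolding index_seq_def by auto
  let ?w = "i # i # w"
  have perm: "word_perm ?w = word_perm w"
    by (simp only: word_perm_simps comp_assoc[symmetric] Transposition.transpose_comp_involutory
        id_comp)
  have ww: "set ?w \<subseteq> {1..<n}" using i assms(6) by simp
  have cancel: "gen_cong n (s_word ?w) (s_word w)"
    by (rule gen_cong_s_word[OF assms(1) ww assms(6) perm])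
  have rel: "gen_cong n (e_word ks @ s_word ?w @ e_word ls)
      (s_word (rev v) @ e_word qs @ s_word v @ s_word ?w)"
  proof (intro gen_cong_relation relations.e_s_e)
    show "\<forall>b\<in>set (interval_partition n ks). \<not> {hd ?w, hd ?w + 1} \<subseteq> b"
      using interval_partition_separates[OF assms(1,2) iks] by simp
    show "interval_partition n qs = u_map (word_perm v) (partition_mult (interval_partition n ks)
        (phi_map (inv_into UNIV (word_perm ?w)) (interval_partition n ls)))"
      unfolding perm phi_map_inv[OF word_perm_permutes[OF assms(6)]] by (rule assms(8))
  qed (use assms ww in simp_all)
  have "gen_cong n (e_word ks @ s_word w @ e_word ls) (e_word ks @ s_word ?w @ e_word ls)"
    by (intro gen_cong_context gen_cong_sym[OF cancel] e_word_in_lists assms)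
  also note rel
  also have "gen_cong n (s_word (rev v) @ e_word qs @ s_word v @ s_word ?w)
      (s_word (rev v) @ e_word qs @ s_word v @ s_word w)"
    using assms
    by (intro gen_cong_append gen_cong_refl cancel s_word_in_lists e_word_in_lists) simp_all
  finally show ?thesis .
qed

text \<open>With a trivial second idempotent, merging says that conjugation carries idempotents to
  idempotents; this compares different choices of the standardizing word.\<close>

lemma gen_cong_e_conjugate:
  assumes "1 \<le> n" "index_seq n ks" "index_seq n qs" "set v \<subseteq> {1..<n}"
    "u_map (word_perm v) (interval_partition n ks) = interval_partition n qs"
  shows "gen_cong n (e_word ks) (s_word (rev v) @ e_word qs @ s_word v)"
proof (cases "ks = []")
  case True
  have "length (interval_partition n qs) = 1"
    unfolding assms(5)[symmetric] True by (simp add: u_map_def)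
  then have "qs = []" unfolding length_interval_partition by simp
  moreover have "gen_cong n (s_word []) (s_word (rev v @ v))"
    using assms(1,4) word_perm_rev[of v]
    by (intro gen_cong_s_word) (simp_all add: word_perm_append)
  ultimately show ?thesis using True by (simp add: e_word_def)
next
  case False
  have "partition_mult (interval_partition n ks) [{1..n}] = interval_partition n ks"
    by (intro partition_mult_one_right interval_partition_closed assms)
  then have "gen_cong n (e_word ks @ s_word [] @ e_word [])
      (s_word (rev v) @ e_word qs @ s_word v @ s_word [])"
    using assms False by (intro gen_cong_sandwich) (simp_all add: u_map_def)
  then show ?thesis by (simp add: e_word_def)
qed

text \<open>The factor \<open>v\<^sup>-\<^sup>1\<close> is attached to \<open>w\<close> so that the permutation of the whole word is that
  of \<open>w\<close> and its ordered set partition depends on \<open>v\<close> and \<open>q\<close> only.\<close>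

definition normal_word :: "nat list \<Rightarrow> nat list \<Rightarrow> nat list \<Rightarrow> gen list" where
  "normal_word w v qs = s_word (w @ rev v) @ e_word qs @ s_word v"

lemma normal_word_value:
  assumes "1 \<le> n" "set w \<subseteq> {1..<n}" "set v \<subseteq> {1..<n}" "index_seq n qs"
  shows "gen_word_value n (normal_word w v qs) =
    (phi_map (word_perm v) (interval_partition n qs), word_perm w)"
proof -
  have "word_perm (w @ rev v) \<circ> word_perm v = word_perm w"
    unfolding word_perm_append comp_assoc word_perm_rev by simp
  then show ?thesis
    unfolding normal_word_def using assms gen_word_value_form[of n "w @ rev v" v qs] by simp
qed

text \<open>Multiplication by a transposition from the left only changes \<open>w\<close>. Multiplication by an
  idempotent is absorbed by merging it with the one already present.\<close>

lemma exists_normal_word: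
  assumes "1 \<le> n" "u \<in> lists (generators n)"
  shows "\<exists>w v qs. set w \<subseteq> {1..<n} \<and> set v \<subseteq> {1..<n} \<and> index_seq n qs \<and>
    gen_cong n u (normal_word w v qs)"
  using assms(2)
proof (induction u)
  case Nil
  have "gen_cong n [] (normal_word [] [] [])"
    using gen_cong_refl[of "[]" n] by (simp add: normal_word_def e_word_def)
  then show ?case by (intro exI[of _ "[]"]) simp
next
  case (Cons x u)
  then obtain w v qs where IH: "set w \<subseteq> {1..<n}" "set v \<subseteq> {1..<n}" "index_seq n qs"
    "gen_cong n u (normal_word w v qs)" by auto
  have x: "[x] \<in> lists (generators n)" using Cons by simp
  have xu: "gen_cong n ([x] @ u) ([x] @ normal_word w v qs)"
    by (intro gen_cong_append gen_cong_refl IH x)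
  consider i where "x = Gen_s i" "i \<in> {1..<n}"
    | ks where "x = Gen_e ks" "index_seq n ks" "ks \<noteq> []"
    using x unfolding generators_def by auto
  then show ?case
  proof cases
    case (1 i)
    then have "gen_cong n (x # u) (normal_word (i # w) v qs)"
      using xu by (simp add: normal_word_def)
    moreover have "set (i # w) \<subseteq> {1..<n}" using 1 IH(1) by simp
    ultimately show ?thesis using IH(2,3) by blast
  next
    case (2 ks)
    let ?w = "w @ rev v"
    have ww: "set ?w \<subseteq> {1..<n}" using IH by simp
    define p where "p = partition_mult (interval_partition n ks)
      (u_map (word_perm ?w) (interval_partition n qs))"
    have "u_map (word_perm ?w) (interval_partition n qs) \<in> ordered_partitions n"
      unfolding phi_map_inv[OF word_perm_permutes[OF ww], symmetric]
      by (intro phi_map_closed interval_partition_closed assms(1) IH permutes_inv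
          word_perm_permutes ww)
    then have "p \<in> ordered_partitions n"
      unfolding p_def by (intro partition_mult_closed interval_partition_closed assms(1) 2)
    then obtain \<sigma> rs where rs: "\<sigma> permutes {1..n}" "index_seq n rs"
      "u_map \<sigma> p = interval_partition n rs"
      using standardize_partition assms(1) by blast
    obtain z where z: "set z \<subseteq> {1..<n}" "word_perm z = \<sigma>"
      using permutation_is_word[OF rs(1)] by blast
    let ?z = "z @ w"
    have zz: "set ?z \<subseteq> {1..<n}" using z IH by simp
    have "gen_cong n (e_word ks @ s_word ?w @ e_word qs)
        (s_word (rev z) @ e_word rs @ s_word z @ s_word ?w)"
      using rs(3) z(2) by (intro gen_cong_sandwich assms(1) 2 IH rs(2) ww z(1)) (simp add: p_def)
    then have A: "gen_cong n ((e_word ks @ s_word ?w @ e_word qs) @ s_word v)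
        ((s_word (rev z) @ e_word rs @ s_word z @ s_word ?w) @ s_word v)"
      by (rule gen_cong_append[OF _ gen_cong_refl[OF s_word_in_lists[OF IH(2)]]])
    have "word_perm (?z @ rev v @ v) = word_perm ?z"
      using word_perm_rev[of v] by (simp only: word_perm_append comp_id)
    then have B: "gen_cong n (s_word (?z @ rev v @ v)) (s_word ?z)"
      using zz IH(2) by (intro gen_cong_s_word assms(1)) simp_all
    have "word_perm (w @ rev ?z) = word_perm (rev z)"
      using word_perm_rev'[of w]
      by (simp only: rev_append word_perm_append comp_assoc[symmetric] id_comp)
    then have C: "gen_cong n (s_word (rev z)) (s_word (w @ rev ?z))"
      using zz z(1) IH(1) by (intro gen_cong_s_word assms(1)) simp_all
    have "gen_cong n (s_word (rev z) @ e_word rs @ s_word (?z @ rev v @ v))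
        (s_word (w @ rev ?z) @ e_word rs @ s_word ?z)"
      by (intro gen_cong_append B C gen_cong_refl e_word_in_lists rs)
    moreover have "[x] @ normal_word w v qs = (e_word ks @ s_word ?w @ e_word qs) @ s_word v"
      using 2 by (simp add: normal_word_def e_word_def)
    moreover have "(s_word (rev z) @ e_word rs @ s_word z @ s_word ?w) @ s_word v =
        s_word (rev z) @ e_word rs @ s_word (?z @ rev v @ v)" by simp
    ultimately have "gen_cong n ([x] @ u) (s_word (w @ rev ?z) @ e_word rs @ s_word ?z)"
      using xu A by (metis gen_cong_trans)
    then have "gen_cong n (x # u) (normal_word w ?z rs)" unfolding normal_word_def by simp
    then show ?thesis using IH(1) zz rs(2) by blast
  qed
qed

text \<open>If the values agree, \<open>v' v\<^sup>-\<^sup>1\<close> carries the interval partition of the first word to that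
  of the second, so the two idempotents are conjugate by it.\<close>

lemma normal_word_unique:
  assumes n: "1 \<le> n"
    and w: "set w \<subseteq> {1..<n}" "set w' \<subseteq> {1..<n}"
    and v: "set v \<subseteq> {1..<n}" "set v' \<subseteq> {1..<n}"
    and qs: "index_seq n qs" "index_seq n qs'"
    and eq: "gen_word_value n (normal_word w v qs) = gen_word_value n (normal_word w' v' qs')"
  shows "gen_cong n (normal_word w v qs) (normal_word w' v' qs')"
proof -
  have ww: "word_perm w = word_perm w'"
    and p: "phi_map (word_perm v) (interval_partition n qs) =
      phi_map (word_perm v') (interval_partition n qs')"
    using eq normal_word_value[OF n w(1) v(1) qs(1)] normal_word_value[OF n w(2) v(2) qs(2)]
    by simp_all
  let ?u = "v' @ rev v"
  have uu: "set ?u \<subseteq> {1..<n}" using v by simp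
  have vp: "word_perm v permutes {1..n}" "word_perm v' permutes {1..n}"
    by (intro word_perm_permutes v)+
  have "u_map (word_perm ?u) (interval_partition n qs) =
      u_map (word_perm v') (u_map (word_perm (rev v)) (interval_partition n qs))"
    unfolding u_map_def word_perm_append by (simp add: image_comp)
  also have "u_map (word_perm (rev v)) (interval_partition n qs) =
      phi_map (word_perm v) (interval_partition n qs)"
    unfolding phi_map_def u_map_def inv_word_perm ..
  also have "u_map (word_perm v') \<dots> = interval_partition n qs'"
    unfolding p by (rule u_map_phi_map(2)[OF vp(2)])
  finally have "gen_cong n (e_word qs) (s_word (rev ?u) @ e_word qs' @ s_word ?u)"
    by (intro gen_cong_e_conjugate n qs uu)
  then have A: "gen_cong n (normal_word w v qs)
      (s_word (w @ rev v) @ (s_word (rev ?u) @ e_word qs' @ s_word ?u) @ s_word v)"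
    unfolding normal_word_def using w v by (intro gen_cong_context s_word_in_lists) simp_all
  have "word_perm (w @ rev v @ rev ?u) = word_perm (w' @ rev v')"
    using word_perm_rev[of v] ww
    by (simp only: rev_append rev_rev_ident word_perm_append comp_assoc[symmetric])
      (simp only: comp_assoc comp_id id_comp)
  then have B: "gen_cong n (s_word (w @ rev v @ rev ?u)) (s_word (w' @ rev v'))"
    using w v by (intro gen_cong_s_word n) simp_all
  have "word_perm (?u @ v) = word_perm v'"
    using word_perm_rev[of v] by (simp only: word_perm_append comp_assoc comp_id)
  then have C: "gen_cong n (s_word (?u @ v)) (s_word v')"
    using w v by (intro gen_cong_s_word n) simp_all
  have "s_word (w @ rev v) @ (s_word (rev ?u) @ e_word qs' @ s_word ?u) @ s_word v =
      s_word (w @ rev v @ rev ?u) @ e_word qs' @ s_word (?u @ v)" by simp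
  also have "gen_cong n (s_word (w @ rev v @ rev ?u) @ e_word qs' @ s_word (?u @ v))
      (normal_word w' v' qs')"
    unfolding normal_word_def by (intro gen_cong_append B C gen_cong_refl e_word_in_lists qs)
  finally show ?thesis using A by (rule gen_cong_trans[rotated])
qed

theorem partition_perm_monoid_presentation:
  assumes "1 \<le> n"
  shows "has_presentation (partition_perm_monoid n) (generators n) (relations n)"
proof (rule monoid.has_presentationI[OF monoid_partition_perm[OF assms] gen_value_closed[OF assms]
      relations_subset gen_word_value_relation[OF assms]])
  fix u v assume u: "u \<in> lists (generators n)" and v: "v \<in> lists (generators n)"
    and eq: "gen_word_value n u = gen_word_value n v"
  obtain w x qs where 1: "set w \<subseteq> {1..<n}" "set x \<subseteq> {1..<n}" "index_seq n qs"
    "gen_cong n u (normal_word w x qs)" using exists_normal_word[OF assms u] by blast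
  obtain w' x' qs' where 2: "set w' \<subseteq> {1..<n}" "set x' \<subseteq> {1..<n}" "index_seq n qs'"
    "gen_cong n v (normal_word w' x' qs')" using exists_normal_word[OF assms v] by blast
  have "gen_cong n (normal_word w x qs) (normal_word w' x' qs')"
    using eq gen_cong_value[OF assms 1(4)] gen_cong_value[OF assms 2(4)]
    by (intro normal_word_unique assms 1 2) simp
  then have "gen_cong n u v" using 1(4) 2(4) by (metis gen_cong_sym gen_cong_trans)
  then show "(u, v) \<in> generated_congruence (generators n) (relations n)" unfolding gen_cong_def .
next
  fix a assume "a \<in> carrier (partition_perm_monoid n)"
  then obtain p \<sigma> where a: "a = (p, \<sigma>)" "p \<in> ordered_partitions n" "\<sigma> permutes {1..n}"
    by (auto simp: partition_perm_monoid_def)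
  obtain \<tau> qs where q: "\<tau> permutes {1..n}" "index_seq n qs" "u_map \<tau> p = interval_partition n qs"
    using standardize_partition[OF a(2) assms] by blast
  obtain v where v: "set v \<subseteq> {1..<n}" "word_perm v = \<tau>" using permutation_is_word[OF q(1)] by blast
  obtain w where w: "set w \<subseteq> {1..<n}" "word_perm w = \<sigma>" using permutation_is_word[OF a(3)] by blast
  have "gen_word_value n (normal_word w v qs) = a"
    using normal_word_value[OF assms w(1) v(1) q(2)] u_map_phi_map(1)[OF q(1), of p]
    unfolding a(1) v(2) w(2) q(3)[symmetric] by simp
  moreover have "normal_word w v qs \<in> lists (generators n)"
    using w(1) v(1) q(2) e_word_in_lists[of n qs] s_word_in_lists[of "w @ rev v" n] s_word_in_lists[of v n]
    unfolding normal_word_def by (simp del: s_word_simps)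
  ultimately show "\<exists>u\<in>lists (generators n). gen_word_value n u = a" by blast
qed

section \<open>Coordinates and partial monomial maps\<close>

text \<open>The basis is enumerated by \<open>{1..n}\<close>, so that sets of indices describe the subspaces
  spanned by basis vectors and permutations of \<open>{1..n}\<close> permute the basis.\<close>

locale coordinates =
  fixes E :: "(complex ^ 'n::finite) set" and b :: "nat \<Rightarrow> complex ^ 'n" and N :: "nat set"
  assumes basis: "is_basis E" and bij: "bij_betw b N E" and N_eq: "N = {1..CARD('n)}"
begin

definition coord :: "complex ^ 'n \<Rightarrow> nat \<Rightarrow> complex" where
  "coord x i = vec.representation E x (b i)"

lemma independent: "vec.independent E" and span: "x \<in> vec.span E"
  using basis unfolding is_basis_def by auto

lemma finite_N [simp]: "finite N"
  unfolding N_eq by simp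

lemma coord_add [simp]: "coord (x + y) i = coord x i + coord y i"
  unfolding coord_def vec.representation_add[OF independent span span] ..

lemma coord_diff [simp]: "coord (x - y) i = coord x i - coord y i"
  unfolding coord_def vec.representation_diff[OF independent span span] ..

lemma coord_scale [simp]: "coord (c *s x) i = c * coord x i"
  unfolding coord_def vec.representation_scale[OF independent span] ..

lemma coord_zero [simp]: "coord 0 i = 0"
  unfolding coord_def vec.representation_zero ..

lemma coord_sum [simp]: "coord (\<Sum>j\<in>I. f j) i = (\<Sum>j\<in>I. coord (f j) i)"
  unfolding coord_def by (simp add: vec.representation_sum[OF independent span])

lemma b_in_E: "i \<in> N \<Longrightarrow> b i \<in> E"
  using bij unfolding bij_betw_def by auto

lemma b_inj: "i \<in> N \<Longrightarrow> j \<in> N \<Longrightarrow> b i = b j \<longleftrightarrow> i = j"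
  using bij unfolding bij_betw_def inj_on_def by auto

lemma coord_basis: "i \<in> N \<Longrightarrow> j \<in> N \<Longrightarrow> coord (b i) j = (if i = j then 1 else 0)"
  unfolding coord_def vec.representation_basis[OF independent b_in_E] by (auto simp: b_inj)

lemma expansion: "(\<Sum>i\<in>N. coord x i *s b i) = x"
proof -
  have "finite E" using bij finite_N bij_betw_finite by blast
  then have "(\<Sum>v\<in>E. vec.representation E x v *s v) = x"
    by (intro vec.sum_representation_eq independent span) auto
  then show ?thesis
    using sum.reindex_bij_betw[OF bij, of "\<lambda>v. vec.representation E x v *s v"]
    unfolding coord_def by simp
qed

lemma eq_coordI: "(\<And>i. i \<in> N \<Longrightarrow> coord x i = coord y i) \<Longrightarrow> x = y"
  using expansion[of x] expansion[of y] by (metis (no_types, lifting) sum.cong)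

lemma b_nonzero: "i \<in> N \<Longrightarrow> b i \<noteq> 0"
  using coord_basis[of i i] coord_zero[of i] by force

lemma continuous_scale_left: "continuous_on S (\<lambda>c. c *s (v :: complex ^ 'n))"
  unfolding vector_scalar_mult_def by (intro continuous_on_vec_lambda continuous_intros)

text \<open>Coordinates are expressed through the standard coordinates in order to see that they are
  continuous and that they are regular functions of matrix entries.\<close>

lemma coord_as_sum: "coord x i = (\<Sum>k\<in>UNIV. x $ k * coord (axis k 1) i)"
proof -
  have "x = (\<Sum>k\<in>UNIV. x $ k *s axis k 1)" by (simp add: basis_expansion)
  then have "coord x i = coord (\<Sum>k\<in>UNIV. x $ k *s axis k 1) i" by simp
  then show ?thesis by simp
qed

lemma continuous_coord: "continuous_on S (\<lambda>x. coord x i)"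
  by (subst coord_as_sum) (intro continuous_intros)

text \<open>A monomial matrix with the columns outside \<open>S\<close> replaced by zero.\<close>

definition mono_map :: "(nat \<Rightarrow> nat) \<Rightarrow> (nat \<Rightarrow> complex) \<Rightarrow> nat set \<Rightarrow> complex ^ 'n \<Rightarrow> complex ^ 'n" where
  "mono_map \<sigma> d S x = (\<Sum>i\<in>S. (d i * coord x i) *s b (\<sigma> i))"

definition coord_space :: "nat set \<Rightarrow> (complex ^ 'n) set" where
  "coord_space S = {x. \<forall>i\<in>N - S. coord x i = 0}"

lemma coord_space_N [simp]: "coord_space N = UNIV"
  unfolding coord_space_def by simp

lemma coord_space_empty: "coord_space {} = {0}"
  unfolding coord_space_def by (auto intro: eq_coordI)

lemma b_in_coord_space: "i \<in> N \<Longrightarrow> b i \<in> coord_space S \<longleftrightarrow> i \<in> S"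
  unfolding coord_space_def using coord_basis[of i] by auto

lemma coord_space_inj: "S \<subseteq> N \<Longrightarrow> S' \<subseteq> N \<Longrightarrow> coord_space S = coord_space S' \<Longrightarrow> S = S'"
  using b_in_coord_space by blast

lemma coord_space_add: "x \<in> coord_space S \<Longrightarrow> y \<in> coord_space S \<Longrightarrow> x + y \<in> coord_space S"
  and coord_space_scale: "x \<in> coord_space S \<Longrightarrow> c *s x \<in> coord_space S"
  unfolding coord_space_def by auto

lemma coord_space_expansion:
  assumes "x \<in> coord_space S" "S \<subseteq> N" shows "x = (\<Sum>i\<in>S. coord x i *s b i)"
proof -
  have "(\<Sum>i\<in>S. coord x i *s b i) = (\<Sum>i\<in>N. coord x i *s b i)"
    using assms unfolding coord_space_def by (intro sum.mono_neutral_left) auto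
  then show ?thesis using expansion[of x] by simp
qed

lemma mono_map_add: "mono_map \<sigma> d S (x + y) = mono_map \<sigma> d S x + mono_map \<sigma> d S y"
  unfolding mono_map_def by (simp add: distrib_left vector_sadd_rdistrib sum.distrib)

lemma mono_map_scale: "mono_map \<sigma> d S (c *s x) = c *s mono_map \<sigma> d S x"
  unfolding mono_map_def by (simp add: vec.scale_sum_right vector_smult_assoc mult.left_commute)

lemma mono_map_cong: "(\<And>i. i \<in> S \<Longrightarrow> d i = d' i) \<Longrightarrow> mono_map \<sigma> d S = mono_map \<sigma> d' S"
  unfolding mono_map_def by (intro ext sum.cong) auto

lemma mono_map_times: "mono_map \<sigma> (\<lambda>i. c * d i) S x = c *s mono_map \<sigma> d S x"
  unfolding mono_map_def by (simp add: vec.scale_sum_right vector_smult_assoc mult.assoc)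

text \<open>Coordinates of the image are read off at the indices \<open>\<sigma> i\<close>; these are all indices,
  because \<open>\<sigma>\<close> is a permutation.\<close>

lemma coord_mono_map:
  assumes "\<sigma> permutes N" "S \<subseteq> N" "i \<in> N"
  shows "coord (mono_map \<sigma> d S x) (\<sigma> i) = (if i \<in> S then d i * coord x i else 0)"
proof -
  have "coord (mono_map \<sigma> d S x) (\<sigma> i) = (\<Sum>k\<in>S. d k * coord x k * coord (b (\<sigma> k)) (\<sigma> i))"
    unfolding mono_map_def by simp
  also have "\<dots> = (\<Sum>k\<in>S. if k = i then d k * coord x k else 0)"
  proof (rule sum.cong[OF refl])
    fix k assume "k \<in> S"
    then have "\<sigma> k \<in> N" "\<sigma> i \<in> N" using assms permutes_in_image[OF assms(1)] by auto
    moreover have "\<sigma> k = \<sigma> i \<longleftrightarrow> k = i" using permutes_inj[OF assms(1)] by (simp add: inj_eq)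
    ultimately show "d k * coord x k * coord (b (\<sigma> k)) (\<sigma> i) = (if k = i then d k * coord x k else 0)"
      by (simp add: coord_basis)
  qed
  also have "\<dots> = (if i \<in> S then d i * coord x i else 0)"
    using finite_subset[OF assms(2)] by (simp add: sum.delta')
  finally show ?thesis .
qed

lemma eq_coord_permI:
  assumes "\<sigma> permutes N" "\<And>i. i \<in> N \<Longrightarrow> coord x (\<sigma> i) = coord y (\<sigma> i)" shows "x = y"
proof (rule eq_coordI)
  fix i assume "i \<in> N"
  then have "inv_into UNIV \<sigma> i \<in> N"
    using permutes_in_image[OF permutes_inv[OF assms(1)]] by blast
  then show "coord x i = coord y i"
    using assms(2)[of "inv_into UNIV \<sigma> i"] permutes_inverses(1)[OF assms(1)] by simp
qed

lemma mono_map_basis: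
  assumes "i \<in> N" "S \<subseteq> N" shows "mono_map \<sigma> d S (b i) = (if i \<in> S then d i *s b (\<sigma> i) else 0)"
proof -
  have "mono_map \<sigma> d S (b i) = (\<Sum>k\<in>S. if k = i then d k *s b (\<sigma> k) else 0)"
    unfolding mono_map_def using assms coord_basis[OF assms(1)] by (intro sum.cong) auto
  then show ?thesis using finite_subset[OF assms(2)] by (simp add: sum.delta')
qed

definition nonvanishing :: "(nat \<Rightarrow> complex) \<Rightarrow> bool" where
  "nonvanishing d \<longleftrightarrow> (\<forall>i\<in>N. d i \<noteq> 0)"

lemma mono_map_eq_0_iff:
  assumes "\<sigma> permutes N" "S \<subseteq> N" "nonvanishing d"
  shows "mono_map \<sigma> d S x = 0 \<longleftrightarrow> (\<forall>i\<in>S. coord x i = 0)"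
proof
  assume "mono_map \<sigma> d S x = 0"
  then show "\<forall>i\<in>S. coord x i = 0"
    using coord_mono_map[OF assms(1,2), of _ d x] assms(2,3) unfolding nonvanishing_def
    by (metis coord_zero mult_eq_0_iff subsetD)
next
  assume "\<forall>i\<in>S. coord x i = 0"
  then show "mono_map \<sigma> d S x = 0" unfolding mono_map_def by simp
qed

lemma mono_map_comp:
  assumes "\<tau> permutes N" "S \<subseteq> N" "S' \<subseteq> N"
  shows "mono_map \<sigma> d S \<circ> mono_map \<tau> d' S' = mono_map (\<sigma> \<circ> \<tau>) (\<lambda>i. d (\<tau> i) * d' i) (\<tau> -` S \<inter> S')"
proof
  fix x
  have inv: "bij_betw \<tau> (\<tau> -` S) S"
    using permutes_bij[OF assms(1)] unfolding bij_betw_def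
    by (auto simp: inj_on_def image_vimage_eq)
  have sub: "\<tau> -` S \<subseteq> N" using assms(2) permutes_in_image[OF assms(1)] by auto
  have "(mono_map \<sigma> d S \<circ> mono_map \<tau> d' S') x = (\<Sum>i\<in>\<tau> -` S. (d (\<tau> i) * coord (mono_map \<tau> d' S' x) (\<tau> i)) *s b (\<sigma> (\<tau> i)))"
    unfolding mono_map_def[of \<sigma>] comp_apply by (rule sum.reindex_bij_betw[OF inv, symmetric])
  also have "\<dots> = (\<Sum>i\<in>\<tau> -` S. if i \<in> S' then (d (\<tau> i) * d' i * coord x i) *s b (\<sigma> (\<tau> i)) else 0)"
    using sub by (intro sum.cong refl) (simp add: coord_mono_map[OF assms(1,3)] subset_iff)
  also have "\<dots> = (\<Sum>i\<in>\<tau> -` S \<inter> S'. (d (\<tau> i) * d' i * coord x i) *s b (\<sigma> (\<tau> i)))"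
    using finite_subset[OF sub] by (simp add: sum.inter_restrict)
  finally show "(mono_map \<sigma> d S \<circ> mono_map \<tau> d' S') x = mono_map (\<sigma> \<circ> \<tau>) (\<lambda>i. d (\<tau> i) * d' i) (\<tau> -` S \<inter> S') x"
    unfolding mono_map_def[of "\<sigma> \<circ> \<tau>"] by simp
qed

section \<open>Block sequences\<close>

text \<open>The indices of the basis vectors that span the \<open>j\<close>-th space of the flag.\<close>

definition tail :: "nat set list \<Rightarrow> nat \<Rightarrow> nat set" where
  "tail p j = \<Union>(set (drop j p))"

abbreviation OP :: "nat set list set" where "OP \<equiv> ordered_partitions (card N)"

lemma N_card: "{1..card N} = N"
  using N_eq by simp

lemma OP_D:
  assumes "p \<in> OP"
  shows "sorted_wrt disjnt p" "{} \<notin> set p" "\<Union>(set p) = N"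
  using assms unfolding ordered_partitions_def N_card by simp_all

lemma tail_0: "p \<in> OP \<Longrightarrow> tail p 0 = N"
  unfolding tail_def using OP_D by simp

lemma tail_length [simp]: "tail p (length p) = {}"
  unfolding tail_def by simp

lemma tail_Suc: "j < length p \<Longrightarrow> tail p j = p ! j \<union> tail p (Suc j)"
  unfolding tail_def by (simp add: Cons_nth_drop_Suc[symmetric])

lemma tail_subset: "p \<in> OP \<Longrightarrow> tail p j \<subseteq> N"
  unfolding tail_def using OP_D(3)[of p] by (auto dest: in_set_dropD)

lemma block_subset: "p \<in> OP \<Longrightarrow> j < length p \<Longrightarrow> p ! j \<subseteq> N"
  using OP_D(3)[of p] nth_mem[of j p] by blast

lemma block_tail_disjoint:
  assumes "p \<in> OP" "j < length p" shows "p ! j \<inter> tail p (Suc j) = {}"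
proof -
  have "disjnt (p ! j) c" if c: "c \<in> set (drop (Suc j) p)" for c
  proof -
    obtain k where k: "k < length p - Suc j" "c = drop (Suc j) p ! k"
      using c by (auto simp: in_set_conv_nth)
    then show ?thesis using OP_D(1)[OF assms(1)] unfolding sorted_wrt_iff_nth_less by simp
  qed
  then show ?thesis unfolding tail_def disjnt_def by blast
qed

lemma block_nonempty: "p \<in> OP \<Longrightarrow> j < length p \<Longrightarrow> p ! j \<noteq> {}"
  using OP_D(2)[of p] nth_mem by metis

lemma block_sub_tail: "j < length p \<Longrightarrow> p ! j \<subseteq> tail p j"
  using tail_Suc by blast

lemma OP_nonempty: "p \<in> OP \<Longrightarrow> p \<noteq> []"
  using OP_D(3)[of p] unfolding N_eq by auto

text \<open>The element of \<open>M\<close> with ordered set partition \<open>p\<close>, permutation \<open>\<sigma>\<close> and coefficients \<open>d\<close>.\<close>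

definition block_seq :: "nat set list \<Rightarrow> (nat \<Rightarrow> nat) \<Rightarrow> (nat \<Rightarrow> complex) \<Rightarrow> 'n vmap list" where
  "block_seq p \<sigma> d = map (\<lambda>j. restrict (mono_map \<sigma> d (p ! j)) (coord_space (tail p j))) [0..<length p]"

lemma length_block_seq [simp]: "length (block_seq p \<sigma> d) = length p"
  unfolding block_seq_def by simp

lemma nth_block_seq:
  "j < length p \<Longrightarrow> block_seq p \<sigma> d ! j = restrict (mono_map \<sigma> d (p ! j)) (coord_space (tail p j))"
  unfolding block_seq_def by simp

lemma flag_block_seq:
  assumes "p \<in> OP" "\<sigma> permutes N" "nonvanishing d"
  shows "j \<le> length p \<Longrightarrow> flag (block_seq p \<sigma> d) j = coord_space (tail p j)"
proof (induction j)
  case 0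
  then show ?case using tail_0[OF assms(1)] by simp
next
  case (Suc j)
  then have j: "j < length p" by simp
  have sub: "p ! j \<subseteq> N" by (rule block_subset[OF assms(1) j])
  have "flag (block_seq p \<sigma> d) (Suc j) =
      {x \<in> coord_space (tail p j). \<forall>i\<in>p ! j. coord x i = 0}"
    using Suc j by (auto simp: nth_block_seq mono_map_eq_0_iff[OF assms(2) sub assms(3)])
  also have "\<dots> = coord_space (tail p (Suc j))"
    using block_tail_disjoint[OF assms(1) j] sub
    unfolding tail_Suc[OF j] coord_space_def by blast
  finally show ?case .
qed

lemma hom_space_restrict_mono_map: "restrict (mono_map \<sigma> d S) (coord_space S') \<in> hom_space (coord_space S')"
  unfolding hom_space_def
  by (auto simp: coord_space_add coord_space_scale mono_map_add mono_map_scale)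

lemma block_seq_in_M_seqs:
  assumes "p \<in> OP" "\<sigma> permutes N" "nonvanishing d"
  shows "block_seq p \<sigma> d \<in> M_seqs"
proof -
  have "block_seq p \<sigma> d ! j \<in> nonzero_hom (flag (block_seq p \<sigma> d) j)" if j: "j < length p" for j
  proof -
    obtain i where i: "i \<in> p ! j" using block_nonempty[OF assms(1) j] by blast
    then have iN: "i \<in> N" using block_subset[OF assms(1) j] by blast
    have "b i \<in> coord_space (tail p j)"
      using i block_sub_tail[OF j] by (auto simp: b_in_coord_space[OF iN])
    moreover have "mono_map \<sigma> d (p ! j) (b i) \<noteq> 0"
      using i iN coord_basis[OF iN iN]
      by (auto simp: mono_map_eq_0_iff[OF assms(2) block_subset[OF assms(1) j] assms(3)]
          intro!: bexI[of _ i])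
    ultimately show ?thesis
      unfolding nonzero_hom_def flag_block_seq[OF assms less_imp_le[OF j]] nth_block_seq[OF j]
      using hom_space_restrict_mono_map by auto
  qed
  moreover have "flag (block_seq p \<sigma> d) (length p) = {0}"
    using flag_block_seq[OF assms, of "length p"] coord_space_empty by simp
  moreover have "block_seq p \<sigma> d \<noteq> []"
    using OP_nonempty[OF assms(1)] length_block_seq[of p \<sigma> d] by (metis length_0_conv)
  ultimately show ?thesis unfolding M_seqs_def by simp
qed

text \<open>This is how a sequence remembers its permutation: a condition that survives limits, does
  not mention the coefficients and makes sense for sequences with arbitrary flags.\<close>

definition monomial_type :: "(nat \<Rightarrow> nat) \<Rightarrow> 'n vmap list \<Rightarrow> bool" where
  "monomial_type \<sigma> As \<longleftrightarrow> (\<forall>j<length As. \<forall>x\<in>flag As j. \<forall>i\<in>N. coord x i = 0 \<longrightarrow> coord ((As ! j) x) (\<sigma> i) = 0)"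

lemma monomial_type_block_seq:
  assumes "p \<in> OP" "\<sigma> permutes N" "nonvanishing d"
  shows "monomial_type \<sigma> (block_seq p \<sigma> d)"
  unfolding monomial_type_def
  using flag_block_seq[OF assms] coord_mono_map[OF assms(2) block_subset[OF assms(1)]]
  by (auto simp: nth_block_seq)

lemma hom_space_sum:
  assumes A: "A \<in> hom_space (coord_space S)" and S: "S \<subseteq> N" "finite I" "I \<subseteq> S"
  shows "A (\<Sum>i\<in>I. c i *s b i) = (\<Sum>i\<in>I. c i *s A (b i))"
  using S(2,3)
proof (induction I)
  case empty
  have "0 \<in> coord_space S" unfolding coord_space_def by simp
  then have "A (0 *s 0) = 0 *s A 0" using A unfolding hom_space_def by blast
  then show ?case by simp
next
  case (insert i I)
  have bi: "b k \<in> coord_space S" if "k \<in> S" for k using that S(1) b_in_coord_space by blast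
  have "(\<Sum>k\<in>I. c k *s b k) \<in> coord_space S"
    unfolding coord_space_def using bi insert.prems
    by (auto simp: coord_space_def intro!: sum.neutral)
  moreover have "b i \<in> coord_space S" using bi insert.prems by blast
  ultimately show ?case
    using A insert coord_space_scale[of "b i" S "c i"] unfolding hom_space_def by simp
qed

text \<open>All coordinates of a basis vector but one vanish, so by the type condition its image is
  a multiple of one basis vector.\<close>

lemma monomial_type_hom:
  assumes A: "A \<in> hom_space (coord_space S)" and S: "S \<subseteq> N" and \<sigma>: "\<sigma> permutes N"
    and type: "\<And>x i. x \<in> coord_space S \<Longrightarrow> i \<in> N \<Longrightarrow> coord x i = 0 \<Longrightarrow> coord (A x) (\<sigma> i) = 0"
    and x: "x \<in> coord_space S"
  shows "A x = mono_map \<sigma> (\<lambda>i. coord (A (b i)) (\<sigma> i)) S x"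
proof -
  have "A x = A (\<Sum>i\<in>S. coord x i *s b i)" using coord_space_expansion[OF x S] by simp
  also have "\<dots> = (\<Sum>i\<in>S. coord x i *s A (b i))"
    using A S finite_subset[OF S finite_N] by (intro hom_space_sum[of A S]) auto
  also have "\<dots> = mono_map \<sigma> (\<lambda>i. coord (A (b i)) (\<sigma> i)) S x"
    unfolding mono_map_def
  proof (rule sum.cong[OF refl])
    fix i assume i: "i \<in> S"
    then have iN: "i \<in> N" using S by blast
    have "A (b i) = coord (A (b i)) (\<sigma> i) *s b (\<sigma> i)"
    proof (rule eq_coord_permI[OF \<sigma>])
      fix k assume k: "k \<in> N"
      have "coord (A (b i)) (\<sigma> k) = 0" if "k \<noteq> i"
        using type[of "b i" k] i iN k that coord_basis[OF iN k] by (simp add: b_in_coord_space)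
      moreover have "\<sigma> i \<in> N" "\<sigma> k \<in> N" using permutes_in_image[OF \<sigma>] iN k by auto
      moreover have "\<sigma> i = \<sigma> k \<longleftrightarrow> i = k" using permutes_inj[OF \<sigma>] by (simp add: inj_eq)
      ultimately show "coord (A (b i)) (\<sigma> k) = coord (coord (A (b i)) (\<sigma> i) *s b (\<sigma> i)) (\<sigma> k)"
        by (auto simp: coord_basis)
    qed
    then have "coord x i *s A (b i) = coord x i *s (coord (A (b i)) (\<sigma> i) *s b (\<sigma> i))" by simp
    then show "coord x i *s A (b i) = (coord (A (b i)) (\<sigma> i) * coord x i) *s b (\<sigma> i)"
      by (simp add: vector_smult_assoc mult.commute)
  qed
  finally show ?thesis .
qed

text \<open>By the type condition the first map is monomial on the whole space, so its kernel is
  spanned by basis vectors; this repeats on each kernel in turn. The \<open>j\<close>-th block consists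
  of the indices that are lost between the \<open>j\<close>-th and the next kernel.\<close>

lemma monomial_type_imp_block_seq:
  assumes As: "As \<in> M_seqs" and \<sigma>: "\<sigma> permutes N" and type: "monomial_type \<sigma> As"
  shows "\<exists>p d. p \<in> OP \<and> nonvanishing d \<and> As = block_seq p \<sigma> d"
proof -
  define m where "m = length As"
  \<comment> \<open>the indices of the basis vectors in the \<open>j\<close>-th kernel, and the coefficients of the \<open>j\<close>-th map\<close>
  define F where "F j = {i \<in> N. b i \<in> flag As j}" for j
  define D where "D j i = coord ((As ! j) (b i)) (\<sigma> i)" for j i
  have FN: "F j \<subseteq> N" for j unfolding F_def by auto
  have hom: "As ! j \<in> nonzero_hom (flag As j)" if "j < m" for j
    using As that unfolding M_seqs_def m_def by auto
  have mono_map: "(As ! j) x = mono_map \<sigma> (D j) (F j) x"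
    if "j < m" "flag As j = coord_space (F j)" "x \<in> flag As j" for j x
    unfolding D_def
  proof (rule monomial_type_hom[OF _ FN \<sigma>])
    show "As ! j \<in> hom_space (coord_space (F j))"
      using hom[OF that(1)] that(2) unfolding nonzero_hom_def by auto
    show "coord ((As ! j) y) (\<sigma> i) = 0" if "y \<in> coord_space (F j)" "i \<in> N" "coord y i = 0" for y i
      using type that \<open>j < m\<close> \<open>flag As j = coord_space (F j)\<close>
      unfolding monomial_type_def m_def by auto
    show "x \<in> coord_space (F j)" using that by simp
  qed
  have step: "flag As (Suc j) = coord_space {i \<in> F j. D j i = 0}"
    if j: "j < m" and fj: "flag As j = coord_space (F j)" for j
  proof (rule Set.set_eqI)
    fix x
    have "x \<in> flag As (Suc j) \<longleftrightarrow> x \<in> coord_space (F j) \<and> mono_map \<sigma> (D j) (F j) x = 0"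
      using mono_map[OF j fj, of x] fj by auto
    also have "\<dots> \<longleftrightarrow> x \<in> coord_space (F j) \<and> (\<forall>i\<in>F j. D j i = 0 \<or> coord x i = 0)"
    proof (intro conj_cong refl iffI ballI)
      fix i assume "mono_map \<sigma> (D j) (F j) x = 0" "i \<in> F j"
      then show "D j i = 0 \<or> coord x i = 0"
        using coord_mono_map[OF \<sigma> FN[of j], of i "D j" x] FN[of j] by (auto simp: subset_iff)
    next
      assume "\<forall>i\<in>F j. D j i = 0 \<or> coord x i = 0"
      then show "mono_map \<sigma> (D j) (F j) x = 0" unfolding mono_map_def by (intro sum.neutral) auto
    qed
    also have "\<dots> \<longleftrightarrow> x \<in> coord_space {i \<in> F j. D j i = 0}"
      using FN[of j] unfolding coord_space_def by auto
    finally show "x \<in> flag As (Suc j) \<longleftrightarrow> x \<in> coord_space {i \<in> F j. D j i = 0}" .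
  qed
  have F_cs: "F j = S" if "flag As j = coord_space S" "S \<subseteq> N" for j S
    using that b_in_coord_space unfolding F_def by auto
  have fl: "flag As j = coord_space (F j)" if "j \<le> m" for j
    using that
  proof (induction j)
    case 0
    then show ?case unfolding F_def by simp
  next
    case (Suc j)
    then have "flag As (Suc j) = coord_space {i \<in> F j. D j i = 0}" by (intro step) auto
    moreover from this have "F (Suc j) = {i \<in> F j. D j i = 0}"
      using FN[of j] by (intro F_cs) auto
    ultimately show ?case by simp
  qed
  have F_Suc: "F (Suc j) = {i \<in> F j. D j i = 0}" if "j < m" for j
    using step[OF that fl] that FN[of j] by (intro F_cs) auto
  have F_0: "F 0 = N" unfolding F_def by simp
  have F_m: "F m = {}"
    using As b_nonzero unfolding F_def m_def M_seqs_def by auto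
  have F_antimono: "F k \<subseteq> F j" if "j \<le> k" "k \<le> m" for j k
    using that
  proof (induction k)
    case (Suc k)
    show ?case
    proof (cases "j = Suc k")
      case False
      then have "F k \<subseteq> F j" using Suc by simp
      then show ?thesis using F_Suc[of k] Suc.prems by auto
    qed simp
  qed simp
  define p where "p = map (\<lambda>j. F j - F (Suc j)) [0..<m]"
  have lp: "length p = m" and pj: "\<And>j. j < m \<Longrightarrow> p ! j = F j - F (Suc j)"
    unfolding p_def by auto
  have tp: "tail p j = F j" if "j \<le> m" for j
    using that
  proof (induction j rule: inc_induct)
    case base
    then show ?case using F_m lp tail_length[of p] by simp
  next
    case (step j)
    then show ?case using F_antimono[of j "Suc j"] by (auto simp: tail_Suc lp pj)
  qed
  have ne: "p ! j \<noteq> {}" if j: "j < m" for j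
  proof -
    obtain x where x: "x \<in> flag As j" "(As ! j) x \<noteq> 0"
      using hom[OF j] unfolding nonzero_hom_def by auto
    then have "mono_map \<sigma> (D j) (F j) x \<noteq> 0" using mono_map[OF j fl] j by auto
    then obtain i where "i \<in> F j" "D j i \<noteq> 0"
      unfolding mono_map_def
      by (metis (no_types, lifting) mult_zero_left sum.neutral vector_smult_lzero)
    then show ?thesis using F_Suc[OF j] pj[OF j] by auto
  qed
  have disj: "p ! i \<inter> p ! j = {}" if "i < j" "j < m" for i j
    using that F_antimono[of "Suc i" j] by (auto simp: pj)
  have pOP: "p \<in> OP"
    unfolding ordered_partitions_def
  proof (intro CollectI conjI)
    show "sorted_wrt disjnt p"
      unfolding sorted_wrt_iff_nth_less disjnt_def using disj lp by auto
    show "{} \<notin> set p" using ne lp by (auto simp: in_set_conv_nth)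
    show "\<Union>(set p) = {1..card N}" using tp[of 0] F_0 N_eq unfolding tail_def by simp
  qed
  \<comment> \<open>each index belongs to one block, and takes its coefficient from the map of that block\<close>
  have "\<forall>i\<in>N. \<exists>j. j < m \<and> i \<in> p ! j"
    using OP_D(3)[OF pOP] lp by (metis UnionE in_set_conv_nth)
  then obtain lvl where lvl: "\<And>i. i \<in> N \<Longrightarrow> lvl i < m \<and> i \<in> p ! lvl i" by metis
  have lvl_eq: "lvl i = j" if "j < m" "i \<in> p ! j" for i j
  proof -
    have "i \<in> N" using that pj FN by auto
    then show ?thesis using lvl[of i] disj[of j "lvl i"] disj[of "lvl i" j] that
      by (cases j "lvl i" rule: linorder_cases) auto
  qed
  define d where "d i = D (lvl i) i" for i
  have "nonvanishing d"
    unfolding nonvanishing_def d_def using lvl F_Suc pj by fastforce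
  moreover have "As = block_seq p \<sigma> d"
  proof (rule nth_equalityI)
    show "length As = length (block_seq p \<sigma> d)" using lp m_def by simp
    fix j assume "j < length As"
    then have j: "j < m" unfolding m_def .
    have flj: "flag As j = coord_space (F j)" using fl j by simp
    have "(As ! j) x = mono_map \<sigma> d (p ! j) x" if x: "x \<in> flag As j" for x
    proof -
      have "(As ! j) x = mono_map \<sigma> (D j) (F j) x" by (rule mono_map[OF j flj x])
      also have "\<dots> = mono_map \<sigma> (D j) (p ! j) x"
        unfolding mono_map_def using F_Suc[OF j] pj[OF j] FN[of j] finite_subset[OF FN[of j]]
        by (intro sum.mono_neutral_right) auto
      also have "\<dots> = mono_map \<sigma> d (p ! j) x"
        unfolding d_def using lvl_eq[OF j] by (metis (no_types, lifting) mono_map_cong)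
      finally show ?thesis .
    qed
    moreover have "As ! j \<in> extensional (flag As j)"
      using hom[OF j] unfolding nonzero_hom_def hom_space_def by auto
    ultimately show "As ! j = block_seq p \<sigma> d ! j"
      using j lp tp[of j] flj by (auto simp: nth_block_seq restrict_def extensional_def fun_eq_iff)
  qed
  ultimately show ?thesis using pOP by blast
qed

end

section \<open>Projective classes of block sequences\<close>

lemma proj_class_scale:
  assumes "c \<noteq> 0" "\<And>x. x \<in> W \<Longrightarrow> B x = c *s A x"
  shows "proj_class W B = proj_class W A"
proof -
  have "restrict (\<lambda>x. k *s B x) W = restrict (\<lambda>x. (k * c) *s A x) W" for k
    using assms(2) by (auto simp: restrict_def vector_smult_assoc)
  then have "proj_class W B = {restrict (\<lambda>x. (k * c) *s A x) W | k. k \<noteq> 0}"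
    unfolding proj_class_def by simp
  also have "\<dots> = proj_class W A"
    unfolding proj_class_def
  proof (intro equalityI subsetI)
    fix f assume "f \<in> {restrict (\<lambda>x. k *s A x) W | k. k \<noteq> 0}"
    then obtain k where "f = restrict (\<lambda>x. (k / c * c) *s A x) W" "k / c \<noteq> 0" using assms(1) by auto
    then show "f \<in> {restrict (\<lambda>x. (k * c) *s A x) W | k. k \<noteq> 0}" by blast
  qed (use assms(1) in auto)
  finally show ?thesis .
qed

lemma proj_class_self: "A \<in> extensional W \<Longrightarrow> A \<in> proj_class W A"
  unfolding proj_class_def by (intro CollectI exI[of _ 1]) (simp add: extensional_restrict)

lemma proj_class_eqD:
  assumes "proj_class W A = proj_class W B" "B \<in> extensional W"
  shows "\<exists>c. c \<noteq> 0 \<and> (\<forall>x\<in>W. B x = c *s A x)"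
proof -
  have "B \<in> proj_class W A" unfolding assms(1) by (rule proj_class_self[OF assms(2)])
  then obtain c where "c \<noteq> 0" "B = restrict (\<lambda>x. c *s A x) W" unfolding proj_class_def by auto
  then show ?thesis by auto
qed

lemma M_seqs_extensional:
  "As \<in> M_seqs \<Longrightarrow> j < length As \<Longrightarrow> As ! j \<in> extensional (flag As j)"
  unfolding M_seqs_def nonzero_hom_def hom_space_def by auto

lemma length_proj_seq [simp]: "length (proj_seq As) = length As"
  unfolding proj_seq_def by simp

lemma nth_proj_seq: "j < length As \<Longrightarrow> proj_seq As ! j = proj_class (flag As j) (As ! j)"
  unfolding proj_seq_def by simp

lemma proj_seq_eqD:
  assumes "proj_seq As = proj_seq Bs" "Bs \<in> M_seqs"
  shows "length As = length Bs" "j \<le> length As \<Longrightarrow> flag As j = flag Bs j"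
    "j < length As \<Longrightarrow> \<exists>c. c \<noteq> 0 \<and> (\<forall>x\<in>flag As j. (Bs ! j) x = c *s (As ! j) x)"
proof -
  show len: "length As = length Bs" using assms(1) length_proj_seq by metis
  have scale: "\<exists>c. c \<noteq> 0 \<and> (\<forall>x\<in>flag As j. (Bs ! j) x = c *s (As ! j) x)"
    if "j < length As" "flag As j = flag Bs j" for j
  proof (rule proj_class_eqD)
    show "proj_class (flag As j) (As ! j) = proj_class (flag As j) (Bs ! j)"
      using assms(1) nth_proj_seq that len by metis
    show "Bs ! j \<in> extensional (flag As j)"
      using M_seqs_extensional[OF assms(2)] that len by simp
  qed
  have fl: "flag As j = flag Bs j" if "j \<le> length As" for j
    using that
  proof (induction j)
    case (Suc j)
    then have eq: "flag As j = flag Bs j" by simp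
    obtain c where c: "c \<noteq> 0" "\<forall>x\<in>flag As j. (Bs ! j) x = c *s (As ! j) x"
      using scale[of j] Suc.prems eq by auto
    show ?case using c by (auto simp flip: eq)
  qed simp
  show "j \<le> length As \<Longrightarrow> flag As j = flag Bs j" by (rule fl)
  show "j < length As \<Longrightarrow> \<exists>c. c \<noteq> 0 \<and> (\<forall>x\<in>flag As j. (Bs ! j) x = c *s (As ! j) x)"
    using scale fl by simp
qed

lemma proj_seq_eqI:
  assumes "length As = length Bs" "\<And>j. j < length As \<Longrightarrow> flag As j = flag Bs j"
    "\<And>j. j < length As \<Longrightarrow> \<exists>c. c \<noteq> 0 \<and> (\<forall>x\<in>flag As j. (Bs ! j) x = c *s (As ! j) x)"
  shows "proj_seq As = proj_seq Bs"
proof (rule nth_equalityI)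
  fix j assume "j < length (proj_seq As)"
  then have j: "j < length As" "j < length Bs" using assms(1) by auto
  obtain c where "c \<noteq> 0" "\<forall>x\<in>flag As j. (Bs ! j) x = c *s (As ! j) x" using assms(3)[OF j(1)]
    by blast
  then have "proj_class (flag As j) (Bs ! j) = proj_class (flag As j) (As ! j)"
    by (intro proj_class_scale) auto
  then show "proj_seq As ! j = proj_seq Bs ! j"
    using j assms(2)[OF j(1)] by (simp add: nth_proj_seq)
qed (simp add: assms(1))

lemma representative:
  assumes "As \<in> M_seqs"
  shows "representative (proj_seq As) \<in> M_seqs" "proj_seq (representative (proj_seq As)) = proj_seq As"
proof -
  have "\<exists>Bs. Bs \<in> M_seqs \<and> proj_seq Bs = proj_seq As" using assms by blast
  then have "representative (proj_seq As) \<in> M_seqs \<and> proj_seq (representative (proj_seq As)) = proj_seq As"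
    unfolding representative_def by (rule someI_ex)
  then show "representative (proj_seq As) \<in> M_seqs"
    "proj_seq (representative (proj_seq As)) = proj_seq As" by auto
qed

context coordinates
begin

lemma monomial_type_proj_seq:
  assumes "proj_seq As = proj_seq Bs" "Bs \<in> M_seqs" "monomial_type \<sigma> As"
  shows "monomial_type \<sigma> Bs"
  unfolding monomial_type_def
proof (intro allI impI ballI)
  fix j x i assume j: "j < length Bs" and x: "x \<in> flag Bs j" and i: "i \<in> N" "coord x i = 0"
  have jA: "j < length As" using j proj_seq_eqD(1)[OF assms(1,2)] by simp
  then have xA: "x \<in> flag As j" using x proj_seq_eqD(2)[OF assms(1,2), of j] by simp
  obtain c where "(Bs ! j) x = c *s (As ! j) x"
    using proj_seq_eqD(3)[OF assms(1,2) jA] xA by blast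
  then show "coord ((Bs ! j) x) (\<sigma> i) = 0"
    using assms(3) jA xA i unfolding monomial_type_def by simp
qed

definition bclass :: "nat set list \<Rightarrow> (nat \<Rightarrow> nat) \<Rightarrow> (nat \<Rightarrow> complex) \<Rightarrow> 'n vmap set list" where
  "bclass p \<sigma> d = proj_seq (block_seq p \<sigma> d)"

text \<open>Coefficient vectors that differ by one scalar on each block: the ambiguity that remains
  after each map of a sequence is replaced by its projective class.\<close>

definition block_scaling :: "nat set list \<Rightarrow> (nat \<Rightarrow> complex) \<Rightarrow> (nat \<Rightarrow> complex) \<Rightarrow> bool" where
  "block_scaling p d d' \<longleftrightarrow> (\<forall>S\<in>set p. \<exists>c. c \<noteq> 0 \<and> (\<forall>i\<in>S. d' i = c * d i))"

lemma bclass_eqI: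
  assumes "p \<in> OP" "\<sigma> permutes N" "nonvanishing d" "nonvanishing d'" "block_scaling p d d'"
  shows "bclass p \<sigma> d = bclass p \<sigma> d'"
  unfolding bclass_def
proof (rule proj_seq_eqI)
  fix j assume "j < length (block_seq p \<sigma> d)"
  then have j: "j < length p" by simp
  show fl: "flag (block_seq p \<sigma> d) j = flag (block_seq p \<sigma> d') j"
    using j by (simp add: flag_block_seq assms less_imp_le)
  obtain c where c: "c \<noteq> 0" "\<forall>i\<in>p ! j. d' i = c * d i"
    using assms(5) j unfolding block_scaling_def by (metis nth_mem)
  then have "mono_map \<sigma> d' (p ! j) x = c *s mono_map \<sigma> d (p ! j) x" for x
    unfolding mono_map_times[symmetric] using mono_map_cong[of "p ! j" d' "\<lambda>i. c * d i"] by metis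
  then show "\<exists>c. c \<noteq> 0 \<and> (\<forall>x\<in>flag (block_seq p \<sigma> d) j.
      (block_seq p \<sigma> d' ! j) x = c *s (block_seq p \<sigma> d ! j) x)"
    using c(1) j by (intro exI[of _ c])
      (auto simp: nth_block_seq flag_block_seq assms less_imp_le)
qed simp

text \<open>The kernels of a sequence depend only on the projective classes, and they determine the
  blocks. On a basis vector of the \<open>j\<close>-th block the two maps are proportional, which gives
  the permutation and the scalar of the block.\<close>

lemma bclass_eqD:
  assumes p: "p \<in> OP" "\<sigma> permutes N" "nonvanishing d"
    and p': "p' \<in> OP" "\<sigma>' permutes N" "nonvanishing d'"
    and eq: "bclass p \<sigma> d = bclass p' \<sigma>' d'"
  shows "p = p'" "\<sigma> = \<sigma>'" "block_scaling p d d'"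
proof -
  note D = proj_seq_eqD[OF eq[unfolded bclass_def] block_seq_in_M_seqs[OF p']]
  have len: "length p = length p'" using D(1) by simp
  have "coord_space (tail p j) = coord_space (tail p' j)" if "j \<le> length p" for j
    using D(2)[of j] that len by (simp add: flag_block_seq[OF p] flag_block_seq[OF p'])
  then have tails: "tail p j = tail p' j" if "j \<le> length p" for j
    using that by (intro coord_space_inj tail_subset p(1) p'(1)) auto
  have diff: "q ! j = tail q j - tail q (Suc j)" if "q \<in> OP" "j < length q" for q j
    using tail_Suc[OF that(2)] block_tail_disjoint[OF that] by blast
  show pp: "p = p'"
  proof (rule nth_equalityI[OF len])
    fix j assume "j < length p"
    then show "p ! j = p' ! j"
      using diff[OF p(1), of j] diff[OF p'(1), of j] tails[of j] tails[of "Suc j"] len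
      by simp
  qed
  have scale: "\<exists>c. c \<noteq> 0 \<and> (\<forall>i\<in>p ! j. d' i *s b (\<sigma>' i) = (c * d i) *s b (\<sigma> i))" if j: "j < length p"
    for j
  proof -
    obtain c where c: "c \<noteq> 0" "\<forall>x\<in>coord_space (tail p j).
        (block_seq p' \<sigma>' d' ! j) x = c *s (block_seq p \<sigma> d ! j) x"
      using D(3)[of j] j by (auto simp: flag_block_seq[OF p])
    have "d' i *s b (\<sigma>' i) = (c * d i) *s b (\<sigma> i)" if i: "i \<in> p ! j" for i
    proof -
      have iN: "i \<in> N" using block_subset[OF p(1) j] i by blast
      have "b i \<in> coord_space (tail p j)"
        using i block_sub_tail[OF j] by (auto simp: b_in_coord_space[OF iN])
      then have "mono_map \<sigma>' d' (p ! j) (b i) = c *s mono_map \<sigma> d (p ! j) (b i)"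
        using c(2) j pp by (auto simp: nth_block_seq)
      then show ?thesis using i iN block_subset[OF p(1) j]
        by (simp add: mono_map_basis vector_smult_assoc)
    qed
    then show ?thesis using c(1) by blast
  qed
  have same: "\<sigma> i = \<sigma>' i" if i: "i \<in> N" for i
  proof -
    obtain j where j: "j < length p" "i \<in> p ! j"
      using i OP_D(3)[OF p(1)] by (metis UnionE in_set_conv_nth)
    obtain c where c: "d' i *s b (\<sigma>' i) = (c * d i) *s b (\<sigma> i)" using scale[OF j(1)] j(2) by blast
    have iN: "\<sigma> i \<in> N" "\<sigma>' i \<in> N" using i permutes_in_image[OF p(2)] permutes_in_image[OF p'(2)]
      by auto
    have "coord (d' i *s b (\<sigma>' i)) (\<sigma>' i) \<noteq> 0"
      using p'(3) i iN coord_basis[OF iN(2,2)] unfolding nonvanishing_def by simp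
    then have "coord (b (\<sigma> i)) (\<sigma>' i) \<noteq> 0" unfolding c by simp
    then show ?thesis using coord_basis[OF iN] by (metis)
  qed
  show \<sigma>: "\<sigma> = \<sigma>'"
  proof
    fix i show "\<sigma> i = \<sigma>' i"
      using same[of i] permutes_not_in[OF p(2), of i] permutes_not_in[OF p'(2), of i]
      by (cases "i \<in> N") auto
  qed
  show "block_scaling p d d'"
    unfolding block_scaling_def
  proof
    fix S assume "S \<in> set p"
    then obtain j where j: "j < length p" "S = p ! j" by (auto simp: in_set_conv_nth)
    obtain c where c: "c \<noteq> 0" "\<forall>i\<in>p ! j. d' i *s b (\<sigma>' i) = (c * d i) *s b (\<sigma> i)"
      using scale[OF j(1)] by blast
    have "d' i = c * d i" if i: "i \<in> S" for i
    proof -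
      have "i \<in> N" using block_subset[OF p(1) j(1)] i j(2) by blast
      then have "\<sigma> i \<in> N" using permutes_in_image[OF p(2)] by simp
      moreover have "d' i *s b (\<sigma> i) = (c * d i) *s b (\<sigma> i)" using c(2) i j(2) \<sigma> by simp
      ultimately show ?thesis using b_nonzero by (simp add: vec.scale_right_imp_eq)
    qed
    then show "\<exists>c. c \<noteq> 0 \<and> (\<forall>i\<in>S. d' i = c * d i)" using c(1) by blast
  qed
qed

text \<open>The chosen representative of a class is again of block form, as the type condition is
  invariant under scaling.\<close>

lemma representative_bclass:
  assumes "p \<in> OP" "\<sigma> permutes N" "nonvanishing d"
  shows "\<exists>d'. nonvanishing d' \<and> block_scaling p d d' \<and> representative (bclass p \<sigma> d) = block_seq p \<sigma> d'"
proof -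
  let ?R = "representative (bclass p \<sigma> d)"
  have R: "?R \<in> M_seqs" "proj_seq ?R = bclass p \<sigma> d"
    using representative[OF block_seq_in_M_seqs[OF assms]] unfolding bclass_def by auto
  have "monomial_type \<sigma> ?R"
    using monomial_type_proj_seq[OF _ R(1) monomial_type_block_seq[OF assms]] R(2)
    unfolding bclass_def by simp
  then obtain p' d' where p': "p' \<in> OP" "nonvanishing d'" "?R = block_seq p' \<sigma> d'"
    using monomial_type_imp_block_seq[OF R(1) assms(2)] by blast
  have "bclass p \<sigma> d = bclass p' \<sigma> d'" using R(2) p'(3) unfolding bclass_def[of p'] by simp
  then have "p = p'" "block_scaling p d d'" using bclass_eqD[OF assms p'(1) assms(2) p'(2)] by auto
  then show ?thesis using p' by blast
qed

section \<open>The product on block sequences\<close>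

lemma herm_eq: "herm E x y = (\<Sum>i\<in>N. cnj (coord x i) * coord y i)"
  unfolding herm_def coord_def
  by (rule sum.reindex_bij_betw[OF bij, of "\<lambda>v. cnj (vec.representation E x v) * vec.representation E y v", symmetric])

lemma orth_compl_coord_space:
  assumes "S \<subseteq> N" shows "orth_compl E (coord_space S) = coord_space (N - S)"
proof (intro equalityI subsetI)
  fix x assume x: "x \<in> orth_compl E (coord_space S)"
  have "coord x i = 0" if "i \<in> S" for i
  proof -
    have iN: "i \<in> N" using that assms by blast
    have "0 = herm E (b i) x"
      using x that b_in_coord_space[OF iN, of S] unfolding orth_compl_def by auto
    also have "\<dots> = (\<Sum>k\<in>N. if k = i then coord x k else 0)"
      unfolding herm_eq using coord_basis[OF iN] by (intro sum.cong) auto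
    also have "\<dots> = coord x i" using iN by (simp add: sum.delta')
    finally show ?thesis by simp
  qed
  then show "x \<in> coord_space (N - S)" unfolding coord_space_def by auto
next
  fix x assume x: "x \<in> coord_space (N - S)"
  have "herm E w x = 0" if "w \<in> coord_space S" for w
    unfolding herm_eq using x that assms unfolding coord_space_def by (intro sum.neutral) auto
  then show "x \<in> orth_compl E (coord_space S)" unfolding orth_compl_def by auto
qed

text \<open>The orthogonal projection onto a coordinate subspace deletes coordinates, and
  coordinates outside the support are ignored by a partial monomial map.\<close>

lemma extend_zero_mono_map:
  assumes "B \<subseteq> S" "S \<subseteq> N"
  shows "extend_zero E (coord_space S) (restrict (mono_map \<sigma> d B) (coord_space S)) = mono_map \<sigma> d B"
proof
  fix x
  define y where "y = (\<Sum>i\<in>S. coord x i *s b i)"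
  have coord_y: "coord y k = (if k \<in> S then coord x k else 0)" if k: "k \<in> N" for k
  proof -
    have "coord y k = (\<Sum>i\<in>S. if i = k then coord x i else 0)"
      unfolding y_def coord_sum coord_scale using coord_basis[OF _ k] assms(2)
      by (intro sum.cong) auto
    then show ?thesis using finite_subset[OF assms(2)] by (simp add: sum.delta')
  qed
  have "(THE w. w \<in> coord_space S \<and> x - w \<in> orth_compl E (coord_space S)) = y"
  proof (rule the_equality)
    show "y \<in> coord_space S \<and> x - y \<in> orth_compl E (coord_space S)"
      unfolding orth_compl_coord_space[OF assms(2)] unfolding coord_space_def using coord_y by auto
    fix w assume w: "w \<in> coord_space S \<and> x - w \<in> orth_compl E (coord_space S)"
    show "w = y"
    proof (rule eq_coordI)
      fix k assume k: "k \<in> N"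
      show "coord w k = coord y k"
        using w k unfolding orth_compl_coord_space[OF assms(2)]
        unfolding coord_space_def coord_y[OF k]
        by auto
    qed
  qed
  moreover have "y \<in> coord_space S" unfolding coord_space_def using coord_y by auto
  moreover have "mono_map \<sigma> d B y = mono_map \<sigma> d B x"
    unfolding mono_map_def
  proof (rule sum.cong[OF refl])
    fix k assume "k \<in> B"
    then have "k \<in> S" "k \<in> N" using assms by auto
    then show "(d k * coord y k) *s b (\<sigma> k) = (d k * coord x k) *s b (\<sigma> k)" by (simp add: coord_y)
  qed
  ultimately show "extend_zero E (coord_space S) (restrict (mono_map \<sigma> d B) (coord_space S)) x = mono_map \<sigma> d B x"
    unfolding extend_zero_def by simp
qed

lemma extend_list_block_seq:
  assumes "p \<in> OP" "\<sigma> permutes N" "nonvanishing d"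
  shows "extend_list E (block_seq p \<sigma> d) = map (mono_map \<sigma> d) p"
proof (rule nth_equalityI)
  fix j assume "j < length (extend_list E (block_seq p \<sigma> d))"
  then have j: "j < length p" unfolding extend_list_def by simp
  then show "extend_list E (block_seq p \<sigma> d) ! j = map (mono_map \<sigma> d) p ! j"
    unfolding extend_list_def
    using extend_zero_mono_map[OF block_sub_tail[OF j] tail_subset[OF assms(1)]]
    by (simp add: flag_block_seq[OF assms] nth_block_seq)
qed (simp add: extend_list_def)

lemma preceding_kernels_mono_map:
  assumes "\<sigma> permutes N" "nonvanishing d" "\<forall>S\<in>set r. S \<subseteq> N" "i \<le> length r"
  shows "preceding_kernels (map (mono_map \<sigma> d) r) i = {x. \<forall>j<i. \<forall>k\<in>r ! j. coord x k = 0}"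
proof -
  have "{x. mono_map \<sigma> d (r ! j) x = 0} = {x. \<forall>k\<in>r ! j. coord x k = 0}" if "j < i" for j
    using mono_map_eq_0_iff[OF assms(1) _ assms(2), of "r ! j"] assms(3,4) that by auto
  then show ?thesis unfolding preceding_kernels_def using assms(4) by auto
qed

text \<open>A basis vector whose index is in the support of one map is killed by the maps with
  disjoint support, so only maps with empty support are redundant.\<close>

lemma remove_redundant_mono_map:
  assumes \<sigma>: "\<sigma> permutes N" and d: "nonvanishing d" and r: "\<forall>S\<in>set r. S \<subseteq> N"
    and disj: "sorted_wrt disjnt r"
  shows "remove_redundant (map (mono_map \<sigma> d) r) = map (mono_map \<sigma> d) (filter (\<lambda>S. S \<noteq> {}) r)"
proof -
  let ?C = "map (mono_map \<sigma> d) r"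
  have iff: "preceding_kernels ?C i \<subseteq> {x. (?C ! i) x = 0} \<longleftrightarrow> r ! i = {}" if i: "i < length r" for i
  proof
    assume sub: "preceding_kernels ?C i \<subseteq> {x. (?C ! i) x = 0}"
    show "r ! i = {}"
    proof (rule ccontr)
      assume "r ! i \<noteq> {}"
      then obtain k where k: "k \<in> r ! i" by blast
      have sN: "r ! i \<subseteq> N" using r nth_mem[OF i] by blast
      then have kN: "k \<in> N" using k by blast
      have "coord (b k) l = 0" if "j < i" "l \<in> r ! j" for j l
      proof -
        have "disjnt (r ! j) (r ! i)" using disj i that(1) unfolding sorted_wrt_iff_nth_less by simp
        then have "l \<noteq> k" using k that(2) unfolding disjnt_def by blast
        moreover have "l \<in> N" using r that i nth_mem[of j r] by auto
        ultimately show ?thesis using coord_basis[OF kN] by simp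
      qed
      then have "b k \<in> preceding_kernels ?C i"
        using preceding_kernels_mono_map[OF \<sigma> d r less_imp_le[OF i]] by auto
      then have "mono_map \<sigma> d (r ! i) (b k) = 0" using sub i by auto
      then have "coord (b k) k = 0" using mono_map_eq_0_iff[OF \<sigma> sN d] k by blast
      then show False using coord_basis[OF kN kN] by simp
    qed
  next
    assume "r ! i = {}"
    then show "preceding_kernels ?C i \<subseteq> {x. (?C ! i) x = 0}" using i by (simp add: mono_map_def)
  qed
  have "remove_redundant ?C = map (mono_map \<sigma> d) (nths r {i. \<not> preceding_kernels ?C i \<subseteq> {x. (?C ! i) x = 0}})"
    unfolding remove_redundant_def by (rule nths_map)
  also have "nths r {i. \<not> preceding_kernels ?C i \<subseteq> {x. (?C ! i) x = 0}} =
      nths r {i. i < length r \<and> r ! i \<noteq> {}}"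
    unfolding nths_def
  proof (intro arg_cong[where f = "map fst"] filter_cong refl)
    fix z assume "z \<in> set (zip r [0..<length r])"
    then have "snd z < length r" by (auto simp: set_zip)
    then show "(snd z \<in> {i. \<not> preceding_kernels ?C i \<subseteq> {x. (?C ! i) x = 0}}) =
        (snd z \<in> {i. i < length r \<and> r ! i \<noteq> {}})"
      using iff[of "snd z"] by simp
  qed
  also have "\<dots> = filter (\<lambda>S. S \<noteq> {}) r" unfolding filter_eq_nths ..
  finally show ?thesis .
qed

text \<open>The kernels of the first maps in the list intersect in the next space of the flag.\<close>

lemma restrict_list_mono_map:
  assumes "q \<in> OP" "\<sigma> permutes N" "nonvanishing d"
  shows "restrict_list (map (mono_map \<sigma> d) q) = block_seq q \<sigma> d"
proof -
  have "preceding_kernels (map (mono_map \<sigma> d) q) i = coord_space (tail q i)" if i: "i < length q"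
    for i
  proof -
    have "flag (block_seq q \<sigma> d) i = {x. \<forall>j<i. \<forall>k\<in>q ! j. coord x k = 0}"
      using less_imp_le[OF i]
    proof (induction i)
      case (Suc i)
      then have i: "i < length q" by simp
      have "flag (block_seq q \<sigma> d) (Suc i) =
          {x \<in> flag (block_seq q \<sigma> d) i. \<forall>k\<in>q ! i. coord x k = 0}"
        using flag_block_seq[OF assms less_imp_le[OF i]] i
        by (auto simp: nth_block_seq mono_map_eq_0_iff[OF assms(2) block_subset[OF assms(1) i] assms(3)])
      then show ?case using Suc i by (auto simp: less_Suc_eq)
    qed simp
    then show ?thesis
      using preceding_kernels_mono_map[OF assms(2,3) _ less_imp_le[OF i]] flag_block_seq[OF assms less_imp_le[OF i]]
        OP_D(3)[OF assms(1)] by auto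
  qed
  then show ?thesis unfolding restrict_list_def block_seq_def by simp
qed

text \<open>The product of the partial monomial maps with supports \<open>A\<close> and \<open>B\<close> is supported on
  \<open>\<tau>\<^sup>-\<^sup>1(A) \<inter> B\<close>, and the order of the list of products is the one in the product of
  ordered set partitions.\<close>

lemma M_mult_block_seq:
  assumes p: "p \<in> OP" "\<sigma> permutes N" "nonvanishing d"
    and q: "q \<in> OP" "\<tau> permutes N" "nonvanishing d'"
  shows "M_mult E (block_seq p \<sigma> d) (block_seq q \<tau> d') =
    block_seq (partition_mult (phi_map \<tau> p) q) (\<sigma> \<circ> \<tau>) (\<lambda>i. d (\<tau> i) * d' i)"
proof -
  let ?e = "\<lambda>i. d (\<tau> i) * d' i"
  let ?r = "intersections (phi_map \<tau> p) q"
  have e: "nonvanishing ?e"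
    using p(3) q(3) permutes_in_image[OF q(2)] unfolding nonvanishing_def by simp
  have st: "\<sigma> \<circ> \<tau> permutes N" by (rule permutes_compose[OF q(2) p(2)])
  have phi: "phi_map \<tau> p \<in> OP" using phi_map_closed[OF p(1)] q(2) unfolding N_card by blast
  have r: "\<forall>S\<in>set ?r. S \<subseteq> N" "sorted_wrt disjnt ?r"
    using OP_D(3)[OF q(1)] sorted_wrt_disjnt_intersections[OF OP_D(1)[OF phi] OP_D(1)[OF q(1)]]
    by (auto simp: set_intersections)
  have comp: "map (\<lambda>A. A \<circ> mono_map \<tau> d' S') (map (mono_map \<sigma> d) p') = map (mono_map (\<sigma> \<circ> \<tau>) ?e) (map (\<lambda>a. a \<inter> S') (phi_map \<tau> p'))"
    if "set p' \<subseteq> set p" "S' \<in> set q" for p' S'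
  proof -
    have "mono_map \<sigma> d S \<circ> mono_map \<tau> d' S' = mono_map (\<sigma> \<circ> \<tau>) ?e (\<tau> -` S \<inter> S')" if "S \<in> set p'"
      for S
      using OP_D(3)[OF p(1)] OP_D(3)[OF q(1)] that \<open>set p' \<subseteq> set p\<close> \<open>S' \<in> set q\<close>
      by (intro mono_map_comp q(2)) auto
    then show ?thesis unfolding phi_map_eq[OF q(2)] by simp
  qed
  have "[A \<circ> B. B \<leftarrow> map (mono_map \<tau> d') q', A \<leftarrow> map (mono_map \<sigma> d) p] =
      map (mono_map (\<sigma> \<circ> \<tau>) ?e) (intersections (phi_map \<tau> p) q')" if "set q' \<subseteq> set q" for q'
    using that
  proof (induction q')
    case (Cons S' q')
    have S': "S' \<in> set q" using Cons.prems by simp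
    have IH: "[A \<circ> B. B \<leftarrow> map (mono_map \<tau> d') q', A \<leftarrow> map (mono_map \<sigma> d) p] =
      map (mono_map (\<sigma> \<circ> \<tau>) ?e) (intersections (phi_map \<tau> p) q')"
      by (rule Cons.IH) (use Cons.prems in auto)
    show ?case
      unfolding list.map(2)[of "mono_map \<tau> d'"] list.map(2)[of "\<lambda>B. map (\<lambda>A. A \<circ> B) _"] concat.simps
        intersections_simps map_append comp[OF subset_refl S'] IH ..
  qed simp
  then have "[A \<circ> B. B \<leftarrow> map (mono_map \<tau> d') q, A \<leftarrow> map (mono_map \<sigma> d) p] = map (mono_map (\<sigma> \<circ> \<tau>) ?e) ?r" by simp
  then have "M_mult E (block_seq p \<sigma> d) (block_seq q \<tau> d') =
      restrict_list (map (mono_map (\<sigma> \<circ> \<tau>) ?e) (partition_mult (phi_map \<tau> p) q))"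
    unfolding M_mult_def extend_list_block_seq[OF p] extend_list_block_seq[OF q] partition_mult_eq
    by (simp only: remove_redundant_mono_map[OF st e r])
  also have "\<dots> = block_seq (partition_mult (phi_map \<tau> p) q) (\<sigma> \<circ> \<tau>) ?e"
    by (intro restrict_list_mono_map partition_mult_closed phi q(1) st e)
  finally show ?thesis .
qed

text \<open>The coefficients of the chosen representatives are block scalings of the given ones, and
  a block of the product lies in one block of each factor, so the product is scaled by a
  constant on it.\<close>

lemma PM_mult_bclass:
  assumes p: "p \<in> OP" "\<sigma> permutes N" "nonvanishing d"
    and q: "q \<in> OP" "\<tau> permutes N" "nonvanishing d'"
  shows "PM_mult E (bclass p \<sigma> d) (bclass q \<tau> d') =
    bclass (partition_mult (phi_map \<tau> p) q) (\<sigma> \<circ> \<tau>) (\<lambda>i. d (\<tau> i) * d' i)"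
proof -
  obtain c
    where c: "nonvanishing c" "block_scaling p d c" "representative (bclass p \<sigma> d) = block_seq p \<sigma> c"
    using representative_bclass[OF p] by blast
  obtain c' where c': "nonvanishing c'" "block_scaling q d' c'"
    "representative (bclass q \<tau> d') = block_seq q \<tau> c'"
    using representative_bclass[OF q] by blast
  have nv: "nonvanishing (\<lambda>i. f (\<tau> i) * g i)" if "nonvanishing f" "nonvanishing g" for f g
    using that permutes_in_image[OF q(2)] unfolding nonvanishing_def by simp
  have phi: "phi_map \<tau> p \<in> OP" using phi_map_closed[OF p(1)] q(2) unfolding N_card by blast
  have "block_scaling (partition_mult (phi_map \<tau> p) q) (\<lambda>i. d (\<tau> i) * d' i) (\<lambda>i. c (\<tau> i) * c' i)"
    unfolding block_scaling_def
  proof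
    fix S assume "S \<in> set (partition_mult (phi_map \<tau> p) q)"
    then obtain A B where AB: "A \<in> set p" "B \<in> set q" "S = \<tau> -` A \<inter> B"
      unfolding set_partition_mult phi_map_eq[OF q(2)] by auto
    obtain k where k: "k \<noteq> 0" "\<forall>i\<in>A. c i = k * d i" using c(2) AB(1) unfolding block_scaling_def
      by blast
    obtain k' where k': "k' \<noteq> 0" "\<forall>i\<in>B. c' i = k' * d' i" using c'(2) AB(2)
      unfolding block_scaling_def by blast
    have "\<forall>i\<in>S. c (\<tau> i) * c' i = (k * k') * (d (\<tau> i) * d' i)" using k(2) k'(2) AB(3) by simp
    then show "\<exists>k. k \<noteq> 0 \<and> (\<forall>i\<in>S. c (\<tau> i) * c' i = k * (d (\<tau> i) * d' i))"
      using k(1) k'(1) by (intro exI[of _ "k * k'"]) simp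
  qed
  then have "bclass (partition_mult (phi_map \<tau> p) q) (\<sigma> \<circ> \<tau>) (\<lambda>i. d (\<tau> i) * d' i) =
      bclass (partition_mult (phi_map \<tau> p) q) (\<sigma> \<circ> \<tau>) (\<lambda>i. c (\<tau> i) * c' i)"
    by (intro bclass_eqI partition_mult_closed phi q(1) permutes_compose[OF q(2) p(2)] nv p(3) q(3) c(1) c'(1))
  then show ?thesis
    unfolding PM_mult_def c(3) c'(3) M_mult_block_seq[OF p(1,2) c(1) q(1,2) c'(1)]
      bclass_def[symmetric] by (rule sym)
qed

end

section \<open>The closure of the monomial classes\<close>

lemma topspace_nonzero_hom_top: "topspace (nonzero_hom_top W) = nonzero_hom W"
  unfolding nonzero_hom_top_def nonzero_hom_def hom_space_def
  by (auto simp: PiE_def)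

lemma openin_proj_hom: "openin (proj_hom_top W) (proj_hom W)"
proof -
  have "{A \<in> nonzero_hom W. proj_class W A \<in> proj_hom W} = topspace (nonzero_hom_top W)"
    unfolding topspace_nonzero_hom_top proj_hom_def by auto
  then show ?thesis unfolding openin_proj_hom_top by (metis openin_topspace order_refl)
qed

lemma M_seqs_nonzero_hom: "As \<in> M_seqs \<Longrightarrow> j < length As \<Longrightarrow> As ! j \<in> nonzero_hom (flag As j)"
  unfolding M_seqs_def by auto

lemma basic_nbhd_subset_PM: "basic_nbhd As U \<subseteq> PM"
  unfolding basic_nbhd_def PM_def by auto

lemma PM_open_PM: "PM_open PM"
  unfolding PM_open_def
proof (intro conjI ballI impI)
  fix As :: "('a::finite) vmap list" assume As: "As \<in> M_seqs"
  show "\<exists>U. (\<forall>i<length As. openin (proj_hom_top (flag As i)) (U i) \<and>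
      proj_class (flag As i) (As ! i) \<in> U i) \<and> basic_nbhd As U \<subseteq> PM"
    using M_seqs_nonzero_hom[OF As] basic_nbhd_subset_PM openin_proj_hom
    by (intro exI[of _ "\<lambda>i. proj_hom (flag As i)"]) (auto simp: proj_hom_def)
qed simp

lemma topspace_PM_top: "topspace PM_top = PM"
proof
  show "topspace PM_top \<subseteq> PM"
    using openin_topspace[of PM_top] unfolding openin_PM_top PM_open_def by blast
  show "PM \<subseteq> topspace PM_top"
    using PM_open_PM by (intro openin_subset) (simp add: openin_PM_top)
qed

context coordinates
begin

lemma openin_coord_nonzero:
  assumes "x \<in> W"
  shows "openin (nonzero_hom_top W) {A \<in> nonzero_hom W. coord (A x) k \<noteq> 0}"
proof -
  have "continuous_map (product_topology (\<lambda>_. euclidean) W) euclidean (\<lambda>A :: 'n vmap. A x)"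
    using assms by (rule continuous_map_product_projection)
  moreover have "continuous_map euclidean euclidean (\<lambda>y. coord y k)"
    using continuous_coord by simp
  ultimately have "continuous_map (product_topology (\<lambda>_. euclidean) W) euclidean
      ((\<lambda>y. coord y k) \<circ> (\<lambda>A :: 'n vmap. A x))"
    by (rule continuous_map_compose)
  then have "continuous_map (nonzero_hom_top W) euclidean (\<lambda>A. coord (A x) k)"
    unfolding nonzero_hom_top_def comp_def by (rule continuous_map_from_subtopology)
  then have "openin (nonzero_hom_top W) {A \<in> topspace (nonzero_hom_top W). coord (A x) k \<in> - {0}}"
    by (rule openin_continuous_map_preimage) (simp add: open_Compl)
  then show ?thesis unfolding topspace_nonzero_hom_top by simp
qed

definition monomial_points :: "(nat \<Rightarrow> nat) \<Rightarrow> 'n vmap set list set" where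
  "monomial_points \<sigma> = {proj_seq As | As. As \<in> M_seqs \<and> monomial_type \<sigma> As}"

text \<open>A violation of the type condition occurs at one vector \<open>x\<close> of one kernel. It is an open
  condition on the map there, and it persists in a neighbourhood, since neighbouring
  sequences have a map that is defined at \<open>x\<close> and close to the given one.\<close>

lemma closedin_monomial_points: "closedin PM_top (monomial_points \<sigma>)"
proof -
  have "PM_open (PM - monomial_points \<sigma>)"
    unfolding PM_open_def
  proof (intro conjI ballI impI)
    fix As :: "'n vmap list" assume As: "As \<in> M_seqs" "proj_seq As \<in> PM - monomial_points \<sigma>"
    then have "\<not> monomial_type \<sigma> As" unfolding monomial_points_def by blast
    then obtain j x i where j: "j < length As" and x: "x \<in> flag As j" and i: "i \<in> N" "coord x i = 0"
      and nz: "coord ((As ! j) x) (\<sigma> i) \<noteq> 0"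
      unfolding monomial_type_def by blast
    let ?W = "flag As j"
    let ?K = "{A \<in> nonzero_hom ?W. coord (A x) (\<sigma> i) \<noteq> 0}"
    \<comment> \<open>only the \<open>j\<close>-th neighbourhood restricts anything\<close>
    define U where "U k = (if k = j then proj_class ?W ` ?K else proj_hom (flag As k))" for k
    have ext: "A \<in> extensional ?W" if "A \<in> nonzero_hom ?W" for A :: "'n vmap"
      using that unfolding nonzero_hom_def hom_space_def by auto
    have K: "{A \<in> nonzero_hom ?W. proj_class ?W A \<in> proj_class ?W ` ?K} = ?K"
    proof (intro equalityI subsetI)
      fix A assume A: "A \<in> {A \<in> nonzero_hom ?W. proj_class ?W A \<in> proj_class ?W ` ?K}"
      then obtain B where B: "B \<in> ?K" "proj_class ?W A = proj_class ?W B" by blast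
      obtain c where "B x = c *s A x" using proj_class_eqD[OF B(2) ext] B(1) x by blast
      then show "A \<in> ?K" using A B(1) by auto
    qed blast
    have open_j: "openin (proj_hom_top ?W) (proj_class ?W ` ?K)"
      unfolding openin_proj_hom_top K using openin_coord_nonzero[OF x] unfolding proj_hom_def
      by auto
    have "openin (proj_hom_top (flag As k)) (U k) \<and> proj_class (flag As k) (As ! k) \<in> U k"
      if k: "k < length As" for k
      using open_j openin_proj_hom[of "flag As k"] M_seqs_nonzero_hom[OF As(1) k] nz
      unfolding U_def proj_hom_def by auto
    moreover have "basic_nbhd As U \<subseteq> PM - monomial_points \<sigma>"
    proof
      fix P assume P: "P \<in> basic_nbhd As U"
      then obtain Bs where Bs: "P = proj_seq Bs" "Bs \<in> M_seqs"
        "\<forall>i<length As. \<exists>k<length Bs. flag As i \<subseteq> flag Bs k \<and>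
          proj_class (flag As i) (restrict (Bs ! k) (flag As i)) \<in> U i"
        unfolding basic_nbhd_def by blast
      then obtain k where k: "k < length Bs" "?W \<subseteq> flag Bs k"
        "proj_class ?W (restrict (Bs ! k) ?W) \<in> U j" using j by blast
      then obtain B where B: "B \<in> ?K" "proj_class ?W (restrict (Bs ! k) ?W) = proj_class ?W B"
        unfolding U_def by auto
      obtain c where c: "B x = c *s restrict (Bs ! k) ?W x"
        using proj_class_eqD[OF B(2) ext] B(1) x by blast
      have not: "\<not> monomial_type \<sigma> Bs"
        unfolding monomial_type_def using B(1) c k x i by auto
      have "P \<notin> monomial_points \<sigma>"
      proof
        assume "P \<in> monomial_points \<sigma>"
        then obtain Cs where "P = proj_seq Cs" "Cs \<in> M_seqs" "monomial_type \<sigma> Cs"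
          unfolding monomial_points_def by blast
        then show False using monomial_type_proj_seq[of Cs Bs \<sigma>] Bs(1,2) not by simp
      qed
      then show "P \<in> PM - monomial_points \<sigma>" using P basic_nbhd_subset_PM by blast
    qed
    ultimately show "\<exists>U. (\<forall>i<length As. openin (proj_hom_top (flag As i)) (U i) \<and>
        proj_class (flag As i) (As ! i) \<in> U i) \<and> basic_nbhd As U \<subseteq> PM - monomial_points \<sigma>"
      by (intro exI[of _ U]) simp
  qed blast
  moreover have "monomial_points \<sigma> \<subseteq> PM" unfolding monomial_points_def PM_def by auto
  ultimately show ?thesis unfolding closedin_def topspace_PM_top openin_PM_top by simp
qed

lemma bclass_in_monomial_points:
  "p \<in> OP \<Longrightarrow> \<sigma> permutes N \<Longrightarrow> nonvanishing d \<Longrightarrow> bclass p \<sigma> d \<in> monomial_points \<sigma>"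
  unfolding monomial_points_def bclass_def using block_seq_in_M_seqs monomial_type_block_seq
  by blast

lemma monomial_points_bclass:
  assumes "P \<in> monomial_points \<sigma>" "\<sigma> permutes N"
  shows "\<exists>p d. p \<in> OP \<and> nonvanishing d \<and> P = bclass p \<sigma> d"
  using assms monomial_type_imp_block_seq unfolding monomial_points_def bclass_def by blast

lemma N_in_OP: "[N] \<in> OP"
proof -
  have "1 \<le> card N" using N_eq by (simp add: Suc_le_eq)
  then show ?thesis using one_ordered_partition[of "card N"] by (simp only: N_card)
qed

lemma block_seq_one_block: "block_seq [N] \<sigma> d = [mono_map \<sigma> d N]"
  unfolding block_seq_def tail_def by (simp add: restrict_def)

lemma bclass_one_block: "bclass [N] \<sigma> d = proj_seq [mono_map \<sigma> d N]"
  unfolding bclass_def block_seq_one_block ..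

lemma one_block_in_M_seqs: "\<sigma> permutes N \<Longrightarrow> nonvanishing d \<Longrightarrow> [mono_map \<sigma> d N] \<in> M_seqs"
  using block_seq_in_M_seqs[OF N_in_OP] unfolding block_seq_one_block by simp

text \<open>The coefficients of the \<open>l\<close>-th block are multiplied by \<open>t\<^sup>l\<close>. On the \<open>j\<close>-th kernel only
  the blocks with \<open>l \<ge> j\<close> are left, so after division by \<open>t\<^sup>j\<close> the monomial map depends
  continuously on \<open>t\<close>, and at \<open>t = 0\<close> it is the \<open>j\<close>-th map of the sequence.\<close>

lemma one_block_dense:
  assumes p: "p \<in> OP" and \<sigma>: "\<sigma> permutes N" and d: "nonvanishing d"
    and S: "PM_open S" "bclass p \<sigma> d \<in> S"
  shows "\<exists>d'. nonvanishing d' \<and> bclass [N] \<sigma> d' \<in> S"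
proof -
  let ?As = "block_seq p \<sigma> d"
  have As: "?As \<in> M_seqs" by (rule block_seq_in_M_seqs[OF p \<sigma> d])
  define W where "W j = coord_space (tail p j)" for j
  have fl: "flag ?As j = W j" if "j < length p" for j
    unfolding W_def using flag_block_seq[OF p \<sigma> d] that by simp
  obtain U where U: "\<And>j. j < length p \<Longrightarrow> openin (proj_hom_top (W j)) (U j)"
    "\<And>j. j < length p \<Longrightarrow> proj_class (W j) (?As ! j) \<in> U j"
    "basic_nbhd ?As U \<subseteq> S"
  proof -
    obtain U where "\<forall>i<length ?As. openin (proj_hom_top (flag ?As i)) (U i) \<and>
        proj_class (flag ?As i) (?As ! i) \<in> U i" "basic_nbhd ?As U \<subseteq> S"
      using S As unfolding PM_open_def bclass_def by blast
    then show thesis using that[of U] fl by simp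
  qed
  have "\<forall>i\<in>N. \<exists>j. j < length p \<and> i \<in> p ! j"
    using OP_D(3)[OF p] by (metis UnionE in_set_conv_nth)
  then obtain lvl where lvl: "\<And>i. i \<in> N \<Longrightarrow> lvl i < length p \<and> i \<in> p ! lvl i" by metis
  have lvl_less: "lvl i = j" if "i \<in> p ! j" "j < length p" for i j
  proof -
    have "i \<in> N" using block_subset[OF p that(2)] that(1) by blast
    then show ?thesis
      using lvl[of i] that OP_D(1)[OF p] unfolding sorted_wrt_iff_nth_less disjnt_def
      by (cases j "lvl i" rule: linorder_cases) auto
  qed
  have lvl_ge: "j \<le> lvl i" if i: "i \<in> tail p j" for i j
  proof -
    obtain k where "k < length p - j" "i \<in> p ! (j + k)"
      using i unfolding tail_def by (auto simp: in_set_conv_nth)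
    then have "lvl i = j + k" by (intro lvl_less) auto
    then show ?thesis by simp
  qed
  \<comment> \<open>the deformed map on the \<open>j\<close>-th kernel, divided by \<open>t\<^sup>j\<close>; for \<open>t = 0\<close> the convention \<open>0\<^sup>0 = 1\<close> leaves
    exactly the \<open>j\<close>-th block\<close>
  define G where "G j t = restrict (mono_map \<sigma> (\<lambda>i. d i * t ^ (lvl i - j)) (tail p j)) (W j)"
    for j t
  have G_0: "G j 0 = ?As ! j" if j: "j < length p" for j
  proof -
    have "mono_map \<sigma> (\<lambda>i. d i * 0 ^ (lvl i - j)) (tail p j) = mono_map \<sigma> d (p ! j)"
    proof
      fix x
      have "mono_map \<sigma> (\<lambda>i. d i * 0 ^ (lvl i - j)) (tail p j) x =
          mono_map \<sigma> (\<lambda>i. d i * 0 ^ (lvl i - j)) (p ! j) x"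
        unfolding mono_map_def
      proof (rule sum.mono_neutral_right)
        show "finite (tail p j)" using finite_subset[OF tail_subset[OF p]] by simp
        show "p ! j \<subseteq> tail p j" by (rule block_sub_tail[OF j])
        show "\<forall>i\<in>tail p j - p ! j. (d i * 0 ^ (lvl i - j) * coord x i) *s b (\<sigma> i) = 0"
        proof
          fix i assume i: "i \<in> tail p j - p ! j"
          then have "i \<in> tail p (Suc j)" using tail_Suc[OF j] by auto
          then have "Suc j \<le> lvl i" by (rule lvl_ge)
          then show "(d i * 0 ^ (lvl i - j) * coord x i) *s b (\<sigma> i) = 0" by simp
        qed
      qed
      also have "\<dots> = mono_map \<sigma> d (p ! j) x"
        using lvl_less[OF _ j] mono_map_cong[of "p ! j" "\<lambda>i. d i * 0 ^ (lvl i - j)" d] by simp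
      finally show "mono_map \<sigma> (\<lambda>i. d i * 0 ^ (lvl i - j)) (tail p j) x = mono_map \<sigma> d (p ! j) x" .
    qed
    then show ?thesis unfolding G_def nth_block_seq[OF j] W_def by simp
  qed
  have G_nz: "G j t \<in> nonzero_hom (W j)" if j: "j < length p" for j t
  proof -
    obtain i where i: "i \<in> p ! j" using block_nonempty[OF p j] by blast
    have iN: "i \<in> N" and it: "i \<in> tail p j"
      using i block_subset[OF p j] block_sub_tail[OF j] by auto
    have "mono_map \<sigma> (\<lambda>i. d i * t ^ (lvl i - j)) (tail p j) (b i) = d i *s b (\<sigma> i)"
      using lvl_less[OF i j] it by (simp add: mono_map_basis[OF iN tail_subset[OF p]])
    moreover have "d i *s b (\<sigma> i) \<noteq> 0"
      using d iN b_nonzero permutes_in_image[OF \<sigma>] unfolding nonvanishing_def by simp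
    moreover have "b i \<in> W j" unfolding W_def using it b_in_coord_space[OF iN] by simp
    ultimately have "\<exists>x\<in>W j. G j t x \<noteq> 0" unfolding G_def by (intro bexI[of _ "b i"]) auto
    then show ?thesis
      unfolding nonzero_hom_def using hom_space_restrict_mono_map unfolding G_def W_def by blast
  qed
  have G_cont: "continuous_map euclidean (nonzero_hom_top (W j)) (G j)" if j: "j < length p" for j
    unfolding nonzero_hom_top_def
  proof (rule continuous_map_into_subtopology)
    show "G j \<in> topspace euclidean \<rightarrow> nonzero_hom (W j)" using G_nz[OF j] by auto
    show "continuous_map euclidean (product_topology (\<lambda>_. euclidean) (W j)) (G j)"
      unfolding continuous_map_componentwise
    proof (intro conjI ballI)
      show "G j ` topspace euclidean \<subseteq> extensional (W j)" unfolding G_def by auto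
      fix x assume x: "x \<in> W j"
      have "continuous_on UNIV (\<lambda>t. (d i * t ^ (lvl i - j) * coord x i) *s b (\<sigma> i))" for i
        by (rule continuous_on_compose2[OF continuous_scale_left[of UNIV]]) (auto intro!: continuous_intros)
      then have "continuous_on UNIV (\<lambda>t. mono_map \<sigma> (\<lambda>i. d i * t ^ (lvl i - j)) (tail p j) x)"
        unfolding mono_map_def by (intro continuous_on_sum)
      then show "continuous_map euclidean euclidean (\<lambda>t. G j t x)"
        unfolding G_def using x by simp
    qed
  qed
  define O' where "O' j = {t. proj_class (W j) (G j t) \<in> U j}" for j
  have O'_open: "open (O' j)" if j: "j < length p" for j
  proof -
    have "openin (nonzero_hom_top (W j)) {A \<in> nonzero_hom (W j). proj_class (W j) A \<in> U j}"
      using U(1)[OF j] unfolding openin_proj_hom_top by blast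
    then have "openin euclidean {t \<in> topspace euclidean. G j t \<in> {A \<in> nonzero_hom (W j). proj_class (W j) A \<in> U j}}"
      by (rule openin_continuous_map_preimage[OF G_cont[OF j]])
    then show ?thesis unfolding O'_def using G_nz[OF j] by simp
  qed
  have "open (\<Inter>j<length p. O' j)" using O'_open by (intro open_INT) auto
  moreover have "0 \<in> (\<Inter>j<length p. O' j)" unfolding O'_def using G_0 U(2) by simp
  ultimately obtain e where e: "e > 0" "ball 0 e \<subseteq> (\<Inter>j<length p. O' j)"
    by (meson openE)
  define t :: complex where "t = of_real (e / 2)"
  have "t \<in> ball 0 e" and t: "t \<noteq> 0" unfolding t_def using e(1) by auto
  then have tO: "proj_class (W j) (G j t) \<in> U j" if "j < length p" for j
    using e(2) that unfolding O'_def by auto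
  define d' where "d' i = d i * t ^ lvl i" for i
  have d': "nonvanishing d'" using d t unfolding d'_def nonvanishing_def by simp
  have "bclass [N] \<sigma> d' \<in> basic_nbhd ?As U"
    unfolding basic_nbhd_def bclass_one_block
  proof (intro CollectI exI[of _ "[mono_map \<sigma> d' N]"] conjI allI impI refl)
    show "[mono_map \<sigma> d' N] \<in> M_seqs" by (rule one_block_in_M_seqs[OF \<sigma> d'])
    fix j assume "j < length ?As"
    then have j: "j < length p" by simp
    have "proj_class (W j) (restrict (mono_map \<sigma> d' N) (W j)) = proj_class (W j) (G j t)"
    proof (rule proj_class_scale)
      show "t ^ j \<noteq> 0" using t by simp
      fix x assume x: "x \<in> W j"
      have "mono_map \<sigma> d' N x = mono_map \<sigma> d' (tail p j) x"
        unfolding mono_map_def using x tail_subset[OF p] unfolding W_def coord_space_def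
        by (intro sum.mono_neutral_right) auto
      also have "\<dots> = mono_map \<sigma> (\<lambda>i. t ^ j * (d i * t ^ (lvl i - j))) (tail p j) x"
      proof -
        have "d' i = t ^ j * (d i * t ^ (lvl i - j))" if "i \<in> tail p j" for i
          using lvl_ge[OF that] unfolding d'_def by (simp flip: power_add)
        then have "mono_map \<sigma> d' (tail p j) = mono_map \<sigma> (\<lambda>i. t ^ j * (d i * t ^ (lvl i - j))) (tail p j)"
          by (rule mono_map_cong)
        then show ?thesis by (rule fun_cong)
      qed
      finally show "restrict (mono_map \<sigma> d' N) (W j) x = t ^ j *s G j t x"
        using x unfolding G_def mono_map_times by simp
    qed
    then show "\<exists>k<length [mono_map \<sigma> d' N]. flag ?As j \<subseteq> flag [mono_map \<sigma> d' N] k \<and>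
        proj_class (flag ?As j) (restrict ([mono_map \<sigma> d' N] ! k) (flag ?As j)) \<in> U j"
      using tO[OF j] fl[OF j] by (intro exI[of _ 0]) simp
  qed
  then show ?thesis using d' U(3) by blast
qed

text \<open>The points of block form are a finite union, over the permutations, of closed sets.\<close>

lemma closure_one_block:
  "PM_top closure_of {bclass [N] \<sigma> d | \<sigma> d. \<sigma> permutes N \<and> nonvanishing d} =
   {bclass p \<sigma> d | p \<sigma> d. p \<in> OP \<and> \<sigma> permutes N \<and> nonvanishing d}"
  (is "_ closure_of ?N = ?C")
proof
  let ?Z = "\<Union>\<sigma>\<in>{\<sigma>. \<sigma> permutes N}. monomial_points \<sigma>"
  have "closedin PM_top ?Z"
    using closedin_monomial_points finite_permutations[OF finite_N]
    by (intro closedin_Union) auto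
  moreover have "?N \<subseteq> ?Z" using bclass_in_monomial_points[OF N_in_OP] by blast
  ultimately have "PM_top closure_of ?N \<subseteq> ?Z" by (intro closure_of_minimal)
  also have "?Z \<subseteq> ?C" using monomial_points_bclass by blast
  finally show "PM_top closure_of ?N \<subseteq> ?C" .
  show "?C \<subseteq> PM_top closure_of ?N"
  proof
    fix P assume "P \<in> ?C"
    then obtain p \<sigma> d where P: "P = bclass p \<sigma> d" and pd: "p \<in> OP" "\<sigma> permutes N" "nonvanishing d"
      by blast
    have "P \<in> topspace PM_top"
      unfolding topspace_PM_top PM_def P bclass_def using block_seq_in_M_seqs[OF pd] by blast
    moreover have "\<exists>Q\<in>?N. Q \<in> S" if "P \<in> S" "openin PM_top S" for S
      using one_block_dense[OF pd] that pd(2) unfolding P openin_PM_top by blast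
    ultimately show "P \<in> PM_top closure_of ?N" unfolding closure_of_def by blast
  qed
qed

end

section \<open>The projective linear group\<close>

abbreviation vlinear :: "(complex ^ 'n \<Rightarrow> complex ^ 'n) \<Rightarrow> bool" where
  "vlinear \<equiv> Vector_Spaces.linear (*s) (*s)"

lemma one_term_M_seqs:
  "[A] \<in> M_seqs \<longleftrightarrow> vlinear (A :: ('n::finite) vmap) \<and> (\<forall>x. A x = 0 \<longrightarrow> x = 0)"
proof -
  have lin: "vlinear A \<longleftrightarrow> (\<forall>x y. A (x + y) = A x + A y) \<and> (\<forall>c x. A (c *s x) = c *s A x)"
    unfolding Vector_Spaces.linear_iff using vec.vector_space_axioms by blast
  have "[A] \<in> M_seqs \<longleftrightarrow> (\<forall>x y. A (x + y) = A x + A y) \<and> (\<forall>c x. A (c *s x) = c *s A x) \<and>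
      (\<exists>x. A x \<noteq> 0) \<and> {x. A x = 0} = {0}"
    unfolding M_seqs_def nonzero_hom_def hom_space_def by auto
  also have "\<dots> \<longleftrightarrow> vlinear A \<and> (\<forall>x. A x = 0 \<longrightarrow> x = 0)"
  proof -
    have "A 0 = 0" if "\<forall>c x. A (c *s x) = c *s A x"
      using that[rule_format, of 0 0] by simp
    moreover have "\<exists>x. A x \<noteq> 0" if "\<forall>x. A x = 0 \<longrightarrow> x = 0"
    proof -
      have "(axis undefined 1 :: complex ^ 'n) \<noteq> 0" by (simp add: axis_eq_0_iff)
      then show ?thesis using that by blast
    qed
    ultimately show ?thesis unfolding lin by auto
  qed
  finally show ?thesis .
qed

lemma proj_seq_one_term: "proj_seq [A] = [proj_class UNIV A]"
  unfolding proj_seq_def by simp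

lemma proj_class_UNIV: "proj_class UNIV A = {\<lambda>x. c *s A x | c. c \<noteq> 0}"
  unfolding proj_class_def by (simp add: restrict_def)

lemma carrier_PGL: "carrier PGL = {proj_seq [A] | A. [A] \<in> M_seqs}"
proof (intro equalityI subsetI)
  fix P assume "P \<in> carrier PGL"
  then obtain As where As: "P = proj_seq As" "As \<in> M_seqs" "length P = 1"
    unfolding PGL_def PM_def by auto
  then obtain A where "As = [A]" by (auto simp: length_Suc_conv)
  then show "P \<in> {proj_seq [A] | A. [A] \<in> M_seqs}" using As(1,2) by blast
next
  fix P assume "P \<in> {proj_seq [A] | A. [A] \<in> M_seqs}"
  then obtain A where "P = proj_seq [A]" "[A] \<in> M_seqs" by blast
  moreover from this have "P \<in> PM" unfolding PM_def by blast
  ultimately show "P \<in> carrier PGL" unfolding PGL_def by simp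
qed

lemma mult_PGL:
  assumes "vlinear A"
  shows "proj_seq [A] \<otimes>\<^bsub>PGL\<^esub> proj_seq [B] = proj_seq [A \<circ> B]"
proof -
  have lin: "A (c *s x) = c *s A x" for c x
    using assms unfolding Vector_Spaces.linear_iff by blast
  have "{f \<circ> g | f g. f \<in> proj_class UNIV A \<and> g \<in> proj_class UNIV B} = proj_class UNIV (A \<circ> B)"
  proof (intro equalityI subsetI)
    fix h assume "h \<in> {f \<circ> g | f g. f \<in> proj_class UNIV A \<and> g \<in> proj_class UNIV B}"
    then obtain c k where "h = (\<lambda>x. c *s A x) \<circ> (\<lambda>x. k *s B x)" "c \<noteq> 0" "k \<noteq> 0"
      unfolding proj_class_UNIV by blast
    then have "h = (\<lambda>x. (c * k) *s (A \<circ> B) x)" "c * k \<noteq> 0" by (auto simp: lin vector_smult_assoc)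
    then show "h \<in> proj_class UNIV (A \<circ> B)" unfolding proj_class_UNIV by blast
  next
    fix h assume "h \<in> proj_class UNIV (A \<circ> B)"
    then obtain c where c: "h = (\<lambda>x. c *s (A \<circ> B) x)" "c \<noteq> 0" unfolding proj_class_UNIV by blast
    have "(\<lambda>x. c *s A x) \<in> proj_class UNIV A"
      unfolding proj_class_UNIV using c(2) by (intro CollectI exI[of _ c]) simp
    moreover have "B \<in> proj_class UNIV B"
      unfolding proj_class_UNIV by (intro CollectI exI[of _ 1]) simp
    moreover have "h = (\<lambda>x. c *s A x) \<circ> B" unfolding c(1) by (simp add: comp_def)
    ultimately show "h \<in> {f \<circ> g | f g. f \<in> proj_class UNIV A \<and> g \<in> proj_class UNIV B}"
      by (intro CollectI exI[of _ "\<lambda>x. c *s A x"] exI[of _ B]) simp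
  qed
  then show ?thesis unfolding PGL_def proj_seq_one_term by simp
qed

lemma one_PGL: "\<one>\<^bsub>PGL\<^esub> = proj_seq [id]"
  unfolding PGL_def by simp

lemma one_term_comp:
  assumes "[A] \<in> M_seqs" "[B] \<in> M_seqs" shows "[A \<circ> B] \<in> M_seqs"
  unfolding one_term_M_seqs
proof (intro conjI allI impI)
  have A: "vlinear A" "\<And>x. A x = 0 \<Longrightarrow> x = 0" and B: "vlinear B" "\<And>x. B x = 0 \<Longrightarrow> x = 0"
    using assms unfolding one_term_M_seqs by blast+
  show "vlinear (A \<circ> B)" using B(1) A(1) by (rule Vector_Spaces.linear_compose)
  show "x = 0" if "(A \<circ> B) x = 0" for x
    using that unfolding comp_apply by (rule B(2)[OF A(2)])
qed

lemma id_in_M_seqs: "[id] \<in> M_seqs"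
  unfolding one_term_M_seqs using vec.linear_id by auto

lemma one_term_inverse:
  assumes "[A] \<in> M_seqs"
  shows "\<exists>B. [B] \<in> M_seqs \<and> B \<circ> A = id \<and> A \<circ> B = id"
proof -
  have A: "vlinear A" "\<And>x. A x = 0 \<Longrightarrow> x = 0" using assms unfolding one_term_M_seqs by auto
  have "inj A" using A vec.linear_inj_iff_eq_0[OF A(1)] by blast
  then obtain B where B: "vlinear B" "\<forall>x. B (A x) = x" "\<forall>x. A (B x) = x"
    using vec.linear_injective_isomorphism[OF A(1)] by blast
  have "x = 0" if "B x = 0" for x
  proof -
    have "A (B x) = 0" using that A(1) vec.linear_0 by metis
    then show ?thesis using B(3) by simp
  qed
  then have "[B] \<in> M_seqs" unfolding one_term_M_seqs using B(1) by blast
  then show ?thesis using B(2,3) by (intro exI[of _ B]) (auto simp: fun_eq_iff)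
qed

lemma group_PGL: "group (PGL :: ('n::finite) vmap set list monoid)"
proof (rule groupI)
  have lin: "vlinear A" if "[A] \<in> M_seqs" for A :: "('n::finite) vmap" using that
    unfolding one_term_M_seqs by simp
  show "\<one>\<^bsub>PGL\<^esub> \<in> carrier (PGL :: ('n::finite) vmap set list monoid)"
    unfolding one_PGL carrier_PGL using id_in_M_seqs by blast
  fix x assume "x \<in> carrier (PGL :: ('n::finite) vmap set list monoid)"
  then obtain A where A: "x = proj_seq [A]" "[A] \<in> M_seqs" unfolding carrier_PGL by blast
  show "\<one>\<^bsub>PGL\<^esub> \<otimes>\<^bsub>PGL\<^esub> x = x"
    unfolding one_PGL A(1) mult_PGL[OF lin[OF id_in_M_seqs]] by simp
  obtain B where B: "[B] \<in> M_seqs" "B \<circ> A = id" using one_term_inverse[OF A(2)] by blast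
  have "proj_seq [B] \<otimes>\<^bsub>PGL\<^esub> x = \<one>\<^bsub>PGL\<^esub>"
    unfolding one_PGL A(1) mult_PGL[OF lin[OF B(1)]] B(2) ..
  then show "\<exists>y\<in>carrier PGL. y \<otimes>\<^bsub>PGL\<^esub> x = \<one>\<^bsub>PGL\<^esub>" using B(1) unfolding carrier_PGL by blast
  fix y assume "y \<in> carrier (PGL :: ('n::finite) vmap set list monoid)"
  then obtain A' where A': "y = proj_seq [A']" "[A'] \<in> M_seqs" unfolding carrier_PGL by blast
  have xy: "x \<otimes>\<^bsub>PGL\<^esub> y = proj_seq [A \<circ> A']" unfolding A(1) A'(1) mult_PGL[OF lin[OF A(2)]] ..
  then show "x \<otimes>\<^bsub>PGL\<^esub> y \<in> carrier PGL"
    unfolding carrier_PGL using one_term_comp[OF A(2) A'(2)] by blast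
  fix z assume "z \<in> carrier (PGL :: ('n::finite) vmap set list monoid)"
  then obtain A'' where A'': "z = proj_seq [A'']" "[A''] \<in> M_seqs" unfolding carrier_PGL by blast
  show "x \<otimes>\<^bsub>PGL\<^esub> y \<otimes>\<^bsub>PGL\<^esub> z = x \<otimes>\<^bsub>PGL\<^esub> (y \<otimes>\<^bsub>PGL\<^esub> z)"
    unfolding xy A''(1) mult_PGL[OF lin[OF one_term_comp[OF A(2) A'(2)]]]
    unfolding A(1) A'(1) mult_PGL[OF lin[OF A'(2)]] mult_PGL[OF lin[OF A(2)]] comp_assoc ..
qed

section \<open>Regular functions\<close>

lemma function_algebra_sum:
  "finite I \<Longrightarrow> (\<And>i. i \<in> I \<Longrightarrow> f i \<in> function_algebra S) \<Longrightarrow> (\<lambda>x. \<Sum>i\<in>I. f i x) \<in> function_algebra S"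
proof (induction I rule: finite_induct)
  case empty
  then show ?case using function_algebra.const[of 0] by simp
next
  case (insert i I)
  then show ?case using function_algebra.add[of "f i" S "\<lambda>x. \<Sum>i\<in>I. f i x"] by simp
qed

lemma function_algebra_prod:
  "finite I \<Longrightarrow> (\<And>i. i \<in> I \<Longrightarrow> f i \<in> function_algebra S) \<Longrightarrow> (\<lambda>x. \<Prod>i\<in>I. f i x) \<in> function_algebra S"
proof (induction I rule: finite_induct)
  case empty
  then show ?case using function_algebra.const[of 1] by simp
next
  case (insert i I)
  then show ?case using function_algebra.mult[of "f i" S "\<lambda>x. \<Prod>i\<in>I. f i x"] by simp
qed

lemma det_one_term:
  assumes "[A] \<in> M_seqs" shows "det (matrix A) \<noteq> 0"
proof -
  obtain B where B: "[B] \<in> M_seqs" "A \<circ> B = id" using one_term_inverse[OF assms] by blast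
  have "matrix A ** matrix B = mat 1"
    using matrix_compose_gen[of B A] assms B unfolding one_term_M_seqs
    by (simp add: matrix_id_mat_1)
  then have "det (matrix A) * det (matrix B) = 1" using det_mul[of "matrix A" "matrix B"] by simp
  then show ?thesis by auto
qed

lemma matrix_scale: "matrix (\<lambda>x. c *s A x) = mat c ** matrix (A :: ('n::finite) vmap)"
  unfolding matrix_def mat_def matrix_matrix_mult_def
  by (simp add: vec_eq_iff if_distrib[of "\<lambda>z. z * _"] cong: if_cong)

lemma det_scale: "det (matrix (\<lambda>x. c *s A x)) = c ^ CARD('n) * det (matrix (A :: ('n::finite) vmap))"
proof -
  have "det (mat c :: complex ^ 'n ^ 'n) = (\<Prod>i\<in>(UNIV :: 'n set). c)"
    by (subst det_diagonal) (simp_all add: mat_def)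
  then show ?thesis unfolding matrix_scale det_mul by simp
qed

definition scale_invariant :: "(('n::finite) vmap \<Rightarrow> complex) \<Rightarrow> bool" where
  "scale_invariant F \<longleftrightarrow> (\<forall>A c. [A] \<in> M_seqs \<longrightarrow> c \<noteq> 0 \<longrightarrow> F (\<lambda>x. c *s A x) = F A)"

text \<open>By scale invariance the value at a chosen representative is the value at every
  representative.\<close>

lemma regular_descends:
  assumes "F \<in> regular_GL" "scale_invariant F"
  shows "\<exists>f\<in>regular_PGL. \<forall>A. [A] \<in> M_seqs \<longrightarrow> f (proj_seq [A]) = F A"
proof -
  define f where "f P = F (hd (representative P))" for P
  have "f (proj_seq [A]) = F A" if A: "[A] \<in> M_seqs" for A
  proof -
    define R where "R = representative (proj_seq [A])"
    have R: "R \<in> M_seqs" "proj_seq [A] = proj_seq R"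
      using representative[OF A] unfolding R_def by auto
    have "length R = 1" using proj_seq_eqD(1)[OF R(2,1)] by simp
    then obtain B where B: "R = [B]" by (metis One_nat_def length_0_conv length_Suc_conv)
    obtain c where "c \<noteq> 0" "\<forall>x. B x = c *s A x"
      using proj_seq_eqD(3)[OF R(2,1), of 0] unfolding B by auto
    then have "B = (\<lambda>x. c *s A x)" "c \<noteq> 0" by auto
    then show ?thesis using assms(2) A B unfolding f_def R_def[symmetric] scale_invariant_def
      by simp
  qed
  then show ?thesis using assms(1) unfolding regular_PGL_def by blast
qed

context coordinates
begin

definition entry :: "nat \<Rightarrow> nat \<Rightarrow> 'n vmap \<Rightarrow> complex" where
  "entry i j A = coord (matrix A *v b j) i"

lemma entry_linear: "vlinear A \<Longrightarrow> entry i j A = coord (A (b j)) i"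
  unfolding entry_def by (simp add: matrix_works)

lemma entry_regular: "entry i j \<in> regular_GL"
proof -
  have "entry i j = (\<lambda>A. \<Sum>k\<in>UNIV. (\<Sum>l\<in>UNIV. matrix A $ k $ l * (b j $ l)) * coord (axis k 1) i)"
    unfolding entry_def by (subst coord_as_sum) (simp add: matrix_vector_mult_def)
  also have "\<dots> \<in> regular_GL"
    unfolding regular_GL_def
    by (intro function_algebra_sum function_algebra.mult function_algebra.const function_algebra.gen) auto
  finally show ?thesis .
qed

lemma entry_scale: "vlinear A \<Longrightarrow> entry i j (\<lambda>x. c *s A x) = c * entry i j A"
proof -
  assume A: "vlinear A"
  have "vlinear (\<lambda>x. c *s A x)"
    using A unfolding Vector_Spaces.linear_iff
    by (simp add: vector_add_ldistrib vector_smult_assoc mult.commute)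
  then show ?thesis by (simp add: entry_linear A)
qed

lemma inverse_det_regular: "(\<lambda>A :: 'n vmap. inverse (det (matrix A))) \<in> regular_GL"
  unfolding regular_GL_def by (intro function_algebra.gen) auto

lemma mono_map_unique:
  assumes "vlinear A" "\<And>i. i \<in> N \<Longrightarrow> A (b i) = d i *s b (\<sigma> i)"
  shows "A = mono_map \<sigma> d N"
proof
  fix x
  have "A \<in> hom_space (coord_space N)"
    using assms(1) unfolding hom_space_def Vector_Spaces.linear_iff by simp
  then have "A (\<Sum>i\<in>N. coord x i *s b i) = (\<Sum>i\<in>N. coord x i *s A (b i))"
    by (rule hom_space_sum) auto
  also have "\<dots> = mono_map \<sigma> d N x"
    unfolding mono_map_def using assms(2)
    by (intro sum.cong) (simp_all add: vector_smult_assoc mult.commute)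
  finally show "A x = mono_map \<sigma> d N x" unfolding expansion .
qed

lemma vlinear_mono_map: "vlinear (mono_map \<sigma> d S)"
  unfolding Vector_Spaces.linear_iff using vec.vector_space_axioms
  by (simp add: mono_map_add mono_map_scale)

text \<open>Conjugation by the matrix \<open>B\<close> whose columns are the basis vectors turns the map into a
  diagonal matrix; the inverse of \<open>B\<close> consists of the coordinates of the standard basis.\<close>

lemma det_mono_map_id: "det (matrix (mono_map id d N)) = (\<Prod>i\<in>N. d i)"
proof -
  have "card (UNIV :: 'n set) = card N" unfolding N_eq by simp
  then obtain \<iota> where \<iota>: "bij_betw \<iota> (UNIV :: 'n set) N"
    using finite_same_card_bij[of "UNIV :: 'n set" N] by auto
  have \<iota>N: "\<iota> c \<in> N" for c using \<iota> unfolding bij_betw_def by auto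
  define B :: "complex ^ 'n ^ 'n" where "B = (\<chi> r c. b (\<iota> c) $ r)"
  define C :: "complex ^ 'n ^ 'n" where "C = (\<chi> r c. coord (axis c 1) (\<iota> r))"
  define D :: "complex ^ 'n ^ 'n" where "D = (\<chi> r c. if r = c then d (\<iota> c) else 0)"
  have "(B ** C) $ r $ c = mat 1 $ r $ c" for r c
  proof -
    have "(B ** C) $ r $ c = (\<Sum>k\<in>UNIV. coord (axis c 1) (\<iota> k) * b (\<iota> k) $ r)"
      unfolding B_def C_def matrix_matrix_mult_def by (simp add: mult.commute)
    also have "\<dots> = (\<Sum>i\<in>N. coord (axis c 1) i * b i $ r)"
      by (rule sum.reindex_bij_betw[OF \<iota>])
    also have "\<dots> = (\<Sum>i\<in>N. coord (axis c 1) i *s b i) $ r" by simp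
    also have "\<dots> = mat 1 $ r $ c" unfolding expansion by (simp add: axis_def mat_def)
    finally show ?thesis .
  qed
  then have "B ** C = mat 1" by (simp add: vec_eq_iff)
  then have "det B * det C = 1" using det_mul[of B C] by simp
  then have B: "det B \<noteq> 0" by auto
  have "(matrix (mono_map id d N) ** B) $ r $ c = (B ** D) $ r $ c" for r c
  proof -
    have "(matrix (mono_map id d N) ** B) $ r $ c = (matrix (mono_map id d N) *v b (\<iota> c)) $ r"
      unfolding B_def matrix_matrix_mult_def matrix_vector_mult_def by simp
    also have "\<dots> = (d (\<iota> c) *s b (\<iota> c)) $ r"
      unfolding matrix_works[OF vlinear_mono_map] using \<iota>N by (simp add: mono_map_basis)
    also have "\<dots> = (B ** D) $ r $ c"
      unfolding B_def D_def matrix_matrix_mult_def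
      by (simp add: if_distrib[of "\<lambda>z. _ * z"] mult.commute cong: if_cong)
    finally show ?thesis .
  qed
  then have "matrix (mono_map id d N) ** B = B ** D" by (simp add: vec_eq_iff)
  then have "det (matrix (mono_map id d N)) * det B = det B * det D"
    using det_mul[of "matrix (mono_map id d N)" B] det_mul[of B D] by metis
  then have "det (matrix (mono_map id d N)) = det D" using B by simp
  also have "\<dots> = (\<Prod>c\<in>UNIV. d (\<iota> c))" unfolding D_def by (subst det_diagonal) simp_all
  also have "\<dots> = (\<Prod>i\<in>N. d i)" by (rule prod.reindex_bij_betw[OF \<iota>])
  finally show ?thesis .
qed

section \<open>The diagonal torus\<close>

definition diagonal_classes :: "'n vmap set list set" where
  "diagonal_classes = {bclass [N] id d | d. nonvanishing d}"

definition monomial_classes :: "'n vmap set list set" where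
  "monomial_classes = {bclass [N] \<sigma> d | \<sigma> d. \<sigma> permutes N \<and> nonvanishing d}"

lemma bclass_cong:
  assumes "p \<in> OP" "\<sigma> permutes N" "nonvanishing d" "\<And>i. i \<in> N \<Longrightarrow> d i = d' i"
  shows "bclass p \<sigma> d = bclass p \<sigma> d'"
proof (rule bclass_eqI[OF assms(1-3)])
  show "nonvanishing d'" using assms(3,4) unfolding nonvanishing_def by simp
  have "\<forall>i\<in>S. d' i = 1 * d i" if "S \<in> set p" for S
  proof
    fix i assume "i \<in> S"
    then have "i \<in> N" using that OP_D(3)[OF assms(1)] by blast
    then show "d' i = 1 * d i" using assms(4) by simp
  qed
  then show "block_scaling p d d'" unfolding block_scaling_def by (metis one_neq_zero)
qed

lemma nonvanishing_comp: "\<tau> permutes N \<Longrightarrow> nonvanishing d \<Longrightarrow> nonvanishing (\<lambda>i. d (\<tau> i))"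
  unfolding nonvanishing_def using permutes_in_image by fastforce

lemma nonvanishing_mult: "nonvanishing d \<Longrightarrow> nonvanishing d' \<Longrightarrow> nonvanishing (\<lambda>i. d i * d' i)"
  unfolding nonvanishing_def by simp

lemma nonvanishing_one: "nonvanishing (\<lambda>_. 1)"
  unfolding nonvanishing_def by simp

lemma nonvanishing_divide: "nonvanishing d \<Longrightarrow> nonvanishing d' \<Longrightarrow> nonvanishing (\<lambda>i. d i / d' i)"
  unfolding nonvanishing_def by simp

lemma mult_PGL_bclass:
  assumes "\<tau> permutes N"
  shows "bclass [N] \<sigma> d \<otimes>\<^bsub>PGL\<^esub> bclass [N] \<tau> d' = bclass [N] (\<sigma> \<circ> \<tau>) (\<lambda>i. d (\<tau> i) * d' i)"
  unfolding bclass_one_block mult_PGL[OF vlinear_mono_map] mono_map_comp[OF assms order_refl order_refl]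
    permutes_vimage_self[OF assms] by simp

lemma one_PGL_bclass: "\<one>\<^bsub>PGL\<^esub> = bclass [N] id (\<lambda>_. 1)"
proof -
  have "(id :: 'n vmap) = mono_map id (\<lambda>_. 1) N"
    using vec.linear_id by (intro mono_map_unique) (simp_all add: id_def)
  then show ?thesis unfolding one_PGL bclass_one_block by simp
qed

lemma bclass_in_PGL: "\<sigma> permutes N \<Longrightarrow> nonvanishing d \<Longrightarrow> bclass [N] \<sigma> d \<in> carrier PGL"
  unfolding carrier_PGL bclass_one_block using one_block_in_M_seqs by blast

lemma inv_PGL_bclass:
  assumes "\<sigma> permutes N" "nonvanishing d"
  shows "inv\<^bsub>PGL\<^esub> (bclass [N] \<sigma> d) = bclass [N] (inv_into UNIV \<sigma>) (\<lambda>i. 1 / d (inv_into UNIV \<sigma> i))"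
proof (rule group.inv_equality[OF group_PGL])
  note inv = permutes_inv[OF assms(1)]
  have d': "nonvanishing (\<lambda>i. 1 / d (inv_into UNIV \<sigma> i))"
    by (rule nonvanishing_divide[OF nonvanishing_one nonvanishing_comp[OF inv assms(2)]])
  show "bclass [N] \<sigma> d \<in> carrier PGL" by (rule bclass_in_PGL[OF assms])
  show "bclass [N] (inv_into UNIV \<sigma>) (\<lambda>i. 1 / d (inv_into UNIV \<sigma> i)) \<in> carrier PGL"
    by (rule bclass_in_PGL[OF inv d'])
  have "inv_into UNIV \<sigma> \<circ> \<sigma> = id" by (rule permutes_inv_o(2)[OF assms(1)])
  moreover have "bclass [N] id (\<lambda>i. 1 / d (inv_into UNIV \<sigma> (\<sigma> i)) * d i) = bclass [N] id (\<lambda>_. 1)"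
    using assms(2) permutes_inverses(2)[OF assms(1)]
    by (intro bclass_cong[OF N_in_OP permutes_id]) (simp_all add: nonvanishing_def)
  ultimately show "bclass [N] (inv_into UNIV \<sigma>) (\<lambda>i. 1 / d (inv_into UNIV \<sigma> i)) \<otimes>\<^bsub>PGL\<^esub> bclass [N] \<sigma> d = \<one>\<^bsub>PGL\<^esub>"
    unfolding mult_PGL_bclass[OF assms(1)] one_PGL_bclass by simp
qed

lemma subgroup_diagonal: "subgroup diagonal_classes PGL"
proof (rule group.subgroupI[OF group_PGL])
  show "diagonal_classes \<subseteq> carrier PGL"
    unfolding diagonal_classes_def using bclass_in_PGL[OF permutes_id] by blast
  show "diagonal_classes \<noteq> {}" unfolding diagonal_classes_def using nonvanishing_one by blast
  fix x assume "x \<in> diagonal_classes"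
  then obtain d where d: "x = bclass [N] id d" "nonvanishing d" unfolding diagonal_classes_def
    by blast
  have "inv\<^bsub>PGL\<^esub> x = bclass [N] id (\<lambda>i. 1 / d i)"
    unfolding d(1) inv_PGL_bclass[OF permutes_id d(2)] by simp
  then show "inv\<^bsub>PGL\<^esub> x \<in> diagonal_classes"
    unfolding diagonal_classes_def using nonvanishing_divide[OF nonvanishing_one d(2)] by blast
  fix y assume "y \<in> diagonal_classes"
  then obtain d' where d': "y = bclass [N] id d'" "nonvanishing d'" unfolding diagonal_classes_def
    by blast
  have "x \<otimes>\<^bsub>PGL\<^esub> y = bclass [N] id (\<lambda>i. d i * d' i)"
    unfolding d(1) d'(1) mult_PGL_bclass[OF permutes_id] by simp
  then show "x \<otimes>\<^bsub>PGL\<^esub> y \<in> diagonal_classes"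
    unfolding diagonal_classes_def using nonvanishing_mult[OF d(2) d'(2)] by blast
qed

lemma entry_mono_map: "i \<in> N \<Longrightarrow> j \<in> N \<Longrightarrow> entry i j (mono_map id d N) = (if i = j then d j else 0)"
  unfolding entry_linear[OF vlinear_mono_map] by (auto simp: mono_map_basis coord_basis)

lemma diagonal_if_entries_zero:
  assumes A: "[A] \<in> M_seqs" and off: "\<And>i j. i \<in> N \<Longrightarrow> j \<in> N \<Longrightarrow> i \<noteq> j \<Longrightarrow> coord (A (b j)) i = 0"
  shows "proj_seq [A] \<in> diagonal_classes"
proof -
  define d where "d i = coord (A (b i)) i" for i
  have lin: "vlinear A" and ker: "\<And>x. A x = 0 \<Longrightarrow> x = 0" using A unfolding one_term_M_seqs by auto
  have Ab: "A (b j) = d j *s b j" if j: "j \<in> N" for j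
  proof (rule eq_coordI)
    fix i assume "i \<in> N"
    then show "coord (A (b j)) i = coord (d j *s b j) i"
      using off[of i j] j unfolding d_def by (cases "i = j") (auto simp: coord_basis)
  qed
  have "nonvanishing d"
    unfolding nonvanishing_def
  proof
    fix i assume i: "i \<in> N"
    have "A (b i) \<noteq> 0" using ker[of "b i"] b_nonzero[OF i] by blast
    then show "d i \<noteq> 0" using Ab[OF i] by auto
  qed
  moreover have "A = mono_map id d N" using Ab by (intro mono_map_unique lin) simp
  ultimately show ?thesis unfolding diagonal_classes_def bclass_one_block by blast
qed

text \<open>The off-diagonal entries are not functions on the projective group, but their \<open>n\<close>-th
  powers divided by the determinant are, and these have the same zeros.\<close>

lemma zariski_closed_diagonal: "zariski_closed_PGL diagonal_classes"
proof -
  let ?F = "\<lambda>i j A. entry i j A ^ CARD('n) * inverse (det (matrix (A :: 'n vmap)))"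
  have "\<exists>f\<in>regular_PGL. \<forall>A. [A] \<in> M_seqs \<longrightarrow> f (proj_seq [A]) = ?F i j A" for i j
  proof (rule regular_descends)
    have "?F i j = (\<lambda>A. (\<Prod>_\<in>{..<CARD('n)}. entry i j A) * inverse (det (matrix A)))" by simp
    also have "\<dots> \<in> regular_GL"
      using entry_regular inverse_det_regular unfolding regular_GL_def
      by (intro function_algebra.mult function_algebra_prod) auto
    finally show "?F i j \<in> regular_GL" .
    show "scale_invariant (?F i j)"
      unfolding scale_invariant_def one_term_M_seqs
      by (auto simp: entry_scale det_scale power_mult_distrib)
  qed
  then obtain f where f: "\<And>i j. f i j \<in> regular_PGL"
    "\<And>i j A. [A] \<in> M_seqs \<Longrightarrow> f i j (proj_seq [A]) = ?F i j A" by metis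
  let ?S = "{f i j | i j. i \<in> N \<and> j \<in> N \<and> i \<noteq> j}"
  have "diagonal_classes = {P \<in> carrier PGL. \<forall>g\<in>?S. g P = 0}"
  proof (intro equalityI subsetI)
    fix P assume P: "P \<in> diagonal_classes"
    then obtain d where d: "P = proj_seq [mono_map id d N]" "nonvanishing d"
      unfolding diagonal_classes_def bclass_one_block by blast
    have "f i j P = 0" if "i \<in> N" "j \<in> N" "i \<noteq> j" for i j
      unfolding d(1) f(2)[OF one_block_in_M_seqs[OF permutes_id d(2)]] using that
      by (simp add: entry_mono_map)
    then show "P \<in> {P \<in> carrier PGL. \<forall>g\<in>?S. g P = 0}"
      using P subgroup.subset[OF subgroup_diagonal] by blast
  next
    fix P assume P: "P \<in> {P \<in> carrier PGL. \<forall>g\<in>?S. g P = 0}"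
    then obtain A where A: "P = proj_seq [A]" "[A] \<in> M_seqs" unfolding carrier_PGL by blast
    have lin: "vlinear A" using A(2) unfolding one_term_M_seqs by simp
    have "coord (A (b j)) i = 0" if "i \<in> N" "j \<in> N" "i \<noteq> j" for i j
    proof -
      have "f i j P = 0" using P that by blast
      then have "?F i j A = 0" using f(2)[OF A(2)] A(1) by simp
      then show ?thesis using det_one_term[OF A(2)] by (simp add: entry_linear[OF lin])
    qed
    then show "P \<in> diagonal_classes" unfolding A(1) by (rule diagonal_if_entries_zero[OF A(2)])
  qed
  then show ?thesis unfolding zariski_closed_PGL_def using f(1) by (intro exI[of _ ?S]) auto
qed

text \<open>Diagonal classes are parametrised by \<open>n - 1\<close> nonzero numbers, with the last coefficient
  normalised to \<open>1\<close>. The shift is there because coordinates of the power of the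
  multiplicative group start at \<open>0\<close>.\<close>

definition padded :: "(nat \<Rightarrow> complex) \<Rightarrow> nat \<Rightarrow> complex" where
  "padded t i = (if i = card N then 1 else t (i - 1))"

lemma in_N_iff: "i \<in> N \<longleftrightarrow> 1 \<le> i \<and> i \<le> card N"
proof -
  have "i \<in> N \<longleftrightarrow> i \<in> {1..card N}" by (simp only: N_card)
  then show ?thesis by simp
qed

lemma card_N_pos: "1 \<le> card N" and card_N_in_N: "card N \<in> N"
proof -
  show "1 \<le> card N" using N_eq by (simp add: Suc_le_eq)
  then show "card N \<in> N" by (simp add: in_N_iff)
qed

lemma carrier_Gm_power: "carrier (Gm_power k) = {..<k} \<rightarrow>\<^sub>E - {0}"
  unfolding Gm_power_def Gm_def by simp

lemma nonvanishing_padded: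
  assumes "t \<in> carrier (Gm_power (card N - 1))" shows "nonvanishing (padded t)"
proof -
  have "t (i - 1) \<noteq> 0" if "i \<in> N" "i \<noteq> card N" for i
  proof -
    have "i - 1 \<in> {..<card N - 1}" using that unfolding in_N_iff by auto
    then show ?thesis using assms unfolding carrier_Gm_power by auto
  qed
  then show ?thesis unfolding nonvanishing_def padded_def by simp
qed

lemma padded_iso:
  "(\<lambda>t. bclass [N] id (padded t)) \<in> iso (Gm_power (card N - 1)) (PGL\<lparr>carrier := diagonal_classes\<rparr>)"
proof -
  let ?G = "Gm_power (card N - 1)"
  let ?h = "\<lambda>t. bclass [N] id (padded t)"
  have "?h \<in> hom ?G (PGL\<lparr>carrier := diagonal_classes\<rparr>)"
  proof (rule homI)
    fix t assume t: "t \<in> carrier ?G"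
    show "?h t \<in> carrier (PGL\<lparr>carrier := diagonal_classes\<rparr>)"
      using nonvanishing_padded[OF t] unfolding diagonal_classes_def by auto
    fix u assume u: "u \<in> carrier ?G"
    have tu: "t \<otimes>\<^bsub>?G\<^esub> u = (\<lambda>i\<in>{..<card N - 1}. t i * u i)"
      unfolding Gm_power_def Gm_def by simp
    have "bclass [N] id (\<lambda>i. padded t i * padded u i) = bclass [N] id (padded (t \<otimes>\<^bsub>?G\<^esub> u))"
    proof (rule bclass_cong[OF N_in_OP permutes_id])
      show "nonvanishing (\<lambda>i. padded t i * padded u i)"
        by (intro nonvanishing_mult nonvanishing_padded t u)
      fix i assume "i \<in> N"
      then show "padded t i * padded u i = padded (t \<otimes>\<^bsub>?G\<^esub> u) i"
        unfolding tu padded_def in_N_iff by auto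
    qed
    then show "?h (t \<otimes>\<^bsub>?G\<^esub> u) = ?h t \<otimes>\<^bsub>PGL\<lparr>carrier := diagonal_classes\<rparr>\<^esub> ?h u"
      using mult_PGL_bclass[OF permutes_id, of id "padded t" "padded u"] by simp
  qed
  moreover have "inj_on ?h (carrier ?G)"
  proof (rule inj_onI)
    fix t u assume t: "t \<in> carrier ?G" and u: "u \<in> carrier ?G" and eq: "?h t = ?h u"
    have "block_scaling [N] (padded t) (padded u)"
      by (rule bclass_eqD(3)[OF N_in_OP permutes_id nonvanishing_padded[OF t]
            N_in_OP permutes_id nonvanishing_padded[OF u] eq])
    then obtain c where c: "\<forall>i\<in>N. padded u i = c * padded t i" unfolding block_scaling_def by auto
    then have "c = 1" using card_N_in_N unfolding padded_def by force
    have "t i = u i" if "i \<in> {..<card N - 1}" for i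
    proof -
      have "Suc i \<in> N" "Suc i \<noteq> card N" using that unfolding in_N_iff by auto
      then show ?thesis using c \<open>c = 1\<close> unfolding padded_def by force
    qed
    then show "t = u" using t u unfolding carrier_Gm_power by (rule PiE_ext[rotated 2])
  qed
  moreover have "diagonal_classes \<subseteq> ?h ` carrier ?G"
  proof
    fix P assume "P \<in> diagonal_classes"
    then obtain d where d: "P = bclass [N] id d" "nonvanishing d" unfolding diagonal_classes_def
      by blast
    define t where "t = (\<lambda>i\<in>{..<card N - 1}. d (Suc i) / d (card N))"
    have nz: "d (card N) \<noteq> 0" using d(2) card_N_in_N unfolding nonvanishing_def by blast
    have t: "t \<in> carrier ?G"
      using d(2) nz unfolding carrier_Gm_power t_def nonvanishing_def by (auto simp: in_N_iff)
    have "block_scaling [N] (padded t) d"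
    proof -
      have "d i = d (card N) * padded t i" if "i \<in> N" for i
        using that nz unfolding padded_def t_def in_N_iff by auto
      then show ?thesis unfolding block_scaling_def using nz by auto
    qed
    then have "?h t = P"
      unfolding d(1) by (intro bclass_eqI N_in_OP permutes_id nonvanishing_padded t d(2))
    then show "P \<in> ?h ` carrier ?G" using t by blast
  qed
  ultimately show ?thesis unfolding iso_def bij_betw_def hom_def by auto
qed

lemma padded_regular:
  assumes "i \<in> N"
  shows "(\<lambda>t. padded t i) \<in> regular_Gm_power (card N - 1)"
    "(\<lambda>t. inverse (padded t i)) \<in> regular_Gm_power (card N - 1)"
proof -
  have "i - 1 < card N - 1" if "i \<noteq> card N" using assms that unfolding in_N_iff by auto
  then show "(\<lambda>t. padded t i) \<in> regular_Gm_power (card N - 1)"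
    "(\<lambda>t. inverse (padded t i)) \<in> regular_Gm_power (card N - 1)"
    unfolding regular_Gm_power_def padded_def
    by (cases "i = card N"; auto intro!: function_algebra.gen function_algebra.const)+
qed

text \<open>Entries of a diagonal map are linear in its coefficients, and the inverse determinant is
  the product of their inverses.\<close>

lemma regular_GL_restrict:
  assumes "F \<in> regular_GL"
  shows "(\<lambda>t. F (mono_map id (padded t) N)) \<in> regular_Gm_power (card N - 1)"
  using assms unfolding regular_GL_def
proof (induction F)
  case (gen F)
  then consider r c where "F = (\<lambda>A. matrix A $ r $ c)" | "F = (\<lambda>A. inverse (det (matrix A)))"
    by blast
  then show ?case
  proof cases
    case (1 r c)
    have "(\<lambda>t. F (mono_map id (padded t) N)) =
        (\<lambda>t. \<Sum>i\<in>N. padded t i * (coord (axis c 1) i * b i $ r))"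
      unfolding 1 matrix_def mono_map_def by (simp add: mult.assoc)
    also have "\<dots> \<in> regular_Gm_power (card N - 1)"
      using padded_regular(1) unfolding regular_Gm_power_def
      by (intro function_algebra_sum function_algebra.mult function_algebra.const finite_N)
    finally show ?thesis .
  next
    case 2
    have "(\<lambda>t. F (mono_map id (padded t) N)) = (\<lambda>t. \<Prod>i\<in>N. inverse (padded t i))"
      unfolding 2 det_mono_map_id by (simp add: prod_inversef[unfolded comp_def])
    also have "\<dots> \<in> regular_Gm_power (card N - 1)"
      using padded_regular(2) unfolding regular_Gm_power_def
      by (intro function_algebra_prod finite_N)
    finally show ?thesis .
  qed
qed (auto simp: regular_Gm_power_def intro: function_algebra.intros)

text \<open>The entry at \<open>(a, a)\<close>, times the diagonal entries other than the one at \<open>(c, c)\<close>,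
  divided by the determinant, has degree zero, and on diagonal maps everything but \<open>d a /
  d c\<close> cancels. With the index of the normalised coefficient as \<open>c\<close> or \<open>a\<close> it extends a
  coordinate of the torus or its inverse.\<close>

lemma entry_ratio:
  assumes "a \<in> N" "c \<in> N"
  shows "\<exists>F\<in>regular_GL. scale_invariant F \<and>
    (\<forall>d. nonvanishing d \<longrightarrow> F (mono_map id d N) = d a / d c)"
proof -
  let ?F = "\<lambda>A. entry a a A * (\<Prod>j\<in>N - {c}. entry j j A) * inverse (det (matrix (A :: 'n vmap)))"
  have "?F \<in> regular_GL"
    using entry_regular inverse_det_regular unfolding regular_GL_def
    by (intro function_algebra.mult function_algebra_prod) auto
  moreover have "scale_invariant ?F"
  proof -
    have pow: "k * k ^ (card N - 1) = k ^ CARD('n)" for k :: complex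
      using card_N_pos N_eq by (simp add: power_eq_if)
    have "?F (\<lambda>x. k *s A x) = ?F A" if A: "vlinear A" and k: "k \<noteq> 0" for A k
    proof -
      let ?P = "\<Prod>j\<in>N - {c}. entry j j A"
      have "card (N - {c}) = card N - 1" using assms(2) by simp
      then have "(\<Prod>j\<in>N - {c}. entry j j (\<lambda>x. k *s A x)) = k ^ (card N - 1) * ?P"
        by (simp only: entry_scale[OF A] prod.distrib prod_constant)
      then have "?F (\<lambda>x. k *s A x) =
          (k * k ^ (card N - 1)) * (entry a a A * ?P) * inverse (k ^ CARD('n) * det (matrix A))"
        by (simp only: entry_scale[OF A] det_scale mult_ac)
      also have "\<dots> = ?F A" unfolding pow using k by (simp add: field_simps)
      finally show ?thesis .
    qed
    then show ?thesis unfolding scale_invariant_def one_term_M_seqs by blast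
  qed
  moreover have "?F (mono_map id d N) = d a / d c" if d: "nonvanishing d" for d
  proof -
    define Q where "Q = (\<Prod>j\<in>N - {c}. d j)"
    have nz: "Q \<noteq> 0" "d c \<noteq> 0" using d assms(2) unfolding nonvanishing_def Q_def by auto
    have "(\<Prod>j\<in>N - {c}. entry j j (mono_map id d N)) = Q"
      unfolding Q_def by (intro prod.cong) (simp_all add: entry_mono_map)
    moreover have "det (matrix (mono_map id d N)) = d c * Q"
      unfolding det_mono_map_id Q_def using assms(2) by (simp add: prod.remove)
    moreover have "entry a a (mono_map id d N) = d a" using assms(1) by (simp add: entry_mono_map)
    ultimately show ?thesis using nz by (simp add: field_simps)
  qed
  ultimately show ?thesis by (intro bexI[of _ ?F]) auto
qed

lemma regular_Gm_power_extend:
  assumes "f \<in> regular_Gm_power (card N - 1)"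
  shows "\<exists>F\<in>regular_GL. scale_invariant F \<and>
    (\<forall>t\<in>carrier (Gm_power (card N - 1)). F (mono_map id (padded t) N) = f t)"
  using assms unfolding regular_Gm_power_def
proof (induction f)
  case (gen f)
  then obtain i where i: "i < card N - 1" "f = (\<lambda>t. t i) \<or> f = (\<lambda>t. inverse (t i))" by auto
  have iN: "Suc i \<in> N" and pad: "padded t (Suc i) = t i" "padded t (card N) = 1" for t
    using i(1) unfolding in_N_iff padded_def by auto
  obtain a c where ac: "a \<in> N" "c \<in> N" "\<And>t. padded t a / padded t c = f t"
  proof (cases "f = (\<lambda>t. t i)")
    case True
    then show thesis using that[OF iN card_N_in_N] pad by simp
  next
    case False
    then have "f = (\<lambda>t. inverse (t i))" using i(2) by blast
    then show thesis using that[OF card_N_in_N iN] pad by (simp add: inverse_eq_divide)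
  qed
  obtain F where F: "F \<in> regular_GL" "scale_invariant F"
    "\<And>d. nonvanishing d \<Longrightarrow> F (mono_map id d N) = d a / d c"
    using entry_ratio[OF ac(1,2)] by blast
  have "F (mono_map id (padded t) N) = f t" if "t \<in> carrier (Gm_power (card N - 1))" for t
    unfolding F(3)[OF nonvanishing_padded[OF that]] ac(3) ..
  then show ?case using F(1,2) by blast
next
  case (const c)
  have "(\<lambda>_. c) \<in> regular_GL" unfolding regular_GL_def by (rule function_algebra.const)
  then show ?case unfolding scale_invariant_def by (intro bexI[of _ "\<lambda>_. c"]) auto
next
  case (add f g)
  then obtain F G
    where FG: "F \<in> regular_GL" "G \<in> regular_GL" "scale_invariant F" "scale_invariant G"
    "\<forall>t\<in>carrier (Gm_power (card N - 1)). F (mono_map id (padded t) N) = f t"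
    "\<forall>t\<in>carrier (Gm_power (card N - 1)). G (mono_map id (padded t) N) = g t" by blast
  have "(\<lambda>A. F A + G A) \<in> regular_GL"
    using FG(1,2) unfolding regular_GL_def by (rule function_algebra.add)
  moreover have "scale_invariant (\<lambda>A. F A + G A)"
    using FG(3,4) unfolding scale_invariant_def by simp
  moreover have "F (mono_map id (padded t) N) + G (mono_map id (padded t) N) = f t + g t"
    if "t \<in> carrier (Gm_power (card N - 1))" for t
    unfolding bspec[OF FG(5) that] bspec[OF FG(6) that] ..
  ultimately show ?case by blast
next
  case (mult f g)
  then obtain F G
    where FG: "F \<in> regular_GL" "G \<in> regular_GL" "scale_invariant F" "scale_invariant G"
    "\<forall>t\<in>carrier (Gm_power (card N - 1)). F (mono_map id (padded t) N) = f t"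
    "\<forall>t\<in>carrier (Gm_power (card N - 1)). G (mono_map id (padded t) N) = g t" by blast
  have "(\<lambda>A. F A * G A) \<in> regular_GL"
    using FG(1,2) unfolding regular_GL_def by (rule function_algebra.mult)
  moreover have "scale_invariant (\<lambda>A. F A * G A)"
    using FG(3,4) unfolding scale_invariant_def by simp
  moreover have "F (mono_map id (padded t) N) * G (mono_map id (padded t) N) = f t * g t"
    if "t \<in> carrier (Gm_power (card N - 1))" for t
    unfolding bspec[OF FG(5) that] bspec[OF FG(6) that] ..
  ultimately show ?case by blast
qed

lemma regular_functions_diagonal:
  fixes g :: "'n vmap set list \<Rightarrow> complex"
  shows "(\<exists>f\<in>regular_PGL. \<forall>P\<in>diagonal_classes. g P = f P) \<longleftrightarrow>
    (\<exists>f\<in>regular_Gm_power (card N - 1). \<forall>t\<in>carrier (Gm_power (card N - 1)).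
      g (bclass [N] id (padded t)) = f t)"
proof -
  let ?K = "carrier (Gm_power (card N - 1))"
  have mem: "bclass [N] id (padded t) \<in> diagonal_classes" "[mono_map id (padded t) N] \<in> M_seqs"
    if "t \<in> ?K" for t
    using nonvanishing_padded[OF that] one_block_in_M_seqs[OF permutes_id]
    unfolding diagonal_classes_def by auto
  show ?thesis
  proof
    assume "\<exists>f\<in>regular_PGL. \<forall>P\<in>diagonal_classes. g P = f P"
    then obtain f F where f: "\<forall>P\<in>diagonal_classes. g P = f P" "F \<in> regular_GL"
      "\<forall>A. [A] \<in> M_seqs \<longrightarrow> f (proj_seq [A]) = F A" unfolding regular_PGL_def by blast
    have "g (bclass [N] id (padded t)) = F (mono_map id (padded t) N)" if "t \<in> ?K" for t
      using f(1,3) mem[OF that] unfolding bclass_one_block by simp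
    then show "\<exists>f\<in>regular_Gm_power (card N - 1). \<forall>t\<in>?K. g (bclass [N] id (padded t)) = f t"
      using regular_GL_restrict[OF f(2)]
      by (intro bexI[of _ "\<lambda>t. F (mono_map id (padded t) N)"]) auto
  next
    assume "\<exists>f\<in>regular_Gm_power (card N - 1). \<forall>t\<in>?K. g (bclass [N] id (padded t)) = f t"
    then obtain f F where f: "\<forall>t\<in>?K. g (bclass [N] id (padded t)) = f t"
      "F \<in> regular_GL" "scale_invariant F" "\<forall>t\<in>?K. F (mono_map id (padded t) N) = f t"
      using regular_Gm_power_extend by blast
    obtain f' where f': "f' \<in> regular_PGL" "\<forall>A. [A] \<in> M_seqs \<longrightarrow> f' (proj_seq [A]) = F A"
      using regular_descends[OF f(2,3)] by blast
    have "g P = f' P" if P: "P \<in> diagonal_classes" for P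
    proof -
      have "bij_betw (\<lambda>t. bclass [N] id (padded t)) ?K diagonal_classes"
        using padded_iso unfolding iso_def by simp
      then obtain t where t: "t \<in> ?K" "P = bclass [N] id (padded t)"
        using P unfolding bij_betw_def by blast
      then show ?thesis using f(1,4) f'(2) mem[OF t(1)] unfolding bclass_one_block by simp
    qed
    then show "\<exists>f\<in>regular_PGL. \<forall>P\<in>diagonal_classes. g P = f P" using f'(1) by blast
  qed
qed

lemma torus_diagonal: "torus diagonal_classes"
  unfolding torus_def
  by (intro conjI subgroup_diagonal zariski_closed_diagonal exI[of _ "card N - 1"]
      bexI[OF _ padded_iso] allI regular_functions_diagonal)

text \<open>A torus that is diagonal in the basis consists of diagonal classes; these already form a
  torus.\<close>

lemma maximal_torus_diagonal:
  assumes "maximal_torus T" "diagonal_in E T"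
  shows "T = diagonal_classes"
proof -
  have T: "torus T" "\<And>T'. torus T' \<Longrightarrow> T \<subseteq> T' \<Longrightarrow> T' = T"
    using assms(1) unfolding maximal_torus_def by auto
  have "T \<subseteq> diagonal_classes"
  proof
    fix P assume P: "P \<in> T"
    then have "P \<in> carrier PGL" using T(1) subgroup.subset unfolding torus_def by blast
    then obtain A where A: "P = proj_seq [A]" "[A] \<in> M_seqs" unfolding carrier_PGL by blast
    have "A \<in> hd P" unfolding A(1) proj_seq_one_term using proj_class_self[of A UNIV] by simp
    then have diag: "\<exists>c. A v = c *s v" if "v \<in> E" for v
      using assms(2) P that unfolding diagonal_in_def by blast
    have "coord (A (b j)) i = 0" if "i \<in> N" "j \<in> N" "i \<noteq> j" for i j
    proof -
      obtain c where "A (b j) = c *s b j" using diag b_in_E \<open>j \<in> N\<close> by blast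
      then show ?thesis using that by (simp add: coord_basis)
    qed
    then show "P \<in> diagonal_classes" unfolding A(1) by (rule diagonal_if_entries_zero[OF A(2)])
  qed
  then show ?thesis using T(2)[OF torus_diagonal] by simp
qed

section \<open>The normalizer\<close>

lemma conjugate_diagonal:
  assumes "\<sigma> permutes N" "nonvanishing d"
  shows "bclass [N] \<sigma> d \<otimes>\<^bsub>PGL\<^esub> bclass [N] id e \<otimes>\<^bsub>PGL\<^esub> inv\<^bsub>PGL\<^esub> (bclass [N] \<sigma> d) =
    bclass [N] id (\<lambda>i. d (inv_into UNIV \<sigma> i) * e (inv_into UNIV \<sigma> i) * (1 / d (inv_into UNIV \<sigma> i)))"
  unfolding inv_PGL_bclass[OF assms] mult_PGL_bclass[OF permutes_id]
    mult_PGL_bclass[OF permutes_inv[OF assms(1)]]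
  using permutes_inv_o(1)[OF assms(1)] by simp

text \<open>A diagonal map with distinct eigenvalues has only the basis vectors as eigenvectors, up
  to scalars. If \<open>D A = c A D'\<close> then \<open>A\<close> carries basis vectors to eigenvectors of \<open>D\<close>.\<close>

lemma monomial_if_normalizes:
  assumes A: "[A] \<in> M_seqs" and d: "nonvanishing d" "inj_on d N"
    and eq: "bclass [N] id d \<otimes>\<^bsub>PGL\<^esub> proj_seq [A] = proj_seq [A] \<otimes>\<^bsub>PGL\<^esub> bclass [N] id e"
  shows "proj_seq [A] \<in> monomial_classes"
proof -
  have lin: "vlinear A" and ker: "\<And>x. A x = 0 \<Longrightarrow> x = 0" using A unfolding one_term_M_seqs by auto
  have lin2: "A (x + y) = A x + A y" "A (c *s x) = c *s A x" for c x y
    using lin unfolding Vector_Spaces.linear_iff by auto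
  have DA: "[mono_map id d N \<circ> A] \<in> M_seqs"
    by (rule one_term_comp[OF one_block_in_M_seqs[OF permutes_id d(1)] A])
  have "proj_seq [A \<circ> mono_map id e N] = proj_seq [mono_map id d N \<circ> A]"
    using eq unfolding bclass_one_block mult_PGL[OF vlinear_mono_map] mult_PGL[OF lin] by simp
  from proj_seq_eqD(3)[OF this DA, of 0]
  obtain c where c: "\<And>x. mono_map id d N (A x) = c *s A (mono_map id e N x)" by auto
  have eig: "(d k - c * e i) * coord (A (b i)) k = 0" if i: "i \<in> N" and k: "k \<in> N" for i k
  proof -
    have 1: "coord (mono_map id d N (A (b i))) (id k) = d k * coord (A (b i)) k"
      using coord_mono_map[OF permutes_id order_refl k] k by simp
    have 2: "mono_map id d N (A (b i)) = (c * e i) *s A (b i)"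
      unfolding c using i by (simp add: mono_map_basis lin2 vector_smult_assoc)
    have "d k * coord (A (b i)) k = c * e i * coord (A (b i)) k"
      using 1 unfolding 2 coord_scale id_apply by (rule sym)
    then show ?thesis unfolding left_diff_distrib by (simp only: diff_self)
  qed
  have "\<forall>i\<in>N. \<exists>k\<in>N. coord (A (b i)) k \<noteq> 0"
  proof (rule ballI, rule ccontr)
    fix i assume i: "i \<in> N" and "\<not> (\<exists>k\<in>N. coord (A (b i)) k \<noteq> 0)"
    then have "A (b i) = 0" by (intro eq_coordI) simp
    then show False using ker b_nonzero[OF i] by blast
  qed
  then obtain s where s: "\<And>i. i \<in> N \<Longrightarrow> s i \<in> N \<and> coord (A (b i)) (s i) \<noteq> 0" by metis
  define a where "a i = coord (A (b i)) (s i)" for i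
  have Ab: "A (b i) = a i *s b (s i)" if i: "i \<in> N" for i
  proof (rule eq_coordI)
    fix k assume k: "k \<in> N"
    have "coord (A (b i)) k = 0" if "k \<noteq> s i"
    proof -
      have "d (s i) = c * e i" using eig[OF i, of "s i"] s[OF i] by auto
      moreover have "d k \<noteq> d (s i)" using d(2) k s[OF i] that unfolding inj_on_def by blast
      ultimately show ?thesis using eig[OF i k] by simp
    qed
    then show "coord (A (b i)) k = coord (a i *s b (s i)) k"
      unfolding a_def using s[OF i] k by (auto simp: coord_basis)
  qed
  have a_nz: "a i \<noteq> 0" if "i \<in> N" for i using s[OF that] unfolding a_def by blast
  have inj: "inj_on s N"
  proof (rule inj_onI, rule ccontr)
    fix i j assume ij: "i \<in> N" "j \<in> N" "s i = s j" "i \<noteq> j"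
    have "A (a j *s b i + (- a i) *s b j) = 0"
      unfolding lin2 Ab[OF ij(1)] Ab[OF ij(2)] ij(3)
      by (simp add: vector_smult_assoc mult.commute vector_sadd_rdistrib[symmetric])
    then have "a j *s b i + (- a i) *s b j = 0" by (rule ker)
    then have "coord (a j *s b i + (- a i) *s b j) i = 0" by simp
    then show False using ij a_nz by (simp add: coord_basis)
  qed
  define \<sigma> where "\<sigma> i = (if i \<in> N then s i else i)" for i
  have "s ` N = N" using inj s by (intro endo_inj_surj finite_N) auto
  then have "bij_betw s N N" using inj unfolding bij_betw_def by blast
  then have "bij_betw \<sigma> N N" using bij_betw_cong[of N s \<sigma> N] unfolding \<sigma>_def by simp
  then have "\<sigma> permutes N" by (rule bij_imp_permutes) (simp add: \<sigma>_def)
  moreover have "nonvanishing a" using a_nz unfolding nonvanishing_def by blast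
  moreover have "A = mono_map \<sigma> a N" using Ab by (intro mono_map_unique lin) (simp add: \<sigma>_def)
  ultimately show ?thesis unfolding monomial_classes_def bclass_one_block by blast
qed

text \<open>Conjugation by a monomial class permutes the coefficients of diagonal classes.\<close>

lemma normalizer_diagonal: "normalizer PGL diagonal_classes = monomial_classes"
proof -
  have sub: "diagonal_classes \<subseteq> carrier PGL" by (rule subgroup.subset[OF subgroup_diagonal])
  have conj: "g <#\<^bsub>PGL\<^esub> diagonal_classes #>\<^bsub>PGL\<^esub> inv\<^bsub>PGL\<^esub> g =
      (\<lambda>t. g \<otimes>\<^bsub>PGL\<^esub> t \<otimes>\<^bsub>PGL\<^esub> inv\<^bsub>PGL\<^esub> g) ` diagonal_classes" for g
    unfolding l_coset_def r_coset_def by auto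
  have norm: "normalizer PGL diagonal_classes = {g \<in> carrier PGL.
      (\<lambda>t. g \<otimes>\<^bsub>PGL\<^esub> t \<otimes>\<^bsub>PGL\<^esub> inv\<^bsub>PGL\<^esub> g) ` diagonal_classes = diagonal_classes}"
    unfolding normalizer_def stabilizer_def using sub conj by simp
  show ?thesis
    unfolding norm
  proof (intro equalityI subsetI)
    fix g assume g: "g \<in> {g \<in> carrier PGL.
      (\<lambda>t. g \<otimes>\<^bsub>PGL\<^esub> t \<otimes>\<^bsub>PGL\<^esub> inv\<^bsub>PGL\<^esub> g) ` diagonal_classes = diagonal_classes}"
    then obtain A where A: "g = proj_seq [A]" "[A] \<in> M_seqs" unfolding carrier_PGL by blast
    interpret PGL: group "PGL :: 'n vmap set list monoid" by (rule group_PGL)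
    \<comment> \<open>the coefficients \<open>1, \<dots>, n\<close> are nonzero and distinct\<close>
    let ?d = "\<lambda>i. of_nat i :: complex"
    have d: "nonvanishing ?d" "inj_on ?d N" unfolding nonvanishing_def inj_on_def
      by (auto simp: in_N_iff)
    have "bclass [N] id ?d \<in> diagonal_classes" unfolding diagonal_classes_def using d(1) by blast
    then obtain t where t: "t \<in> diagonal_classes" "bclass [N] id ?d = g \<otimes>\<^bsub>PGL\<^esub> t \<otimes>\<^bsub>PGL\<^esub> inv\<^bsub>PGL\<^esub> g"
      using g by blast
    have gt: "g \<in> carrier PGL" "t \<in> carrier PGL" using g t(1) sub by auto
    then have "bclass [N] id ?d \<otimes>\<^bsub>PGL\<^esub> g = g \<otimes>\<^bsub>PGL\<^esub> t"
      unfolding t(2) by (simp add: PGL.m_assoc)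
    then show "g \<in> monomial_classes"
      using monomial_if_normalizes[OF A(2) d] t(1) unfolding A(1) diagonal_classes_def by blast
  next
    fix g assume "g \<in> monomial_classes"
    then obtain \<sigma> d where g: "g = bclass [N] \<sigma> d" and \<sigma>: "\<sigma> permutes N" and d: "nonvanishing d"
      unfolding monomial_classes_def by blast
    let ?i = "inv_into UNIV \<sigma>"
    note inv = permutes_inv[OF \<sigma>]
    have conj_eq: "g \<otimes>\<^bsub>PGL\<^esub> bclass [N] id e \<otimes>\<^bsub>PGL\<^esub> inv\<^bsub>PGL\<^esub> g = bclass [N] id (\<lambda>i. e (?i i))"
      if e: "nonvanishing e" for e
      unfolding g conjugate_diagonal[OF \<sigma> d]
    proof (rule bclass_cong[OF N_in_OP permutes_id, symmetric])
      show "nonvanishing (\<lambda>i. e (?i i))" by (rule nonvanishing_comp[OF inv e])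
      show "e (?i i) = d (?i i) * e (?i i) * (1 / d (?i i))" if "i \<in> N" for i
        using nonvanishing_comp[OF inv d] that unfolding nonvanishing_def by simp
    qed
    have "(\<lambda>t. g \<otimes>\<^bsub>PGL\<^esub> t \<otimes>\<^bsub>PGL\<^esub> inv\<^bsub>PGL\<^esub> g) ` diagonal_classes = diagonal_classes"
    proof (intro equalityI subsetI)
      fix t assume "t \<in> (\<lambda>t. g \<otimes>\<^bsub>PGL\<^esub> t \<otimes>\<^bsub>PGL\<^esub> inv\<^bsub>PGL\<^esub> g) ` diagonal_classes"
      then show "t \<in> diagonal_classes"
        unfolding diagonal_classes_def using conj_eq nonvanishing_comp[OF inv] by blast
    next
      fix t assume "t \<in> diagonal_classes"
      then obtain e where e: "t = bclass [N] id e" "nonvanishing e" unfolding diagonal_classes_def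
        by blast
      have ne: "nonvanishing (\<lambda>i. e (\<sigma> i))" by (rule nonvanishing_comp[OF \<sigma> e(2)])
      have "g \<otimes>\<^bsub>PGL\<^esub> bclass [N] id (\<lambda>i. e (\<sigma> i)) \<otimes>\<^bsub>PGL\<^esub> inv\<^bsub>PGL\<^esub> g = t"
        unfolding conj_eq[OF ne] e(1) permutes_inverses(1)[OF \<sigma>] ..
      then show "t \<in> (\<lambda>t. g \<otimes>\<^bsub>PGL\<^esub> t \<otimes>\<^bsub>PGL\<^esub> inv\<^bsub>PGL\<^esub> g) ` diagonal_classes"
        using ne unfolding diagonal_classes_def by blast
    qed
    then show "g \<in> {g \<in> carrier PGL.
      (\<lambda>t. g \<otimes>\<^bsub>PGL\<^esub> t \<otimes>\<^bsub>PGL\<^esub> inv\<^bsub>PGL\<^esub> g) ` diagonal_classes = diagonal_classes}"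
      using bclass_in_PGL[OF \<sigma> d] g by simp
  qed
qed

section \<open>The quotient by the torus\<close>

text \<open>All coefficient vectors for a given partition and permutation; these sets turn out to be
  the cosets of the torus.\<close>

definition orbit :: "nat set list \<Rightarrow> (nat \<Rightarrow> nat) \<Rightarrow> 'n vmap set list set" where
  "orbit p \<sigma> = {bclass p \<sigma> d | d. nonvanishing d}"

lemma orbit_inj:
  assumes "p \<in> OP" "\<sigma> permutes N" "p' \<in> OP" "\<sigma>' permutes N" "orbit p \<sigma> = orbit p' \<sigma>'"
  shows "p = p'" "\<sigma> = \<sigma>'"
proof -
  have "bclass p \<sigma> (\<lambda>_. 1) \<in> orbit p' \<sigma>'"
    using assms(5) nonvanishing_one unfolding orbit_def by blast
  then obtain d where "nonvanishing d" "bclass p \<sigma> (\<lambda>_. 1) = bclass p' \<sigma>' d" unfolding orbit_def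
    by blast
  then show "p = p'" "\<sigma> = \<sigma>'"
    using bclass_eqD(1,2)[OF assms(1,2) nonvanishing_one assms(3,4)] by auto
qed

lemma carrier_normalizer_closure:
  "carrier (normalizer_closure E diagonal_classes) =
   {bclass p \<sigma> d | p \<sigma> d. p \<in> OP \<and> \<sigma> permutes N \<and> nonvanishing d}"
  unfolding normalizer_closure_def normalizer_diagonal monomial_classes_def
  using closure_one_block by simp

lemma mult_normalizer_closure: "P \<otimes>\<^bsub>normalizer_closure E T\<^esub> Q = PM_mult E P Q"
  unfolding normalizer_closure_def by simp

text \<open>Every coefficient vector of the product is reached by putting it, transported by
  \<open>\<tau>\<^sup>-\<^sup>1\<close>, into the first factor.\<close>

lemma set_mult_orbits:
  assumes p: "p \<in> OP" "\<sigma> permutes N" and q: "q \<in> OP" "\<tau> permutes N"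
  shows "(\<Union>P\<in>orbit p \<sigma>. \<Union>Q\<in>orbit q \<tau>. {PM_mult E P Q}) =
    orbit (partition_mult (phi_map \<tau> p) q) (\<sigma> \<circ> \<tau>)"
proof (intro equalityI subsetI)
  fix R assume "R \<in> (\<Union>P\<in>orbit p \<sigma>. \<Union>Q\<in>orbit q \<tau>. {PM_mult E P Q})"
  then obtain d d'
    where d: "nonvanishing d" "nonvanishing d'" "R = PM_mult E (bclass p \<sigma> d) (bclass q \<tau> d')"
    unfolding orbit_def by blast
  have "nonvanishing (\<lambda>i. d (\<tau> i) * d' i)"
    by (rule nonvanishing_mult[OF nonvanishing_comp[OF q(2) d(1)] d(2)])
  then show "R \<in> orbit (partition_mult (phi_map \<tau> p) q) (\<sigma> \<circ> \<tau>)"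
    unfolding d(3) PM_mult_bclass[OF p d(1) q d(2)] orbit_def by blast
next
  fix R assume "R \<in> orbit (partition_mult (phi_map \<tau> p) q) (\<sigma> \<circ> \<tau>)"
  then obtain e where e: "nonvanishing e" "R = bclass (partition_mult (phi_map \<tau> p) q) (\<sigma> \<circ> \<tau>) e"
    unfolding orbit_def by blast
  let ?d = "\<lambda>i. e (inv_into UNIV \<tau> i)"
  have d: "nonvanishing ?d" by (rule nonvanishing_comp[OF permutes_inv[OF q(2)] e(1)])
  have "PM_mult E (bclass p \<sigma> ?d) (bclass q \<tau> (\<lambda>_. 1)) = R"
    unfolding PM_mult_bclass[OF p d q nonvanishing_one] e(2) permutes_inverses(2)[OF q(2)] by simp
  then show "R \<in> (\<Union>P\<in>orbit p \<sigma>. \<Union>Q\<in>orbit q \<tau>. {PM_mult E P Q})"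
    using d nonvanishing_one unfolding orbit_def by blast
qed

lemma diagonal_orbit: "diagonal_classes = orbit [N] id"
  unfolding diagonal_classes_def orbit_def ..

lemma coset_orbit:
  assumes "p \<in> OP" "\<sigma> permutes N" "nonvanishing d"
  shows "diagonal_classes #>\<^bsub>normalizer_closure E diagonal_classes\<^esub> bclass p \<sigma> d = orbit p \<sigma>"
proof -
  have one: "partition_mult (phi_map \<sigma> [N]) p = p"
  proof -
    have "\<sigma> permutes {1..card N}" using assms(2) by (simp only: N_card)
    then show ?thesis
      using phi_map_one[of \<sigma> "card N"] partition_mult_one_left[OF assms(1)] by (simp only: N_card)
  qed
  have mult: "PM_mult E (bclass [N] id e) (bclass p \<sigma> d) = bclass p \<sigma> (\<lambda>i. e (\<sigma> i) * d i)"
    if "nonvanishing e" for e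
    unfolding PM_mult_bclass[OF N_in_OP permutes_id that assms] one by simp
  have "(\<Union>P\<in>orbit [N] id. {PM_mult E P (bclass p \<sigma> d)}) = orbit p \<sigma>"
  proof (intro equalityI subsetI)
    fix R assume "R \<in> (\<Union>P\<in>orbit [N] id. {PM_mult E P (bclass p \<sigma> d)})"
    then obtain e where e: "nonvanishing e" "R = PM_mult E (bclass [N] id e) (bclass p \<sigma> d)"
      unfolding orbit_def by blast
    have "nonvanishing (\<lambda>i. e (\<sigma> i) * d i)"
      by (rule nonvanishing_mult[OF nonvanishing_comp[OF assms(2) e(1)] assms(3)])
    then show "R \<in> orbit p \<sigma>" unfolding e(2) mult[OF e(1)] orbit_def by blast
  next
    fix R assume "R \<in> orbit p \<sigma>"
    then obtain e where e: "nonvanishing e" "R = bclass p \<sigma> e" unfolding orbit_def by blast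
    let ?e = "\<lambda>i. e (inv_into UNIV \<sigma> i) / d (inv_into UNIV \<sigma> i)"
    have ne: "nonvanishing ?e"
      by (rule nonvanishing_divide[OF nonvanishing_comp[OF permutes_inv[OF assms(2)] e(1)]
            nonvanishing_comp[OF permutes_inv[OF assms(2)] assms(3)]])
    have "PM_mult E (bclass [N] id ?e) (bclass p \<sigma> d) = bclass p \<sigma> e"
      unfolding mult[OF ne]
    proof (rule bclass_cong[OF assms(1,2), symmetric])
      show "nonvanishing e" by (rule e(1))
      show "e i = ?e (\<sigma> i) * d i" if "i \<in> N" for i
        using assms(3) that permutes_inverses(2)[OF assms(2)] unfolding nonvanishing_def by simp
    qed
    then have "R = PM_mult E (bclass [N] id ?e) (bclass p \<sigma> d)" using e(2) by simp
    then show "R \<in> (\<Union>P\<in>orbit [N] id. {PM_mult E P (bclass p \<sigma> d)})"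
      using ne unfolding orbit_def by blast
  qed
  then show ?thesis unfolding r_coset_def mult_normalizer_closure diagonal_orbit .
qed

lemma orbit_iso:
  "(\<lambda>(p, \<sigma>). orbit p \<sigma>) \<in> iso (partition_perm_monoid (card N)) (R_monoid E diagonal_classes)"
proof -
  let ?G = "partition_perm_monoid (card N)"
  let ?f = "\<lambda>(p, \<sigma>). orbit p \<sigma>"
  have carG: "carrier ?G = OP \<times> {\<sigma>. \<sigma> permutes N}"
    unfolding partition_perm_monoid_def by (simp only: N_card partial_object.select_convs)
  have carR: "carrier (R_monoid E diagonal_classes) = ?f ` carrier ?G"
  proof (intro equalityI subsetI)
    fix X assume "X \<in> carrier (R_monoid E diagonal_classes)"
    then obtain p \<sigma> d where "p \<in> OP" "\<sigma> permutes N" "nonvanishing d"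
      "X = diagonal_classes #>\<^bsub>normalizer_closure E diagonal_classes\<^esub> bclass p \<sigma> d"
      unfolding R_monoid_def carrier_FactGroup carrier_normalizer_closure by blast
    then show "X \<in> ?f ` carrier ?G" using coset_orbit unfolding carG by auto
  next
    fix X assume "X \<in> ?f ` carrier ?G"
    then obtain p \<sigma> where p: "p \<in> OP" "\<sigma> permutes N" "X = orbit p \<sigma>" unfolding carG by auto
    then have "X = diagonal_classes #>\<^bsub>normalizer_closure E diagonal_classes\<^esub> bclass p \<sigma> (\<lambda>_. 1)"
      using coset_orbit[OF p(1,2) nonvanishing_one] by simp
    then show "X \<in> carrier (R_monoid E diagonal_classes)"
      unfolding R_monoid_def carrier_FactGroup carrier_normalizer_closure
      using p(1,2) nonvanishing_one by blast
  qed
  have "?f \<in> hom ?G (R_monoid E diagonal_classes)"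
  proof (rule homI)
    show "?f x \<in> carrier (R_monoid E diagonal_classes)" if "x \<in> carrier ?G" for x
      using that unfolding carR by blast
    fix x y assume "x \<in> carrier ?G" "y \<in> carrier ?G"
    then obtain p \<sigma> q \<tau> where x: "x = (p, \<sigma>)" "p \<in> OP" "\<sigma> permutes N"
      and y: "y = (q, \<tau>)" "q \<in> OP" "\<tau> permutes N" unfolding carG by blast
    have "?f (x \<otimes>\<^bsub>?G\<^esub> y) = orbit (partition_mult (phi_map \<tau> p) q) (\<sigma> \<circ> \<tau>)"
      unfolding x(1) y(1) partition_perm_monoid_def by simp
    also have "\<dots> = orbit p \<sigma> \<otimes>\<^bsub>R_monoid E diagonal_classes\<^esub> orbit q \<tau>"
      unfolding R_monoid_def mult_FactGroup set_mult_def mult_normalizer_closure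
      using set_mult_orbits[OF x(2,3) y(2,3)] by simp
    finally show "?f (x \<otimes>\<^bsub>?G\<^esub> y) = ?f x \<otimes>\<^bsub>R_monoid E diagonal_classes\<^esub> ?f y"
      unfolding x(1) y(1) by simp
  qed
  moreover have "inj_on ?f (carrier ?G)"
    unfolding carG by (rule inj_onI) (use orbit_inj in auto)
  ultimately show ?thesis unfolding iso_def bij_betw_def carR by blast
qed

lemma orbit_one:
  "(\<lambda>(p, \<sigma>). orbit p \<sigma>) \<one>\<^bsub>partition_perm_monoid (card N)\<^esub> = \<one>\<^bsub>R_monoid E diagonal_classes\<^esub>"
proof -
  have "\<one>\<^bsub>partition_perm_monoid (card N)\<^esub> = ([N], id)"
    unfolding partition_perm_monoid_def by (simp only: N_card monoid.select_convs)
  then show ?thesis unfolding R_monoid_def one_FactGroup diagonal_orbit by simp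
qed

end

lemma coordinates_exist:
  fixes E :: "(complex ^ 'n::finite) set"
  assumes "is_basis E" shows "\<exists>b. coordinates E b {1..CARD('n)}"
proof -
  have E: "vec.independent E" "vec.span E = UNIV" using assms unfolding is_basis_def by auto
  have "finite E" "card E = CARD('n)"
    using vec.indep_card_eq_dim_span[OF E(1)] unfolding E(2) vec_dim_card by auto
  then obtain b where "bij_betw b {1..CARD('n)} E" using ex_bij_betw_nat_finite_1[of E] by auto
  then show ?thesis using assms unfolding coordinates_def by blast
qed

theorem proposition3p8:
  fixes T :: "('n::finite) vmap set list set" and E :: "(complex ^ 'n) set"
  assumes "maximal_torus T" and "is_basis E" and "diagonal_in E T"
  shows "has_presentation (R_monoid E T) (generators CARD('n)) (relations CARD('n))"
proof -
  obtain b where "coordinates E b {1..CARD('n)}" using coordinates_exist[OF assms(2)] by blast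
  then interpret coordinates E b "{1..CARD('n)}" .
  have T: "T = diagonal_classes" by (rule maximal_torus_diagonal[OF assms(1,3)])
  have n: "card {1..CARD('n)} = CARD('n)" by simp
  have "has_presentation (partition_perm_monoid CARD('n)) (generators CARD('n)) (relations CARD('n))"
    by (rule partition_perm_monoid_presentation) (simp add: Suc_le_eq)
  then show ?thesis
    unfolding T by (rule has_presentation_iso[OF _ orbit_iso[unfolded n] orbit_one[unfolded n]])
qed

end
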